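(* Let $\Omega\subset\mathbb{R}^3$ be an open set with boundary $\Gamma=\partial\Omega$. Let $(E_n)_{n\in\mathbb{N}}$ be a sequence in $D(\operatorname{curl})$ and $E\in D(\operatorname{curl})$ with $E_n\rightharpoonup E$ weakly in the Hilbert space $D(\operatorname{curl})$, and let $(H_n)_{n\in\mathbb{N}}$ be a sequence in $D(\operatorname{div})$ and $H\in D(\operatorname{div})$ with $H_n\rightharpoonup H$ weakly in the Hilbert space $D(\operatorname{div})$. Then for all $\varphi\in\mathsf{C}^\infty_\Gamma(\Omega)$ $$\langle\varphi\,E_n,H_n\rangle_{\mathsf{L}^2(\Omega)}\to\langle\varphi\,E,H\rangle_{\mathsf{L}^2(\Omega)}\qquad\text{as } n\to\infty.$$ Here $\mathsf{C}^\infty_\Gamma(\Omega)$ may be replaced by $\mathsf{C}^{1}_\Gamma(\Omega)$ or even by $\mathsf{C}^{0,1}_\Gamma(\Omega)$. Moreover, the boundedness of $(E_n)$ and $(H_n)$ in local spaces is sufficient for the assertion to hold.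
   Context: $\mathsf{L}^2(\Omega)$ denotes the usual Lebesgue space of square integrable functions, or of $\mathbb{R}^3$-valued vector fields, on $\Omega$, with its standard inner product $\langle\cdot,\cdot\rangle_{\mathsf{L}^2(\Omega)}$. For an open set $\Omega\subset\mathbb{R}^3$, $D(\operatorname{curl})$ is the space of vector fields $E\in\mathsf{L}^2(\Omega)$ whose distributional $\operatorname{curl}E$ belongs to $\mathsf{L}^2(\Omega)$, and $D(\operatorname{div})$ is the space of vector fields $H\in\mathsf{L}^2(\Omega)$ whose distributional $\operatorname{div}H$ belongs to $\mathsf{L}^2(\Omega)$. No boundary conditions are imposed. Both are Hilbert spaces with the graph inner products, e.g. $\langle E,F\rangle_{D(\operatorname{curl})}=\langle E,F\rangle_{\mathsf{L}^2(\Omega)}+\langle\operatorname{curl}E,\operatorname{curl}F\rangle_{\mathsf{L}^2(\Omega)}$, and analogously for $\operatorname{div}$. "Local spaces" refers to the local versions of $D(\operatorname{curl})$ (for $(E_n)$) and $D(\operatorname{div})$ (for $(H_n)$), that is, the same spaces taken over open sets whose closure is a compact subset of $\Omega$. The spaces of cut-off functions are $$\mathsf{C}^\infty_{\Gamma}(\Omega):=\{\varphi|_\Omega:\varphi\in\mathsf{C}^\infty(\mathbb{R}^3),\ \operatorname{supp}\varphi\text{ compact},\ \operatorname{dist}(\operatorname{supp}\varphi,\Gamma)>0\},$$ and $\mathsf{C}^{1}_\Gamma(\Omega)$, $\mathsf{C}^{0,1}_\Gamma(\Omega)$ are defined in the same way with $\varphi\in\mathsf{C}^\infty(\mathbb{R}^3)$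 replaced by continuously differentiable, respectively Lipschitz continuous, functions; thus $\mathsf{C}^{0,1}_\Gamma(\Omega)$ consists of Lipschitz continuous functions vanishing in a neighbourhood of $\Gamma$. *)

theory Defs
  imports "HOL-Analysis.Analysis"
begin

section \<open>Functions of class C^k and cut-off functions\<close>

definition partial :: "'n \<Rightarrow> (real^'n \<Rightarrow> 'b::real_normed_vector) \<Rightarrow> real^'n \<Rightarrow> 'b" where
  "partial i f x = frechet_derivative f (at x) (axis i 1)"

primrec Ck :: "nat \<Rightarrow> (real^'n \<Rightarrow> 'b::real_normed_vector) \<Rightarrow> bool" where
  "Ck 0 f \<longleftrightarrow> continuous_on UNIV f"
| "Ck (Suc k) f \<longleftrightarrow> (\<forall>x. f differentiable (at x)) \<and> (\<forall>i. Ck k (partial i f))"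

definition smooth :: "(real^'n \<Rightarrow> 'b::real_normed_vector) \<Rightarrow> bool" where
  "smooth f \<longleftrightarrow> (\<forall>k. Ck k f)"

definition supp :: "('a::topological_space \<Rightarrow> 'b::zero) \<Rightarrow> 'a set" where
  "supp f = closure {x. f x \<noteq> 0}"

text \<open>
  Positive distance of two sets, where the distance to the empty set is infinite.
  (The constant \<^const>\<open>setdist\<close> is \<open>0\<close> if one of the sets is empty, so it would exclude
  the zero function and, for \<open>\<Omega> = UNIV\<close>, every function.)
\<close>

definition pos_dist :: "'a::metric_space set \<Rightarrow> 'a set \<Rightarrow> bool" where
  "pos_dist S T \<longleftrightarrow> (\<exists>\<delta>>0. \<forall>x\<in>S. \<forall>y\<in>T. \<delta> \<le> dist x y)"

definition cutoff ::
  "((real^'n \<Rightarrow> real) \<Rightarrow> bool) \<Rightarrow> (real^'n) set \<Rightarrow> (real^'n) set \<Rightarrow> (real^'n \<Rightarrow> real) set" where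
  "cutoff P \<Gamma> \<Omega> =
     {restrict \<phi> \<Omega> | \<phi>. P \<phi> \<and> compact (supp \<phi>) \<and> pos_dist (supp \<phi>) \<Gamma>}"

definition C_inf_cutoff :: "(real^'n) set \<Rightarrow> (real^'n) set \<Rightarrow> (real^'n \<Rightarrow> real) set" where
  "C_inf_cutoff \<Gamma> \<Omega> = cutoff smooth \<Gamma> \<Omega>"

definition C1_cutoff :: "(real^'n) set \<Rightarrow> (real^'n) set \<Rightarrow> (real^'n \<Rightarrow> real) set" where
  "C1_cutoff \<Gamma> \<Omega> = cutoff (Ck 1) \<Gamma> \<Omega>"

definition Lip_cutoff :: "(real^'n) set \<Rightarrow> (real^'n) set \<Rightarrow> (real^'n \<Rightarrow> real) set" where
  "Lip_cutoff \<Gamma> \<Omega> = cutoff (\<lambda>\<phi>. \<exists>L. L-lipschitz_on UNIV \<phi>) \<Gamma> \<Omega>"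

definition test_functions :: "(real^'n) set \<Rightarrow> (real^'n \<Rightarrow> 'b::real_normed_vector) set" where
  "test_functions \<Omega> = {\<psi>. smooth \<psi> \<and> compact (supp \<psi>) \<and> supp \<psi> \<subseteq> \<Omega>}"


section \<open>Square integrable functions and fields\<close>

text \<open>
  Elements of \<open>L2 \<Omega>\<close> are representatives: functions on the whole space whose values outside
  \<open>\<Omega>\<close> are irrelevant and which are not identified when they agree almost everywhere in \<open>\<Omega>\<close>.
  In particular, restriction to a smaller open set is implicit.
\<close>

definition L2 :: "'a::euclidean_space set \<Rightarrow> ('a \<Rightarrow> 'b::euclidean_space) set" where
  "L2 \<Omega> = {f. f \<in> borel_measurable (lebesgue_on \<Omega>) \<and>
               integrable (lebesgue_on \<Omega>) (\<lambda>x. (norm (f x))\<^sup>2)}"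

definition L2_inner ::
  "'a::euclidean_space set \<Rightarrow> ('a \<Rightarrow> 'b::euclidean_space) \<Rightarrow> ('a \<Rightarrow> 'b) \<Rightarrow> real" where
  "L2_inner \<Omega> f g = integral\<^sup>L (lebesgue_on \<Omega>) (\<lambda>x. f x \<bullet> g x)"


section \<open>Distributional curl and divergence\<close>

definition grad :: "(real^3 \<Rightarrow> real) \<Rightarrow> real^3 \<Rightarrow> real^3" where
  "grad \<psi> x = (\<chi> i. partial i \<psi> x)"

definition curl :: "(real^3 \<Rightarrow> real^3) \<Rightarrow> real^3 \<Rightarrow> real^3" where
  "curl \<Psi> x = vector
     [partial 2 (\<lambda>y. \<Psi> y $ 3) x - partial 3 (\<lambda>y. \<Psi> y $ 2) x,
      partial 3 (\<lambda>y. \<Psi> y $ 1) x - partial 1 (\<lambda>y. \<Psi> y $ 3) x,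
      partial 1 (\<lambda>y. \<Psi> y $ 2) x - partial 2 (\<lambda>y. \<Psi> y $ 1) x]"

definition has_weak_curl :: "(real^3) set \<Rightarrow> (real^3 \<Rightarrow> real^3) \<Rightarrow> (real^3 \<Rightarrow> real^3) \<Rightarrow> bool" where
  "has_weak_curl \<Omega> E G \<longleftrightarrow>
     (\<forall>\<Psi>\<in>test_functions \<Omega>. L2_inner \<Omega> G \<Psi> = L2_inner \<Omega> E (curl \<Psi>))"

definition has_weak_div :: "(real^3) set \<Rightarrow> (real^3 \<Rightarrow> real^3) \<Rightarrow> (real^3 \<Rightarrow> real) \<Rightarrow> bool" where
  "has_weak_div \<Omega> H g \<longleftrightarrow>
     (\<forall>\<psi>\<in>test_functions \<Omega>. L2_inner \<Omega> g \<psi> = - L2_inner \<Omega> H (grad \<psi>))"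

definition D_curl :: "(real^3) set \<Rightarrow> (real^3 \<Rightarrow> real^3) set" where
  "D_curl \<Omega> = {E \<in> L2 \<Omega>. \<exists>G\<in>L2 \<Omega>. has_weak_curl \<Omega> E G}"

definition D_div :: "(real^3) set \<Rightarrow> (real^3 \<Rightarrow> real^3) set" where
  "D_div \<Omega> = {H \<in> L2 \<Omega>. \<exists>g\<in>L2 \<Omega>. has_weak_div \<Omega> H g}"

text \<open>
  For open \<open>\<Omega>\<close> the weak curl and divergence are determined almost everywhere in \<open>\<Omega>\<close>, so
  the choice of representatives below does not affect any of the inner products.
\<close>

definition weak_curl :: "(real^3) set \<Rightarrow> (real^3 \<Rightarrow> real^3) \<Rightarrow> real^3 \<Rightarrow> real^3" where
  "weak_curl \<Omega> E = (SOME G. G \<in> L2 \<Omega> \<and> has_weak_curl \<Omega> E G)"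

definition weak_div :: "(real^3) set \<Rightarrow> (real^3 \<Rightarrow> real^3) \<Rightarrow> real^3 \<Rightarrow> real" where
  "weak_div \<Omega> H = (SOME g. g \<in> L2 \<Omega> \<and> has_weak_div \<Omega> H g)"

definition D_curl_inner ::
  "(real^3) set \<Rightarrow> (real^3 \<Rightarrow> real^3) \<Rightarrow> (real^3 \<Rightarrow> real^3) \<Rightarrow> real" where
  "D_curl_inner \<Omega> E F = L2_inner \<Omega> E F + L2_inner \<Omega> (weak_curl \<Omega> E) (weak_curl \<Omega> F)"

definition D_div_inner ::
  "(real^3) set \<Rightarrow> (real^3 \<Rightarrow> real^3) \<Rightarrow> (real^3 \<Rightarrow> real^3) \<Rightarrow> real" where
  "D_div_inner \<Omega> H K = L2_inner \<Omega> H K + L2_inner \<Omega> (weak_div \<Omega> H) (weak_div \<Omega> K)"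


section \<open>Weak convergence, boundedness and local spaces\<close>

text \<open>
  Weak convergence and boundedness in a Hilbert space with underlying set \<open>V\<close> and inner
  product \<open>ip\<close>; membership of the sequence and its limit in \<open>V\<close> is not included.
\<close>

definition weakly_converges ::
  "'v set \<Rightarrow> ('v \<Rightarrow> 'v \<Rightarrow> real) \<Rightarrow> (nat \<Rightarrow> 'v) \<Rightarrow> 'v \<Rightarrow> bool" where
  "weakly_converges V ip u l \<longleftrightarrow> (\<forall>v\<in>V. (\<lambda>n. ip (u n) v) \<longlonglongrightarrow> ip l v)"

definition norm_bounded :: "('v \<Rightarrow> 'v \<Rightarrow> real) \<Rightarrow> (nat \<Rightarrow> 'v) \<Rightarrow> bool" where
  "norm_bounded ip u \<longleftrightarrow> (\<exists>C. \<forall>n. sqrt (ip (u n) (u n)) \<le> C)"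

definition compactly_inside :: "'a::topological_space set \<Rightarrow> 'a set set" where
  "compactly_inside \<Omega> = {\<omega>. open \<omega> \<and> compact (closure \<omega>) \<and> closure \<omega> \<subseteq> \<Omega>}"

definition L2_loc :: "'a::euclidean_space set \<Rightarrow> ('a \<Rightarrow> 'b::euclidean_space) set" where
  "L2_loc \<Omega> = (\<Inter>\<omega>\<in>compactly_inside \<Omega>. L2 \<omega>)"

definition D_curl_loc :: "(real^3) set \<Rightarrow> (real^3 \<Rightarrow> real^3) set" where
  "D_curl_loc \<Omega> = (\<Inter>\<omega>\<in>compactly_inside \<Omega>. D_curl \<omega>)"

definition D_div_loc :: "(real^3) set \<Rightarrow> (real^3 \<Rightarrow> real^3) set" where
  "D_div_loc \<Omega> = (\<Inter>\<omega>\<in>compactly_inside \<Omega>. D_div \<omega>)"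

end

theory Submission
  imports Defs "HOL-Complex_Analysis.Great_Picard"
begin

text \<open>
  The heart is a quantitative estimate of a mollification error. Let \<open>v = \<phi> H\<close> with a smooth cut-off
  function \<open>\<phi>\<close>, so that \<open>g = div v\<close> is again square integrable, and let \<open>\<eta>\<^sub>e\<close> be a mollifier of product form.
  Replacing one factor at a time gives \<open>\<eta>\<^sub>e - \<eta>\<^sub>d = \<Sum>\<^sub>j \<partial>\<^sub>j \<kappa>\<^sub>j\<close> with test functions \<open>\<kappa>\<^sub>j\<close> whose L1 norm is at
  most \<open>2 e\<close> for \<open>d \<le> e\<close>. As \<open>\<partial>\<^sub>j \<kappa> * v = (\<kappa> * g) e\<^sub>j - curl (\<kappa> * (e\<^sub>j \<times> v))\<close> and the field under the
  curl is an admissible test field, letting \<open>d\<close> tend to \<open>0\<close> yields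
  \<open>\<bar>\<langle>E, \<eta>\<^sub>e * v\<rangle> - \<langle>E, v\<rangle>\<bar> \<le> 6 e (\<parallel>E\<parallel> \<parallel>div v\<parallel> + \<parallel>curl E\<parallel> \<parallel>v\<parallel>)\<close>.
  This is uniform along bounded sequences, while for fixed \<open>e\<close> convolution turns the weak convergence of \<open>H\<^sub>n\<close>
  into strong convergence. Continuous cut-off functions are uniform limits of smooth ones.
\<close>

section \<open>Semi-inner product spaces\<close>

text \<open>Neither sequence is compact in L2: a bound on the divergence alone controls no translate
  of \<open>H\<close>. So \<open>conv (mollifier e) v - v\<close> is not small in norm uniformly
  along the sequence, only when paired with a field whose curl is controlled. Nothing is asked of
  the boundary: it is enough that the closed balls of radius \<open>3 * e\<close> about the support
  of the cut-off stay in \<Omega>.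

  The second parameter \<open>d\<close> is forced by smoothness. For \<open>d = 0\<close> the
  primitive of a mollifier minus a point mass would jump, and convolving with it need not give a
  smooth test field. The bound must therefore be independent of \<open>d\<close>. The constant 6 is
  three coordinate directions times the L1 bound \<open>2 * e\<close>.

  Two abstract facts feed the estimate: weak convergence in a graph space gives bounded graph norms
  and weak convergence in L2; conversely, bounded graph norms place weak L2 limits in the graph
  space. Both are proved for semi-inner products, because the fields are never identified almost
  everywhere.\<close>

text \<open>
  The elements are representatives, so all vector space identities are only needed up to \<open>ip\<close>.
  The single operation \<open>lin a x b y\<close> stands for \<open>a x + b y\<close>.
\<close>

locale semi_hilbert =
  fixes V :: "'v set" and lin :: "real \<Rightarrow> 'v \<Rightarrow> real \<Rightarrow> 'v \<Rightarrow> 'v" and ip :: "'v \<Rightarrow> 'v \<Rightarrow> real"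
  assumes nonempty: "V \<noteq> {}"
    and lin_closed: "\<And>a x b y. x \<in> V \<Longrightarrow> y \<in> V \<Longrightarrow> lin a x b y \<in> V"
    and ip_sym: "\<And>x y. x \<in> V \<Longrightarrow> y \<in> V \<Longrightarrow> ip x y = ip y x"
    and ip_lin: "\<And>a x b y z. x \<in> V \<Longrightarrow> y \<in> V \<Longrightarrow> z \<in> V \<Longrightarrow> ip (lin a x b y) z = a * ip x z + b * ip y z"
    and ip_nonneg: "\<And>x. x \<in> V \<Longrightarrow> 0 \<le> ip x x"
    and complete: "\<And>f. (\<And>n. f n \<in> V) \<Longrightarrow>
      (\<And>e. e > 0 \<Longrightarrow> \<exists>N. \<forall>m\<ge>N. \<forall>n\<ge>N. ip (f m) (f m) - 2 * ip (f m) (f n) + ip (f n) (f n) < e) \<Longrightarrow>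
      \<exists>l\<in>V. (\<lambda>n. ip (f n) (f n) - 2 * ip (f n) l + ip l l) \<longlonglongrightarrow> 0"
begin

text \<open>This is the squared seminorm of \<open>x - y\<close> in expanded form, so that no
  subtraction on \<open>'v\<close> is needed; the completeness assumption of the locale is phrased
  in the same way.\<close>

definition dsq :: "'v \<Rightarrow> 'v \<Rightarrow> real" where
  "dsq x y = ip x x - 2 * ip x y + ip y y"

lemma ip_lin2: "x \<in> V \<Longrightarrow> y \<in> V \<Longrightarrow> z \<in> V \<Longrightarrow> ip z (lin a x b y) = a * ip z x + b * ip z y"
  using ip_lin[of x y z a b] ip_sym lin_closed by metis

lemma ip_lin_lin:
  assumes "x \<in> V" "y \<in> V"
  shows "ip (lin a x b y) (lin a x b y) = a\<^sup>2 * ip x x + 2 * a * b * ip x y + b\<^sup>2 * ip y y"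
  using assms by (simp add: ip_lin ip_lin2 lin_closed ip_sym[of y x] power2_eq_square algebra_simps)

lemma dsq_eq: "x \<in> V \<Longrightarrow> y \<in> V \<Longrightarrow> dsq x y = ip (lin 1 x (-1) y) (lin 1 x (-1) y)"
  by (simp add: ip_lin_lin dsq_def)

lemma dsq_nonneg: "x \<in> V \<Longrightarrow> y \<in> V \<Longrightarrow> 0 \<le> dsq x y"
  by (simp add: dsq_eq ip_nonneg lin_closed)

lemma Cauchy_Schwarz_sq:
  assumes "x \<in> V" "y \<in> V"
  shows "(ip x y)\<^sup>2 \<le> ip x x * ip y y"
proof -
  have q: "0 \<le> ip x x + 2 * t * ip x y + t\<^sup>2 * ip y y" for t
    using ip_nonneg[OF lin_closed[OF assms, of 1 t]] ip_lin_lin[OF assms, of 1 t] by simp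
  show ?thesis
  proof (cases "ip y y = 0")
    case True
    have "ip x y = 0"
    proof (rule ccontr)
      assume "ip x y \<noteq> 0"
      \<comment> \<open>For \<open>ip y y = 0\<close> the quadratic is affine in \<open>t\<close>.
        If its slope were non-zero, its value at this \<open>t\<close> would be
        \<open>-1\<close>.\<close>
      with q[of "- (ip x x + 1) / (2 * ip x y)"] True show False by (simp add: field_simps)
    qed
    with True show ?thesis by simp
  next
    case False
    then have pos: "ip y y > 0" using ip_nonneg[OF assms(2)] by simp
    have "0 \<le> ip y y * (ip x x + 2 * (- ip x y / ip y y) * ip x y + (- ip x y / ip y y)\<^sup>2 * ip y y)"
      using q[of "- ip x y / ip y y"] pos by (intro mult_nonneg_nonneg) auto
    also have "\<dots> = ip x x * ip y y - (ip x y)\<^sup>2"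
      using pos by (simp add: field_simps power2_eq_square)
    finally show ?thesis by simp
  qed
qed

lemma Cauchy_Schwarz:
  assumes "x \<in> V" "y \<in> V"
  shows "\<bar>ip x y\<bar> \<le> sqrt (ip x x) * sqrt (ip y y)"
  using real_sqrt_le_mono[OF Cauchy_Schwarz_sq[OF assms]] by (simp add: real_sqrt_mult)

lemma ip_diff_le:
  assumes "x \<in> V" "y \<in> V" "z \<in> V"
  shows "\<bar>ip x z - ip y z\<bar> \<le> sqrt (dsq x y) * sqrt (ip z z)"
  using Cauchy_Schwarz[OF lin_closed[OF assms(1,2), of 1 "-1"] assms(3)] assms
  by (simp add: ip_lin dsq_eq)

lemma sqrt_ip_triangle:
  assumes "x \<in> V" "y \<in> V"
  shows "sqrt (ip (lin a x b y) (lin a x b y)) \<le> \<bar>a\<bar> * sqrt (ip x x) + \<bar>b\<bar> * sqrt (ip y y)"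
proof (rule real_le_lsqrt)
  have "a * b * ip x y \<le> \<bar>a\<bar> * \<bar>b\<bar> * \<bar>ip x y\<bar>"
    by (metis abs_ge_self abs_mult)
  also have "\<dots> \<le> \<bar>a\<bar> * \<bar>b\<bar> * (sqrt (ip x x) * sqrt (ip y y))"
    by (intro mult_left_mono Cauchy_Schwarz assms) auto
  finally show "ip (lin a x b y) (lin a x b y) \<le> (\<bar>a\<bar> * sqrt (ip x x) + \<bar>b\<bar> * sqrt (ip y y))\<^sup>2"
    using assms ip_nonneg[of x] ip_nonneg[of y]
    by (simp add: ip_lin_lin power2_sum power_mult_distrib algebra_simps)
qed (use assms ip_nonneg in auto)

text \<open>In \<open>'v\<close> the combinations for p - r and (p - q) + (q - r) need not be the
  same element. Only their values under \<open>ip\<close> agree, so the identity is checked on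
  \<open>dsq\<close>.\<close>

lemma sqrt_dsq_triangle:
  assumes "p \<in> V" "q \<in> V" "r \<in> V"
  shows "sqrt (dsq p r) \<le> sqrt (dsq p q) + sqrt (dsq q r)"
proof -
  have "dsq p r = ip (lin 1 (lin 1 p (-1) q) 1 (lin 1 q (-1) r)) (lin 1 (lin 1 p (-1) q) 1 (lin 1 q (-1) r))"
    using assms by (simp add: ip_lin ip_lin2 lin_closed dsq_def algebra_simps
        ip_sym[of q p] ip_sym[of r p] ip_sym[of r q])
  then show ?thesis
    using sqrt_ip_triangle[of "lin 1 p (-1) q" "lin 1 q (-1) r" 1 1] assms by (simp add: dsq_eq lin_closed)
qed

lemma dsq_commute: "x \<in> V \<Longrightarrow> y \<in> V \<Longrightarrow> dsq x y = dsq y x"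
  by (simp add: dsq_def ip_sym[of x y])

lemma tendsto_ip:
  assumes "\<And>n. f n \<in> V" "l \<in> V" "z \<in> V" "(\<lambda>n. dsq (f n) l) \<longlonglongrightarrow> 0"
  shows "(\<lambda>n. ip (f n) z) \<longlonglongrightarrow> ip l z"
proof (rule LIM_zero_cancel, rule Lim_null_comparison)
  show "\<forall>\<^sub>F n in sequentially. norm (ip (f n) z - ip l z) \<le> sqrt (dsq (f n) l) * sqrt (ip z z)"
    using ip_diff_le assms by simp
  have "(\<lambda>n. sqrt (dsq (f n) l) * sqrt (ip z z)) \<longlonglongrightarrow> sqrt 0 * sqrt (ip z z)"
    by (intro tendsto_intros assms)
  then show "(\<lambda>n. sqrt (dsq (f n) l) * sqrt (ip z z)) \<longlonglongrightarrow> 0" by simp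
qed

text \<open>
  The representing element is the limit of a minimising sequence of \<open>ip s s - 2 * l s\<close> in \<open>S\<close>,
  which is Cauchy by the parallelogram identity.
\<close>

theorem Riesz:
  assumes S: "S \<subseteq> V" "S \<noteq> {}" "\<And>a x b y. x \<in> S \<Longrightarrow> y \<in> S \<Longrightarrow> lin a x b y \<in> S"
    and l: "\<And>a x b y. x \<in> S \<Longrightarrow> y \<in> S \<Longrightarrow> l (lin a x b y) = a * l x + b * l y"
    and bd: "\<And>x. x \<in> S \<Longrightarrow> (l x)\<^sup>2 \<le> C * ip x x" and "C \<ge> 0"
  shows "\<exists>u f. u \<in> V \<and> (\<forall>n. f n \<in> S) \<and> (\<lambda>n. dsq (f n) u) \<longlonglongrightarrow> 0 \<and> (\<forall>s\<in>S. ip u s = l s)"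
proof -
  define J where "J s = ip s s - 2 * l s" for s
  have SV: "x \<in> S \<Longrightarrow> x \<in> V" for x using S by auto
  have below: "- C \<le> J s" if "s \<in> S" for s
  proof -
    have q: "ip s s \<ge> 0" using that SV ip_nonneg by blast
    have "(2 * l s)\<^sup>2 \<le> (C + ip s s)\<^sup>2"
    proof -
      have "(2 * l s)\<^sup>2 \<le> 4 * (C * ip s s)" using bd[OF that] by (simp add: power_mult_distrib)
      also have "\<dots> \<le> (C + ip s s)\<^sup>2"
        using zero_le_power2[of "C - ip s s"] by (simp add: power2_eq_square algebra_simps)
      finally show ?thesis .
    qed
    then have "2 * l s \<le> C + ip s s"
      using q \<open>C \<ge> 0\<close> by (intro power2_le_imp_le[of "2 * l s"]) auto
    then show ?thesis by (simp add: J_def)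
  qed
  define m where "m = Inf (J ` S)"
  have bdd: "bdd_below (J ` S)" using below by (auto intro!: bdd_belowI[of _ "-C"])
  have m: "m \<le> J s" if "s \<in> S" for s
    unfolding m_def using bdd that by (intro cInf_lower) auto
  have "\<exists>s\<in>S. J s < m + 1 / real (Suc n)" for n
  proof -
    have "m < m + 1 / real (Suc n)" by simp
    then show ?thesis
      using cInf_lessD[of "J ` S"] S(2) unfolding m_def by blast
  qed
  then obtain f where f: "\<And>n. f n \<in> S" and fm: "\<And>n. J (f n) < m + 1 / real (Suc n)"
    by metis
  have Cau: "dsq (f n) (f k) < 2 / real (Suc n) + 2 / real (Suc k)" for n k
  proof -
    have mid: "lin (1/2) (f n) (1/2) (f k) \<in> S" using f S by blast
    have "dsq (f n) (f k) = 2 * J (f n) + 2 * J (f k) - 4 * J (lin (1/2) (f n) (1/2) (f k))"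
      using f[of n] f[of k] SV
      by (simp add: J_def l ip_lin_lin dsq_def power2_eq_square algebra_simps)
    also have "\<dots> < 2 * (1 / real (Suc n)) + 2 * (1 / real (Suc k))"
      using fm[of n] fm[of k] m[OF mid] by argo
    finally show ?thesis by simp
  qed
  have "\<exists>u\<in>V. (\<lambda>n. ip (f n) (f n) - 2 * ip (f n) u + ip u u) \<longlonglongrightarrow> 0"
  proof (rule complete)
    fix e :: real assume "e > 0"
    then obtain N where N: "1 / real (Suc N) < e / 4"
      using nat_approx_posE[of "e/4"] by auto
    have "dsq (f a) (f b) < e" if "N \<le> a" "N \<le> b" for a b
    proof -
      have "1 / real (Suc a) \<le> 1 / real (Suc N)" "1 / real (Suc b) \<le> 1 / real (Suc N)"
        using that by (auto simp: field_simps)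
      then show ?thesis using Cau[of a b] N by simp
    qed
    then show "\<exists>N. \<forall>m\<ge>N. \<forall>n\<ge>N. ip (f m) (f m) - 2 * ip (f m) (f n) + ip (f n) (f n) < e"
      unfolding dsq_def by blast
  qed (use f SV in auto)
  then obtain u where u: "u \<in> V" and lim: "(\<lambda>n. dsq (f n) u) \<longlonglongrightarrow> 0"
    unfolding dsq_def by auto
  have "ip u s = l s" if s: "s \<in> S" for s
  proof -
    \<comment> \<open>First variation at the minimum. The limit \<open>u\<close> need not lie in
      \<open>S\<close>, where \<open>J\<close> is controlled, so the inequality is written for
      \<open>f n\<close> and passed to the limit.\<close>
    have q: "0 \<le> t\<^sup>2 * ip s s + 2 * t * (ip u s - l s)" for t
    proof (rule LIMSEQ_le)
      have "(\<lambda>n. 1 / real (Suc n)) \<longlonglongrightarrow> 0" using lim_1_over_n LIMSEQ_Suc by blast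
      then show "(\<lambda>n. - (1 / real (Suc n))) \<longlonglongrightarrow> 0" using tendsto_minus by fastforce
      show "(\<lambda>n. t\<^sup>2 * ip s s + 2 * t * (ip (f n) s - l s)) \<longlonglongrightarrow> t\<^sup>2 * ip s s + 2 * t * (ip u s - l s)"
        by (intro tendsto_intros tendsto_ip lim u) (use f s SV in auto)
      have "- (1 / real (Suc n)) \<le> t\<^sup>2 * ip s s + 2 * t * (ip (f n) s - l s)" for n
      proof -
        have "m \<le> J (lin 1 (f n) t s)" using m S f s by blast
        also have "\<dots> = J (f n) + (t\<^sup>2 * ip s s + 2 * t * (ip (f n) s - l s))"
          using f[of n] s SV by (simp add: J_def l ip_lin_lin algebra_simps)
        finally show ?thesis using fm[of n] by linarith
      qed
      then show "\<exists>N. \<forall>n\<ge>N. - (1 / real (Suc n)) \<le> t\<^sup>2 * ip s s + 2 * t * (ip (f n) s - l s)" by blast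
    qed
    define d where "d = ip u s - l s"
    \<comment> \<open>The added 1 keeps the denominator of the optimal \<open>t = - d / p\<close>
      positive even if \<open>ip s s = 0\<close>.\<close>
    define p where "p = ip s s + 1"
    have p: "p > 0" unfolding p_def using ip_nonneg s SV by force
    have "0 \<le> (- d / p)\<^sup>2 * ip s s + 2 * (- d / p) * d" using q[of "- d / p"] d_def by simp
    also have "\<dots> \<le> (- d / p)\<^sup>2 * p + 2 * (- d / p) * d"
      unfolding p_def by (intro add_right_mono mult_left_mono) auto
    also have "\<dots> = - (d\<^sup>2 / p)" using p by (simp add: field_simps power2_eq_square)
    finally have "d\<^sup>2 \<le> 0" using p by (simp add: field_simps)
    then show ?thesis unfolding d_def by simp
  qed
  with u f lim show ?thesis by blast
qed

section \<open>Weak compactness, uniform boundedness and tests for weak convergence\<close>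

theorem weakly_compact:
  assumes f: "\<And>n. f n \<in> V" and B: "\<And>n. ip (f n) (f n) \<le> B"
  obtains r u where "strict_mono (r :: nat \<Rightarrow> nat)" "u \<in> V"
    "\<And>w. w \<in> V \<Longrightarrow> (\<lambda>n. ip (f (r n)) w) \<longlonglongrightarrow> ip u w"
proof -
  have B0: "0 \<le> B" using B[of 0] ip_nonneg[OF f[of 0]] by linarith
  have sB: "sqrt (ip (f n) (f n)) \<le> sqrt B" for n using B by simp
  have "norm (ip (f n) (f m)) \<le> B" for n m
  proof -
    have "\<bar>ip (f n) (f m)\<bar> \<le> sqrt B * sqrt B"
      using Cauchy_Schwarz[OF f f, of n m] mult_mono[OF sB[of n] sB[of m]] ip_nonneg[OF f] B0
      by auto
    then show ?thesis using B0 by simp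
  qed
  note le_B = this
  obtain r where r: "strict_mono (r :: nat \<Rightarrow> nat)"
    and conv: "\<And>m. \<exists>c. (\<lambda>n. ip (f (r n)) (f m)) \<longlonglongrightarrow> c"
    by (rule function_convergent_subsequence[of "UNIV :: nat set" "\<lambda>n m. ip (f n) (f m)" B])
      (use le_B in auto)
  define S where "S = {s \<in> V. convergent (\<lambda>n. ip (f (r n)) s)}"
  define l where "l s = lim (\<lambda>n. ip (f (r n)) s)" for s
  have lim: "(\<lambda>n. ip (f (r n)) s) \<longlonglongrightarrow> l s" if "s \<in> S" for s
    using that by (simp add: S_def l_def convergent_LIMSEQ_iff)
  have fS: "f m \<in> S" for m using conv f by (auto simp: S_def convergent_def)
  have SV: "S \<subseteq> V" by (auto simp: S_def)
  have Slin: "lin a x b y \<in> S \<and> l (lin a x b y) = a * l x + b * l y" if "x \<in> S" "y \<in> S" for a x b y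
  proof -
    have "(\<lambda>n. a * ip (f (r n)) x + b * ip (f (r n)) y) \<longlonglongrightarrow> a * l x + b * l y"
      by (intro tendsto_intros lim that)
    moreover have "ip (f (r n)) (lin a x b y) = a * ip (f (r n)) x + b * ip (f (r n)) y" for n
      using that SV f by (intro ip_lin2) auto
    ultimately have *: "(\<lambda>n. ip (f (r n)) (lin a x b y)) \<longlonglongrightarrow> a * l x + b * l y" by simp
    then have "lin a x b y \<in> S"
      using that SV lin_closed unfolding S_def convergent_def by blast
    with lim[OF this] * show ?thesis using LIMSEQ_unique by blast
  qed
  note Sl = Slin[THEN conjunct1] and ll = Slin[THEN conjunct2]
  \<comment> \<open>The bound \<open>B\<close> makes \<open>ip (f n) (g k)\<close> close to
    \<open>ip (f n) p\<close> uniformly in \<open>n\<close>, so the Cauchy property passes from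
    \<open>g k\<close> to \<open>p\<close>.\<close>
  have closed: "p \<in> S" if p: "p \<in> V" and g: "\<And>k. g k \<in> S" and gp: "(\<lambda>k. dsq (g k) p) \<longlonglongrightarrow> 0" for p g
  proof -
    have "Cauchy (\<lambda>n. ip (f (r n)) p)"
    proof (rule metric_CauchyI)
      fix e :: real assume e: "e > 0"
      have "(\<lambda>k. sqrt (dsq (g k) p) * sqrt B) \<longlonglongrightarrow> sqrt 0 * sqrt B"
        by (intro tendsto_intros gp)
      then have "\<forall>\<^sub>F k in sequentially. sqrt (dsq (g k) p) * sqrt B < e / 3"
        using e by (intro order_tendstoD(2)[where y = "sqrt 0 * sqrt B"]) auto
      then obtain k where k: "sqrt (dsq (g k) p) * sqrt B < e / 3"
        using eventually_happens'[OF sequentially_bot] by blast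
      have close: "\<bar>ip (f n) (g k) - ip (f n) p\<bar> < e / 3" for n
      proof -
        have gV: "g k \<in> V" using g SV by blast
        have "\<bar>ip (f n) (g k) - ip (f n) p\<bar> \<le> sqrt (dsq (g k) p) * sqrt (ip (f n) (f n))"
          using ip_diff_le[OF gV p f[of n]] ip_sym[OF f[of n] gV] ip_sym[OF f[of n] p] by simp
        also have "\<dots> \<le> sqrt (dsq (g k) p) * sqrt B"
          by (intro mult_left_mono sB) (use dsq_nonneg gV p in auto)
        finally show ?thesis using k by simp
      qed
      have "Cauchy (\<lambda>n. ip (f (r n)) (g k))" using lim[OF g] LIMSEQ_imp_Cauchy by blast
      then obtain N where N: "\<And>a b. a \<ge> N \<Longrightarrow> b \<ge> N \<Longrightarrow> dist (ip (f (r a)) (g k)) (ip (f (r b)) (g k)) < e / 3"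
        using metric_CauchyD[of _ "e/3"] e by (metis zero_less_divide_iff zero_less_numeral)
      have "dist (ip (f (r a)) p) (ip (f (r b)) p) < e" if "a \<ge> N" "b \<ge> N" for a b
        using N[OF that] close[of "r a"] close[of "r b"] unfolding dist_real_def by linarith
      then show "\<exists>M. \<forall>m\<ge>M. \<forall>n\<ge>M. dist (ip (f (r m)) p) (ip (f (r n)) p) < e" by blast
    qed
    then show ?thesis using p by (simp add: S_def Cauchy_convergent)
  qed
  have Sne: "S \<noteq> {}" using fS by blast
  have lb: "(l x)\<^sup>2 \<le> B * ip x x" if x: "x \<in> S" for x
  proof (rule LIMSEQ_le_const2)
    show "(\<lambda>n. (ip (f (r n)) x)\<^sup>2) \<longlonglongrightarrow> (l x)\<^sup>2" by (intro tendsto_intros lim x)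
    have xV: "x \<in> V" using x SV by blast
    have "(ip (f (r n)) x)\<^sup>2 \<le> B * ip x x" for n
      using Cauchy_Schwarz_sq[OF f xV, of "r n"] mult_right_mono[OF B ip_nonneg[OF xV], of "r n"] by linarith
    then show "\<exists>N. \<forall>n\<ge>N. (ip (f (r n)) x)\<^sup>2 \<le> B * ip x x" by blast
  qed
  obtain u g where u: "u \<in> V" and g: "\<And>n. g n \<in> S" "(\<lambda>n. dsq (g n) u) \<longlonglongrightarrow> 0"
    and ul: "\<And>s. s \<in> S \<Longrightarrow> ip u s = l s"
    using Riesz[OF SV Sne Sl ll lb B0] by blast
  have uS: "u \<in> S" using closed[OF u g] .
  have "(\<lambda>n. ip (f (r n)) w) \<longlonglongrightarrow> ip u w" if w: "w \<in> V" for w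
  proof -
    have wb: "(ip w x)\<^sup>2 \<le> ip w w * ip x x" if "x \<in> S" for x
      using Cauchy_Schwarz_sq w that SV by blast
    have wl: "ip w (lin a x b y) = a * ip w x + b * ip w y" if "x \<in> S" "y \<in> S" for a x b y
      using that SV w by (intro ip_lin2) auto
    \<comment> \<open>\<open>p\<close> is the orthogonal projection of \<open>w\<close>: it
      represents the functional \<open>ip w\<close> on \<open>S\<close>, and \<open>closed\<close>
      puts it back into \<open>S\<close>, where convergence is already known.\<close>
    obtain p h where p: "p \<in> V" and h: "\<And>n. h n \<in> S" "(\<lambda>n. dsq (h n) p) \<longlonglongrightarrow> 0"
      and pw: "\<And>s. s \<in> S \<Longrightarrow> ip p s = ip w s"
      using Riesz[OF SV Sne Sl wl wb ip_nonneg[OF w]] by blast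
    have pS: "p \<in> S" using closed[OF p h] .
    have "ip (f n) w = ip (f n) p" for n
      using pw[OF fS[of n]] ip_sym[OF f[of n] w] ip_sym[OF f[of n] p] by simp
    moreover have "ip u w = ip u p"
      using pw[OF uS] ip_sym[OF u w] ip_sym[OF u p] by simp
    ultimately show ?thesis using lim[OF pS] ul[OF pS] by simp
  qed
  with r u that show ?thesis by blast
qed

text \<open>
  Gliding hump (Sokal): adding \<open>\<plusminus> 3\<^sup>-\<^sup>k\<close> times the normalised element \<open>f (N k)\<close> with the right sign
  makes \<open>\<bar>ip (f (N k)) (x k)\<bar>\<close> large, and the later steps cannot destroy more than half of it.
\<close>

theorem uniformly_bounded:
  assumes f: "\<And>n. f n \<in> V" and pw: "\<And>v. v \<in> V \<Longrightarrow> bounded (range (\<lambda>n. ip (f n) v))"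
  shows "\<exists>B. \<forall>n. ip (f n) (f n) \<le> B"
proof (rule ccontr)
  assume "\<not> ?thesis"
  then have "\<forall>B. \<exists>n. ip (f n) (f n) > B" by (meson not_le)
  then have "\<forall>k::nat. \<exists>n. ip (f n) (f n) > (4^k)\<^sup>2" by blast
  \<comment> \<open>Norms above \<open>4^k\<close> against steps of length \<open>3^-k\<close>: the
    quotient \<open>(4/3)^k\<close> is what finally exceeds every bound.\<close>
  then obtain N where N: "\<And>k::nat. ip (f (N k)) (f (N k)) > (4^k)\<^sup>2" by metis
  define a where "a k = sqrt (ip (f (N k)) (f (N k)))" for k
  have a: "a k > 4^k" for k unfolding a_def using N[of k] by (intro real_less_rsqrt) auto
  have a0: "a k > 0" for k using a[of k] by (meson less_trans zero_less_numeral zero_less_power)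
  have a2: "ip (f (N k)) (f (N k)) = (a k)\<^sup>2" for k
    unfolding a_def using ip_nonneg f by simp
  obtain v0 where v0: "v0 \<in> V" using nonempty by blast
  define sg :: "nat \<Rightarrow> 'v \<Rightarrow> real" where "sg k v = (if ip (f (N k)) v \<ge> 0 then 1 else -1)" for k v
  define x where "x = rec_nat v0 (\<lambda>k v. lin 1 v (sg k v / 3^k / a k) (f (N k)))"
  have x0: "x 0 = v0" by (simp add: x_def)
  have xS: "x (Suc k) = lin 1 (x k) (sg k (x k) / 3^k / a k) (f (N k))" for k
    by (simp add: x_def)
  have xV: "x k \<in> V" for k by (induction k) (auto simp: x0 xS v0 intro!: lin_closed f)
  have s2: "(sg k v)\<^sup>2 = 1" for k v by (simp add: sg_def)
  have big: "\<bar>ip (f (N k)) (x (Suc k))\<bar> \<ge> a k / 3^k" for k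
  proof -
    have "ip (f (N k)) (x (Suc k)) = ip (f (N k)) (x k) + sg k (x k) / 3^k / a k * (a k)\<^sup>2"
      using xV f by (simp add: xS ip_lin2 a2)
    also have "sg k (x k) / 3^k / a k * (a k)\<^sup>2 = sg k (x k) * (a k / 3^k)"
      using a0[of k] by (simp add: field_simps power2_eq_square)
    finally show ?thesis
      using a0[of k] by (simp add: sg_def abs_if)
  qed
  have step: "sqrt (dsq (x (Suc k)) (x k)) = 1 / 3^k" for k
  proof -
    have "dsq (x (Suc k)) (x k) = (sg k (x k) / 3^k / a k)\<^sup>2 * (a k)\<^sup>2"
      using xV[of k] f[of "N k"]
      by (simp add: xS dsq_def ip_lin_lin ip_lin a2 ip_sym[of "f (N k)" "x k"] algebra_simps)
    also have "\<dots> = (1 / 3^k)\<^sup>2" using a0[of k] s2[of k "x k"] by (simp add: power_divide power_mult_distrib)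
    finally show ?thesis by (simp add: real_sqrt_divide)
  qed
  \<comment> \<open>\<open>3 / 2 / 3^k\<close> is the geometric tail of all step lengths from index
    \<open>k\<close> on.\<close>
  have far: "sqrt (dsq (x (k + j)) (x k)) \<le> 3 / 2 / 3^k" for k j
  proof -
    have "sqrt (dsq (x (k + j)) (x k)) \<le> 3 / 2 / 3^k - 3 / 2 / 3^(k + j)"
    proof (induction j)
      case 0
      then show ?case using xV by (simp add: dsq_def)
    next
      case (Suc j)
      have "sqrt (dsq (x (k + Suc j)) (x k)) \<le> 1 / 3^(k+j) + sqrt (dsq (x (k + j)) (x k))"
        using sqrt_dsq_triangle[OF xV xV xV, of "k + Suc j" k "k + j"] step[of "k + j"] by simp
      then show ?case using Suc by simp
    qed
    moreover have "0 \<le> 3 / 2 / (3::real)^(k + j)" by simp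
    ultimately show ?thesis by linarith
  qed
  have "\<exists>l\<in>V. (\<lambda>n. ip (x n) (x n) - 2 * ip (x n) l + ip l l) \<longlonglongrightarrow> 0"
  proof (rule complete)
    fix e :: real assume e: "e > 0"
    have "(\<lambda>k. (3 / 2 * (1 / 3)^k + 3 / 2 * (1 / 3)^k :: real)) \<longlonglongrightarrow> 3 / 2 * 0 + 3 / 2 * 0"
      by (intro tendsto_intros LIMSEQ_realpow_zero) auto
    then have "\<forall>\<^sub>F k in sequentially. 3 / 2 * (1 / 3)^k + 3 / 2 * (1 / 3)^k < sqrt e"
      using e by (intro order_tendstoD(2)[where y = "3 / 2 * 0 + 3 / 2 * 0"]) auto
    then obtain k where "3 / 2 * (1 / 3)^k + 3 / 2 * (1 / 3)^k < sqrt e"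
      using eventually_happens'[OF sequentially_bot] by blast
    then have k: "3 / 2 / 3^k + 3 / 2 / 3^k < sqrt e"
      by (simp add: power_divide)
    have "dsq (x m) (x n) < e" if "k \<le> m" "k \<le> n" for m n
    proof -
      have "dsq (x k) (x n) = dsq (x n) (x k)"
        using xV by (simp add: dsq_def ip_sym[of "x k" "x n"])
      then have "sqrt (dsq (x m) (x n)) \<le> 3 / 2 / 3^k + 3 / 2 / 3^k"
        using sqrt_dsq_triangle[OF xV xV xV, of m n k] far[of k "m - k"] far[of k "n - k"] that by simp
      then show ?thesis using k real_sqrt_less_iff[of "dsq (x m) (x n)" e] by linarith
    qed
    then show "\<exists>N. \<forall>m\<ge>N. \<forall>n\<ge>N. ip (x m) (x m) - 2 * ip (x m) (x n) + ip (x n) (x n) < e"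
      unfolding dsq_def by blast
  qed (rule xV)
  then obtain l where l: "l \<in> V" and lim: "(\<lambda>n. dsq (x n) l) \<longlonglongrightarrow> 0"
    unfolding dsq_def by auto
  \<comment> \<open>Counted from \<open>Suc k\<close>, after the step that produces the gain
    \<open>a k / 3^k\<close>, the tail is \<open>1 / 2 / 3^k\<close>; this is where the half comes
    from.\<close>
  have dist: "\<bar>ip l z - ip (x (Suc k)) z\<bar> \<le> 1 / 2 / 3^k * sqrt (ip z z)" if z: "z \<in> V" for k z
  proof (rule LIMSEQ_le_const2)
    show "(\<lambda>j. \<bar>ip (x (Suc k + j)) z - ip (x (Suc k)) z\<bar>) \<longlonglongrightarrow> \<bar>ip l z - ip (x (Suc k)) z\<bar>"
      using LIMSEQ_ignore_initial_segment[OF tendsto_ip[OF xV l z lim], of "Suc k"]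
      by (intro tendsto_intros) (simp add: add.commute)
    have "\<bar>ip (x (Suc k + j)) z - ip (x (Suc k)) z\<bar> \<le> 1 / 2 / 3^k * sqrt (ip z z)" for j
    proof -
      have "\<bar>ip (x (Suc k + j)) z - ip (x (Suc k)) z\<bar> \<le> sqrt (dsq (x (Suc k + j)) (x (Suc k))) * sqrt (ip z z)"
        using ip_diff_le xV z by blast
      also have "\<dots> \<le> 3 / 2 / 3^(Suc k) * sqrt (ip z z)"
        by (intro mult_right_mono far) (use ip_nonneg z in auto)
      finally show ?thesis by simp
    qed
    then show "\<exists>N. \<forall>j\<ge>N. \<bar>ip (x (Suc k + j)) z - ip (x (Suc k)) z\<bar> \<le> 1 / 2 / 3^k * sqrt (ip z z)" by blast
  qed
  obtain M where M: "\<And>n. \<bar>ip (f n) l\<bar> \<le> M"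
    using pw[OF l] by (auto simp: bounded_iff)
  have "(4/3)^k \<le> 2 * M" for k :: nat
  proof -
    have "\<bar>ip (f (N k)) l\<bar> \<ge> a k / 3^k - 1 / 2 / 3^k * a k"
      using dist[OF f, of "N k" k] big[of k] ip_sym[OF f[of "N k"] l] ip_sym[OF f[of "N k"] xV[of "Suc k"]]
      unfolding a_def by linarith
    then have "a k / 3^k \<le> 2 * \<bar>ip (f (N k)) l\<bar>" by (simp add: field_simps)
    then have "a k / 3^k \<le> 2 * M" using M[of "N k"] by linarith
    moreover have "(4/3)^k \<le> a k / 3^k"
      using a[of k] by (simp add: power_divide divide_right_mono)
    ultimately show ?thesis by linarith
  qed
  moreover obtain k :: nat where "2 * M < (4/3)^k"
    using real_arch_pow[of "4/3" "2 * M"] by auto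
  ultimately show False by (meson not_le)
qed

corollary weakly_convergent_bounded:
  assumes "\<And>n. f n \<in> V" "\<And>v. v \<in> V \<Longrightarrow> (\<lambda>n. ip (f n) v) \<longlonglongrightarrow> ip l v"
  shows "\<exists>B. \<forall>n. ip (f n) (f n) \<le> B"
  using assms by (intro uniformly_bounded convergent_imp_bounded) auto

text \<open>The bound makes the functionals \<open>ip (f n)\<close> equicontinuous, so convergence
  spreads from \<open>S\<close> to everything \<open>S\<close> approximates. \<open>S\<close> need
  not be a subspace.\<close>

lemma weak_limit_dense:
  assumes f: "\<And>n. f n \<in> V" and B: "\<And>n. ip (f n) (f n) \<le> B" and l: "l \<in> V"
    and S: "S \<subseteq> V" "\<And>w e. w \<in> V \<Longrightarrow> e > 0 \<Longrightarrow> \<exists>s\<in>S. dsq w s < e"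
    and lim: "\<And>s. s \<in> S \<Longrightarrow> (\<lambda>n. ip (f n) s) \<longlonglongrightarrow> ip l s" and w: "w \<in> V"
  shows "(\<lambda>n. ip (f n) w) \<longlonglongrightarrow> ip l w"
proof (rule LIMSEQ_I)
  fix e :: real assume e: "e > 0"
  \<comment> \<open>One bound for the norms of the sequence and of the limit; the added 1 allows
    division by \<open>C\<close>.\<close>
  define C where "C = sqrt (max B (ip l l)) + 1"
  have C: "C > 0" using ip_nonneg[OF l] by (simp add: C_def add_nonneg_pos le_max_iff_disj)
  have "sqrt (ip (f n) (f n)) \<le> sqrt (max B (ip l l))" for n
    using B[of n] by (intro real_sqrt_le_mono) (simp add: le_max_iff_disj)
  then have fC: "sqrt (ip (f n) (f n)) \<le> C" for n unfolding C_def by (meson add_increasing2 zero_le_one)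
  have "sqrt (ip l l) \<le> sqrt (max B (ip l l))" by (intro real_sqrt_le_mono) simp
  then have lC: "sqrt (ip l l) \<le> C" unfolding C_def by (meson add_increasing2 zero_le_one)
  obtain s where s: "s \<in> S" and "dsq w s < (e / (3 * C))\<^sup>2"
    using S(2)[OF w, of "(e / (3 * C))\<^sup>2"] e C by auto
  then have "sqrt (dsq w s) < e / (3 * C)"
    using real_sqrt_less_mono[of "dsq w s" "(e / (3 * C))\<^sup>2"] e C by simp
  then have small: "sqrt (dsq w s) * C < e / 3" using C by (simp add: field_simps)
  have sV: "s \<in> V" using s S by blast
  have close: "\<bar>ip z w - ip z s\<bar> < e / 3" if z: "z \<in> V" and zC: "sqrt (ip z z) \<le> C" for z
  proof -
    have "\<bar>ip z w - ip z s\<bar> \<le> sqrt (dsq w s) * sqrt (ip z z)"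
      using ip_diff_le[OF w sV z] ip_sym[OF z w] ip_sym[OF z sV] by simp
    also have "\<dots> \<le> sqrt (dsq w s) * C"
      by (intro mult_left_mono zC) (use dsq_nonneg w sV in auto)
    finally show ?thesis using small by simp
  qed
  obtain N where N: "\<And>n. n \<ge> N \<Longrightarrow> norm (ip (f n) s - ip l s) < e / 3"
    using LIMSEQ_D[OF lim[OF s], of "e / 3"] e by auto
  have "norm (ip (f n) w - ip l w) < e" if "n \<ge> N" for n
    using N[OF that] close[OF f fC, of n] close[OF l lC] unfolding real_norm_def by linarith
  then show "\<exists>N. \<forall>n\<ge>N. norm (ip (f n) w - ip l w) < e" by blast
qed

text \<open>Replacing \<open>g n\<close> by \<open>m\<close> costs a bounded norm times a null
  sequence. This is how the products with mollified fields pass to the limit.\<close>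

lemma tendsto_weak_strong:
  assumes f: "\<And>n. f n \<in> V" "\<And>n. ip (f n) (f n) \<le> B" "l \<in> V"
    and weak: "\<And>w. w \<in> V \<Longrightarrow> (\<lambda>n. ip (f n) w) \<longlonglongrightarrow> ip l w"
    and g: "\<And>n. g n \<in> V" "m \<in> V" "(\<lambda>n. dsq (g n) m) \<longlonglongrightarrow> 0"
  shows "(\<lambda>n. ip (f n) (g n)) \<longlonglongrightarrow> ip l m"
proof -
  have "(\<lambda>n. ip (f n) (g n) - ip (f n) m) \<longlonglongrightarrow> 0"
  proof (rule Lim_null_comparison)
    have "\<bar>ip (f n) (g n) - ip (f n) m\<bar> \<le> sqrt (dsq (g n) m) * sqrt B" for n
    proof -
      have "\<bar>ip (f n) (g n) - ip (f n) m\<bar> \<le> sqrt (dsq (g n) m) * sqrt (ip (f n) (f n))"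
        using ip_diff_le[OF g(1)[of n] g(2) f(1)[of n]] ip_sym[OF f(1)[of n] g(1)[of n]] ip_sym[OF f(1)[of n] g(2)] by simp
      also have "\<dots> \<le> sqrt (dsq (g n) m) * sqrt B"
        using f(2)[of n] dsq_nonneg[OF g(1)[of n] g(2)] by (intro mult_left_mono) auto
      finally show ?thesis .
    qed
    then show "\<forall>\<^sub>F n in sequentially. norm (ip (f n) (g n) - ip (f n) m) \<le> sqrt (dsq (g n) m) * sqrt B" by simp
    have "(\<lambda>n. sqrt (dsq (g n) m) * sqrt B) \<longlonglongrightarrow> sqrt 0 * sqrt B" by (intro tendsto_intros g(3))
    then show "(\<lambda>n. sqrt (dsq (g n) m) * sqrt B) \<longlonglongrightarrow> 0" by simp
  qed
  from tendsto_add[OF this weak[OF g(2)]] show ?thesis by simp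
qed

end

section \<open>Weakly defined operators\<close>

text \<open>The operator is the adjoint of \<open>T\<close>, which is only defined on the dense set \<open>S\<close> of test elements.\<close>

locale weak_operator = V: semi_hilbert V linV ipV + W: semi_hilbert W linW ipW
  for V :: "'v set" and linV ipV and W :: "'w set" and linW ipW +
  fixes S :: "'w set" and T :: "'w \<Rightarrow> 'v"
  assumes S_W: "S \<subseteq> W" and T_V: "\<And>s. s \<in> S \<Longrightarrow> T s \<in> V"
    and dense: "\<And>w e. w \<in> W \<Longrightarrow> e > 0 \<Longrightarrow> \<exists>s\<in>S. W.dsq w s < e"
begin

text \<open>The weak curl arises from \<open>T = curl\<close>, which is its own formal adjoint, and
  the weak divergence from \<open>T = - grad\<close>.\<close>

definition has_adj :: "'v \<Rightarrow> 'w \<Rightarrow> bool" where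
  "has_adj e g \<longleftrightarrow> (\<forall>s\<in>S. ipW g s = ipV e (T s))"

definition dom :: "'v set" where
  "dom = {e \<in> V. \<exists>g\<in>W. has_adj e g}"

definition adj :: "'v \<Rightarrow> 'w" where
  "adj e = (SOME g. g \<in> W \<and> has_adj e g)"

definition ipD :: "'v \<Rightarrow> 'v \<Rightarrow> real" where
  "ipD e f = ipV e f + ipW (adj e) (adj f)"

lemma domD: "e \<in> dom \<Longrightarrow> e \<in> V" "e \<in> dom \<Longrightarrow> adj e \<in> W" "e \<in> dom \<Longrightarrow> has_adj e (adj e)"
proof -
  assume e: "e \<in> dom"
  then have "\<exists>g. g \<in> W \<and> has_adj e g" by (auto simp: dom_def)
  from someI_ex[OF this] show "adj e \<in> W" "has_adj e (adj e)" by (auto simp: adj_def)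
qed (simp add: dom_def)

text \<open>Density of the test elements makes weak adjoints unique up to \<open>ipW\<close>; the
  constant sequence \<open>g\<close> in \<open>weak_limit_dense\<close> reduces this to uniqueness
  of limits. It justifies the choice made in \<open>adj\<close>.\<close>

lemma ip_eq_dense:
  assumes "g \<in> W" "h \<in> W" "\<And>s. s \<in> S \<Longrightarrow> ipW g s = ipW h s" "w \<in> W"
  shows "ipW g w = ipW h w"
proof -
  have "(\<lambda>n::nat. ipW g w) \<longlonglongrightarrow> ipW h w"
    by (rule W.weak_limit_dense[of "\<lambda>_. g" "ipW g g" h S]) (use assms S_W dense in auto)
  then show ?thesis using LIMSEQ_const_iff by blast
qed

lemma adj_unique:
  assumes "e \<in> V" "g \<in> W" "has_adj e g"
  shows "e \<in> dom" "\<And>w. w \<in> W \<Longrightarrow> ipW (adj e) w = ipW g w"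
proof -
  show e: "e \<in> dom" using assms by (auto simp: dom_def)
  show "ipW (adj e) w = ipW g w" if "w \<in> W" for w
    by (rule ip_eq_dense) (use domD[OF e] assms that in \<open>auto simp: has_adj_def\<close>)
qed

lemma has_adj_lin:
  assumes "x \<in> dom" "y \<in> dom"
  shows "has_adj (linV a x b y) (linW a (adj x) b (adj y))"
  unfolding has_adj_def
proof
  fix s assume s: "s \<in> S"
  then have "ipW (linW a (adj x) b (adj y)) s = a * ipV x (T s) + b * ipV y (T s)"
    using domD[OF assms(1)] domD[OF assms(2)] S_W by (auto simp: W.ip_lin has_adj_def)
  then show "ipW (linW a (adj x) b (adj y)) s = ipV (linV a x b y) (T s)"
    using domD[OF assms(1)] domD[OF assms(2)] T_V[OF s] by (simp add: V.ip_lin)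
qed

text \<open>For fixed \<open>s\<close> both sides of the defining identity are weakly continuous, so
  the graph of the adjoint is weakly closed.\<close>

lemma has_adj_weak_limit:
  assumes "\<And>n. f n \<in> V" "\<And>n. g n \<in> W" "\<And>n. has_adj (f n) (g n)"
    and "\<And>v. v \<in> V \<Longrightarrow> (\<lambda>n. ipV (f n) v) \<longlonglongrightarrow> ipV l v" "\<And>w. w \<in> W \<Longrightarrow> (\<lambda>n. ipW (g n) w) \<longlonglongrightarrow> ipW h w"
  shows "has_adj l h"
  unfolding has_adj_def
proof
  fix s assume s: "s \<in> S"
  have "(\<lambda>n. ipW (g n) s) \<longlonglongrightarrow> ipW h s" using assms(5) s S_W by blast
  moreover have "(\<lambda>n. ipW (g n) s) \<longlonglongrightarrow> ipV l (T s)"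
    using assms(3,4) T_V s by (simp add: has_adj_def)
  ultimately show "ipW h s = ipV l (T s)" using LIMSEQ_unique by blast
qed

lemma lin_dom:
  assumes "x \<in> dom" "y \<in> dom"
  shows "linV a x b y \<in> dom"
    "\<And>w. w \<in> W \<Longrightarrow> ipW (adj (linV a x b y)) w = a * ipW (adj x) w + b * ipW (adj y) w"
proof -
  note x = domD[OF assms(1)] and y = domD[OF assms(2)]
  have "linV a x b y \<in> V" "linW a (adj x) b (adj y) \<in> W"
    using x y V.lin_closed W.lin_closed by blast+
  note * = adj_unique[OF this has_adj_lin[OF assms]]
  show "linV a x b y \<in> dom" by (rule *)
  show "ipW (adj (linV a x b y)) w = a * ipW (adj x) w + b * ipW (adj y) w" if "w \<in> W" for w
    using *(2)[OF that] x y that by (simp add: W.ip_lin)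
qed

text \<open>Completeness of the graph space is closedness of the graph: a Cauchy sequence has limits
  \<open>l\<close> of the elements and \<open>g\<close> of the adjoints, and
  \<open>has_adj_weak_limit\<close> ties them together.\<close>

lemma semi_hilbert_dom: "semi_hilbert dom linV ipD"
proof
  obtain v w where v: "v \<in> V" and w: "w \<in> W" using V.nonempty W.nonempty by blast
  \<comment> \<open>Without a zero in the signature, \<open>linV 0 v 0 v\<close> serves as the null
    element.\<close>
  have v0: "linV 0 v 0 v \<in> V" and w0: "linW 0 w 0 w \<in> W"
    using V.lin_closed[OF v v] W.lin_closed[OF w w] by blast+
  have "has_adj (linV 0 v 0 v) (linW 0 w 0 w)"
    unfolding has_adj_def using S_W T_V v w by (auto simp: V.ip_lin W.ip_lin subsetD)
  from adj_unique(1)[OF v0 w0 this] show "dom \<noteq> {}" by blast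
  show "linV a x b y \<in> dom" if "x \<in> dom" "y \<in> dom" for a x b y by (rule lin_dom[OF that])
  show "ipD x y = ipD y x" if "x \<in> dom" "y \<in> dom" for x y
    using domD[OF that(1)] domD[OF that(2)] by (simp add: ipD_def V.ip_sym[of x y] W.ip_sym[of "adj x" "adj y"])
  show "0 \<le> ipD x x" if "x \<in> dom" for x
    using domD[OF that] by (simp add: ipD_def V.ip_nonneg W.ip_nonneg)
  show "ipD (linV a x b y) z = a * ipD x z + b * ipD y z" if "x \<in> dom" "y \<in> dom" "z \<in> dom" for a x b y z
    using lin_dom(2)[OF that(1,2) domD(2)[OF that(3)]] domD[OF that(1)] domD[OF that(2)] domD[OF that(3)]
    by (simp add: ipD_def V.ip_lin algebra_simps)
  fix f assume f: "\<And>n::nat. f n \<in> dom"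
    and Cau: "\<And>e. e > 0 \<Longrightarrow> \<exists>N. \<forall>m\<ge>N. \<forall>n\<ge>N. ipD (f m) (f m) - 2 * ipD (f m) (f n) + ipD (f n) (f n) < e"
  have dsqD: "ipD x x - 2 * ipD x y + ipD y y = V.dsq x y + W.dsq (adj x) (adj y)" for x y
    by (simp add: ipD_def V.dsq_def W.dsq_def)
  have nn: "0 \<le> V.dsq (f m) (f n)" "0 \<le> W.dsq (adj (f m)) (adj (f n))" for m n
    by (rule V.dsq_nonneg[OF domD(1)[OF f] domD(1)[OF f]])
      (rule W.dsq_nonneg[OF domD(2)[OF f] domD(2)[OF f]])
  have "\<exists>l\<in>V. (\<lambda>n. ipV (f n) (f n) - 2 * ipV (f n) l + ipV l l) \<longlonglongrightarrow> 0"
  proof (rule V.complete)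
    fix e :: real assume "e > 0"
    from Cau[OF this] obtain N where N: "\<forall>m\<ge>N. \<forall>n\<ge>N. V.dsq (f m) (f n) + W.dsq (adj (f m)) (adj (f n)) < e"
      unfolding dsqD by blast
    have "V.dsq (f m) (f n) < e" if "m \<ge> N" "n \<ge> N" for m n
      using N[rule_format, OF that] nn(2)[of m n] by linarith
    then show "\<exists>N. \<forall>m\<ge>N. \<forall>n\<ge>N. ipV (f m) (f m) - 2 * ipV (f m) (f n) + ipV (f n) (f n) < e"
      unfolding V.dsq_def by blast
  qed (use f domD in auto)
  then obtain l where l: "l \<in> V" and liml: "(\<lambda>n. V.dsq (f n) l) \<longlonglongrightarrow> 0"
    unfolding V.dsq_def by blast
  have "\<exists>g\<in>W. (\<lambda>n. ipW (adj (f n)) (adj (f n)) - 2 * ipW (adj (f n)) g + ipW g g) \<longlonglongrightarrow> 0"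
  proof (rule W.complete)
    fix e :: real assume "e > 0"
    from Cau[OF this] obtain N where N: "\<forall>m\<ge>N. \<forall>n\<ge>N. V.dsq (f m) (f n) + W.dsq (adj (f m)) (adj (f n)) < e"
      unfolding dsqD by blast
    have "W.dsq (adj (f m)) (adj (f n)) < e" if "m \<ge> N" "n \<ge> N" for m n
      using N[rule_format, OF that] nn(1)[of m n] by linarith
    then show "\<exists>N. \<forall>m\<ge>N. \<forall>n\<ge>N. ipW (adj (f m)) (adj (f m)) - 2 * ipW (adj (f m)) (adj (f n)) + ipW (adj (f n)) (adj (f n)) < e"
      unfolding W.dsq_def by blast
  qed (use f domD in auto)
  then obtain g where g: "g \<in> W" and limg: "(\<lambda>n. W.dsq (adj (f n)) g) \<longlonglongrightarrow> 0"
    unfolding W.dsq_def by blast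
  have "has_adj l g"
    by (rule has_adj_weak_limit[of f "\<lambda>n. adj (f n)"])
      (use f domD l g liml limg V.tendsto_ip[of f l] W.tendsto_ip[of "\<lambda>n. adj (f n)" g] in auto)
  note lg = adj_unique[OF l g this]
  have al: "adj l \<in> W" using domD lg(1) by blast
  \<comment> \<open>\<open>adj l\<close> is a chosen representative and may differ from the limit
    \<open>g\<close>; under \<open>ipW\<close> they cannot be distinguished.\<close>
  have "W.dsq (adj (f n)) (adj l) = W.dsq (adj (f n)) g" for n
  proof -
    have afn: "adj (f n) \<in> W" using f domD by blast
    have "ipW (adj (f n)) (adj l) = ipW (adj (f n)) g"
      using lg(2)[OF afn] W.ip_sym[OF afn al] W.ip_sym[OF afn g] by simp
    moreover have "ipW (adj l) (adj l) = ipW g g"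
      using lg(2)[OF al] lg(2)[OF g] W.ip_sym[OF g al] by simp
    ultimately show ?thesis by (simp add: W.dsq_def)
  qed
  then have "(\<lambda>n. V.dsq (f n) l + W.dsq (adj (f n)) (adj l)) \<longlonglongrightarrow> 0 + 0"
    using limg by (intro tendsto_add liml) simp
  then show "\<exists>l\<in>dom. (\<lambda>n. ipD (f n) (f n) - 2 * ipD (f n) l + ipD l l) \<longlonglongrightarrow> 0"
    unfolding dsqD using lg(1) by auto
qed

lemma ip_le_ipD: "e \<in> dom \<Longrightarrow> ipV e e \<le> ipD e e" "e \<in> dom \<Longrightarrow> ipW (adj e) (adj e) \<le> ipD e e"
  using domD[of e] by (simp_all add: ipD_def V.ip_nonneg W.ip_nonneg)

text \<open>Bounded graph norms give a weakly convergent subsequence of the adjoints, whose limit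
  must be an adjoint of \<open>l\<close>. Convergence of the whole sequence then follows by testing
  on \<open>S\<close>, where \<open>ipW (adj (f n)) s\<close> equals \<open>ipV (f n) (T s)\<close>,
  and spreading to all of \<open>W\<close> by density and boundedness.\<close>

lemma dom_weak_limit:
  assumes f: "\<And>n. f n \<in> dom" and B: "\<And>n. ipD (f n) (f n) \<le> B" and l: "l \<in> V"
    and lim: "\<And>v. v \<in> V \<Longrightarrow> (\<lambda>n. ipV (f n) v) \<longlonglongrightarrow> ipV l v"
  shows "l \<in> dom" "\<And>v. v \<in> dom \<Longrightarrow> (\<lambda>n. ipD (f n) v) \<longlonglongrightarrow> ipD l v"
proof -
  have fV: "f n \<in> V" and fW: "adj (f n) \<in> W" and fa: "has_adj (f n) (adj (f n))" for n
    using f domD by blast+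
  have BW: "ipW (adj (f n)) (adj (f n)) \<le> B" for n
    using ip_le_ipD(2)[OF f[of n]] B[of n] by linarith
  obtain r g where r: "strict_mono (r :: nat \<Rightarrow> nat)" and g: "g \<in> W"
    and rg: "\<And>w. w \<in> W \<Longrightarrow> (\<lambda>n. ipW (adj (f (r n))) w) \<longlonglongrightarrow> ipW g w"
    using W.weakly_compact[of "\<lambda>n. adj (f n)", OF fW BW] by blast
  have "has_adj l g"
  proof (rule has_adj_weak_limit)
    show "(\<lambda>n. ipV (f (r n)) v) \<longlonglongrightarrow> ipV l v" if "v \<in> V" for v
      using LIMSEQ_subseq_LIMSEQ[OF lim[OF that] r] by (simp add: o_def)
  qed (use fV fW fa rg in auto)
  note lg = adj_unique[OF l g this]
  show ld: "l \<in> dom" by (rule lg)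
  have al: "adj l \<in> W" "has_adj l (adj l)" using domD ld by blast+
  have "(\<lambda>n. ipW (adj (f n)) w) \<longlonglongrightarrow> ipW (adj l) w" if "w \<in> W" for w
  proof (rule W.weak_limit_dense[OF fW BW al(1) S_W dense _ that])
    show "(\<lambda>n. ipW (adj (f n)) s) \<longlonglongrightarrow> ipW (adj l) s" if "s \<in> S" for s
      using lim[OF T_V[OF that]] fa al that by (simp add: has_adj_def)
  qed
  then show "(\<lambda>n. ipD (f n) v) \<longlonglongrightarrow> ipD l v" if "v \<in> dom" for v
    unfolding ipD_def using domD[OF that] by (intro tendsto_add lim) auto
qed

text \<open>For \<open>v\<close> in \<open>V\<close> the functional \<open>ipV v\<close> is bounded
  on \<open>dom\<close> in the graph norm, so the Riesz theorem in \<open>dom\<close> turns it into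
  \<open>ipD u\<close>, and the assumed convergence applies to \<open>u\<close>. The bound is the
  uniform boundedness principle in \<open>dom\<close>.\<close>

lemma dom_weak_convergence:
  assumes f: "\<And>n. f n \<in> dom" and l: "l \<in> dom" and lim: "\<And>v. v \<in> dom \<Longrightarrow> (\<lambda>n. ipD (f n) v) \<longlonglongrightarrow> ipD l v"
  shows "\<exists>B. \<forall>n. ipD (f n) (f n) \<le> B" "\<And>v. v \<in> V \<Longrightarrow> (\<lambda>n. ipV (f n) v) \<longlonglongrightarrow> ipV l v"
proof -
  interpret D: semi_hilbert dom linV ipD by (rule semi_hilbert_dom)
  show "\<exists>B. \<forall>n. ipD (f n) (f n) \<le> B" by (rule D.weakly_convergent_bounded[OF f lim])
  show "(\<lambda>n. ipV (f n) v) \<longlonglongrightarrow> ipV l v" if v: "v \<in> V" for v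
  proof -
    have b: "(ipV v x)\<^sup>2 \<le> ipV v v * ipD x x" if "x \<in> dom" for x
    proof -
      have "(ipV v x)\<^sup>2 \<le> ipV v v * ipV x x" using V.Cauchy_Schwarz_sq v domD that by blast
      also have "\<dots> \<le> ipV v v * ipD x x"
        using ip_le_ipD(1)[OF that] V.ip_nonneg[OF v] by (rule mult_left_mono)
      finally show ?thesis .
    qed
    have vlin: "ipV v (linV a x b y) = a * ipV v x + b * ipV v y" if "x \<in> dom" "y \<in> dom" for a x b y
      using that domD(1) v by (intro V.ip_lin2) auto
    obtain u where u: "u \<in> dom" and ul: "\<And>s. s \<in> dom \<Longrightarrow> ipD u s = ipV v s"
      using D.Riesz[OF subset_refl D.nonempty lin_dom(1) vlin b V.ip_nonneg[OF v]] by blast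
    have "ipV x v = ipD x u" if "x \<in> dom" for x
      using ul[OF that] D.ip_sym[OF u that] V.ip_sym[OF v domD(1)[OF that]] by simp
    then show ?thesis using lim[OF u] f l by simp
  qed
qed

end

section \<open>Square integrable functions on a measure space\<close>

text \<open>The measure is arbitrary because three kinds occur: \<open>lebesgue\<close>,
  \<open>lebesgue_on\<close> a set, and later a weighted measure on \<Omega>.\<close>

definition L2_on :: "'a measure \<Rightarrow> ('a \<Rightarrow> 'b::euclidean_space) set" where
  "L2_on M = {f \<in> borel_measurable M. integrable M (\<lambda>x. (norm (f x))\<^sup>2)}"

definition ip_on :: "'a measure \<Rightarrow> ('a \<Rightarrow> 'b::euclidean_space) \<Rightarrow> ('a \<Rightarrow> 'b) \<Rightarrow> real" where
  "ip_on M f g = (\<integral>x. f x \<bullet> g x \<partial>M)"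

definition lin_fun :: "real \<Rightarrow> ('a \<Rightarrow> 'b::real_vector) \<Rightarrow> real \<Rightarrow> ('a \<Rightarrow> 'b) \<Rightarrow> 'a \<Rightarrow> 'b" where
  "lin_fun a f b g = (\<lambda>x. a *\<^sub>R f x + b *\<^sub>R g x)"

lemma L2_onD:
  assumes "f \<in> L2_on M"
  shows "f \<in> borel_measurable M" "integrable M (\<lambda>x. (norm (f x))\<^sup>2)"
  using assms by (auto simp: L2_on_def)

lemma inner_le_norm_squares: "\<bar>(x :: 'b::real_inner) \<bullet> y\<bar> \<le> (norm x)\<^sup>2 + (norm y)\<^sup>2"
proof -
  have "\<bar>x \<bullet> y\<bar> \<le> norm x * norm y" by (rule Cauchy_Schwarz_ineq2)
  moreover have "2 * (norm x * norm y) \<le> (norm x)\<^sup>2 + (norm y)\<^sup>2"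
    using sum_squares_bound[of "norm x" "norm y"] by simp
  moreover have "0 \<le> norm x * norm y" by simp
  ultimately show ?thesis by linarith
qed

lemma integrable_inner_L2_on:
  assumes "f \<in> L2_on M" "g \<in> L2_on M"
  shows "integrable M (\<lambda>x. f x \<bullet> g x)"
proof (rule Bochner_Integration.integrable_bound)
  show "integrable M (\<lambda>x. (norm (f x))\<^sup>2 + (norm (g x))\<^sup>2)"
    using L2_onD[OF assms(1)] L2_onD[OF assms(2)] by simp
  show "(\<lambda>x. f x \<bullet> g x) \<in> borel_measurable M"
    using L2_onD[OF assms(1)] L2_onD[OF assms(2)] by measurable
  have "norm (f x \<bullet> g x) \<le> norm ((norm (f x))\<^sup>2 + (norm (g x))\<^sup>2)" for x
    using inner_le_norm_squares[of "f x" "g x"] by simp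
  then show "AE x in M. norm (f x \<bullet> g x) \<le> norm ((norm (f x))\<^sup>2 + (norm (g x))\<^sup>2)" by simp
qed

lemma norm_lin_sq_le:
  "(norm (a *\<^sub>R x + b *\<^sub>R y))\<^sup>2 \<le> 2 * a\<^sup>2 * (norm (x :: 'b::real_inner))\<^sup>2 + 2 * b\<^sup>2 * (norm y)\<^sup>2"
proof -
  have "(norm (a *\<^sub>R x + b *\<^sub>R y))\<^sup>2 \<le> (norm (a *\<^sub>R x) + norm (b *\<^sub>R y))\<^sup>2"
    by (intro power_mono norm_triangle_ineq) auto
  also have "\<dots> \<le> 2 * (norm (a *\<^sub>R x))\<^sup>2 + 2 * (norm (b *\<^sub>R y))\<^sup>2"
    using sum_squares_bound[of "norm (a *\<^sub>R x)" "norm (b *\<^sub>R y)"] by (simp add: power2_sum)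
  finally show ?thesis by (simp add: power_mult_distrib)
qed

lemma lin_fun_L2_on:
  assumes "f \<in> L2_on M" "g \<in> L2_on M"
  shows "lin_fun a f b g \<in> L2_on M"
proof -
  note f = L2_onD[OF assms(1)] and g = L2_onD[OF assms(2)]
  have m: "lin_fun a f b g \<in> borel_measurable M"
    using f(1) g(1) unfolding lin_fun_def by measurable
  have "integrable M (\<lambda>x. (norm (lin_fun a f b g x))\<^sup>2)"
  proof (rule Bochner_Integration.integrable_bound)
    show "integrable M (\<lambda>x. 2 * a\<^sup>2 * (norm (f x))\<^sup>2 + 2 * b\<^sup>2 * (norm (g x))\<^sup>2)"
      using f(2) g(2) by simp
    show "(\<lambda>x. (norm (lin_fun a f b g x))\<^sup>2) \<in> borel_measurable M"
      using m by measurable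
    show "AE x in M. norm ((norm (lin_fun a f b g x))\<^sup>2) \<le> norm (2 * a\<^sup>2 * (norm (f x))\<^sup>2 + 2 * b\<^sup>2 * (norm (g x))\<^sup>2)"
    proof (rule AE_I2)
      fix x
      show "norm ((norm (lin_fun a f b g x))\<^sup>2) \<le> norm (2 * a\<^sup>2 * (norm (f x))\<^sup>2 + 2 * b\<^sup>2 * (norm (g x))\<^sup>2)"
        using norm_lin_sq_le[of a "f x" b "g x"] by (simp add: lin_fun_def)
    qed
  qed
  with m show ?thesis by (simp add: L2_on_def)
qed

lemma ip_on_dsq:
  assumes "f \<in> L2_on M" "g \<in> L2_on M"
  shows "ip_on M f f - 2 * ip_on M f g + ip_on M g g = (\<integral>x. (norm (f x - g x))\<^sup>2 \<partial>M)"
proof -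
  have "(norm (f x - g x))\<^sup>2 = f x \<bullet> f x - 2 * (f x \<bullet> g x) + g x \<bullet> g x" for x
    by (simp add: power2_norm_eq_inner inner_diff_left inner_diff_right inner_commute[of "g x" "f x"])
  then show ?thesis
    using assms by (simp add: ip_on_def integrable_inner_L2_on)
qed

text \<open>Riesz-Fischer: a rapidly Cauchy subsequence converges almost everywhere, and Fatou's
  lemma shows that its pointwise limit is the limit in L2 of the whole sequence.\<close>

lemma L2_on_complete:
  fixes f :: "nat \<Rightarrow> 'a \<Rightarrow> 'b::euclidean_space"
  assumes f: "\<And>n. f n \<in> L2_on M"
    and Cau: "\<And>e. e > 0 \<Longrightarrow> \<exists>N. \<forall>m\<ge>N. \<forall>n\<ge>N. (\<integral>x. (norm (f m x - f n x))\<^sup>2 \<partial>M) < e"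
  shows "\<exists>l\<in>L2_on M. (\<lambda>n. \<integral>x. (norm (f n x - l x))\<^sup>2 \<partial>M) \<longlonglongrightarrow> 0"
proof -
  have fm[measurable]: "f n \<in> borel_measurable M" for n using f L2_onD by blast
  have diff: "(\<lambda>x. f m x - f n x) \<in> L2_on M" for m n
    using lin_fun_L2_on[OF f[of m] f[of n], of 1 "-1"] by (simp add: lin_fun_def)
  have nn: "(\<integral>\<^sup>+x. ennreal ((norm (f m x - f n x))\<^sup>2) \<partial>M) = ennreal (\<integral>x. (norm (f m x - f n x))\<^sup>2 \<partial>M)" for m n
    using L2_onD(2)[OF diff] by (intro nn_integral_eq_integral) auto
  have "\<exists>N. \<forall>m\<ge>N. \<forall>n\<ge>N. (\<integral>x. (norm (f m x - f n x))\<^sup>2 \<partial>M) < (1/8)^k" for k :: nat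
    by (rule Cau) simp
  then obtain N where N: "\<And>k m n. m \<ge> N k \<Longrightarrow> n \<ge> N k \<Longrightarrow> (\<integral>x. (norm (f m x - f n x))\<^sup>2 \<partial>M) < (1/8)^k"
    by metis
  \<comment> \<open>The sum puts \<open>r k\<close> and \<open>r (Suc k)\<close> beyond
    \<open>N k\<close>; the summand \<open>k\<close> makes \<open>r k\<close> eventually exceed
    every index, which Fatou's lemma needs.\<close>
  define r where "r k = k + (\<Sum>j\<le>k. N j)" for k
  have rN: "N k \<le> r k" "N k \<le> r (Suc k)" for k
  proof -
    have "N k \<le> (\<Sum>j\<le>m. N j)" if "k \<le> m" for m by (rule member_le_sum) (use that in auto)
    from this[of k] this[of "Suc k"] show "N k \<le> r k" "N k \<le> r (Suc k)" by (simp_all add: r_def)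
  qed
  \<comment> \<open>Squared distances below \<open>8^-k\<close> weighted by \<open>4^k\<close> still
    sum up, and finiteness of the sum at \<open>x\<close> bounds the increments there by a multiple
    of \<open>2^-k\<close>.\<close>
  define d where "d k x = 4^k * (norm (f (r (Suc k)) x - f (r k) x))\<^sup>2" for k x
  have dm[measurable]: "d k \<in> borel_measurable M" for k unfolding d_def by measurable
  have dint: "(\<integral>\<^sup>+x. ennreal (d k x) \<partial>M) \<le> ennreal ((1/2)^k)" for k
  proof -
    have "(\<integral>\<^sup>+x. ennreal (d k x) \<partial>M) = ennreal (4^k) * (\<integral>\<^sup>+x. ennreal ((norm (f (r (Suc k)) x - f (r k) x))\<^sup>2) \<partial>M)"
      unfolding d_def by (subst nn_integral_cmult[symmetric]) (auto simp: ennreal_mult)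
    also have "\<dots> \<le> ennreal (4^k) * ennreal ((1/8)^k)"
      unfolding nn using N[OF rN(2) rN(1)] by (intro mult_left_mono ennreal_leI) (auto intro: less_imp_le)
    also have "\<dots> = ennreal ((1/2)^k)"
      by (subst ennreal_mult[symmetric]) (auto simp: power_mult_distrib[symmetric])
    finally show ?thesis .
  qed
  have "(\<integral>\<^sup>+x. (\<Sum>k. ennreal (d k x)) \<partial>M) = (\<Sum>k. \<integral>\<^sup>+x. ennreal (d k x) \<partial>M)"
    by (intro nn_integral_suminf) simp
  also have "\<dots> \<le> (\<Sum>k. ennreal ((1/2)^k))"
    by (intro suminf_le dint) auto
  also have "\<dots> = ennreal (\<Sum>k. (1/2)^k)"
    by (intro suminf_ennreal2) auto
  also have "\<dots> < \<infinity>" by simp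
  finally have fin: "(\<integral>\<^sup>+x. (\<Sum>k. ennreal (d k x)) \<partial>M) \<noteq> \<infinity>" by simp
  have AEfin: "AE x in M. (\<Sum>k. ennreal (d k x)) \<noteq> \<infinity>"
    by (rule nn_integral_PInf_AE[OF _ fin]) measurable
  have conv: "AE x in M. convergent (\<lambda>k. f (r k) x)"
    using AEfin
  proof eventually_elim
    case (elim x)
    define S where "S = (\<Sum>k. ennreal (d k x))"
    obtain C where C: "S = ennreal C" "C \<ge> 0"
      using elim unfolding S_def by (cases "\<Sum>k. ennreal (d k x)") auto
    have "d k x \<le> C" for k
    proof -
      have "ennreal (d k x) \<le> S"
        using sum_le_suminf[of "\<lambda>k. ennreal (d k x)" "{k}"] by (simp add: S_def)
      then show ?thesis using C by (simp add: ennreal_le_iff)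
    qed
    moreover have "(2^k)\<^sup>2 = (4::real)^k" for k
      by (simp add: power2_eq_square flip: power_mult_distrib)
    ultimately have "(2^k * norm (f (r (Suc k)) x - f (r k) x))\<^sup>2 \<le> C" for k
      by (simp add: d_def power_mult_distrib)
    then have "2^k * norm (f (r (Suc k)) x - f (r k) x) \<le> sqrt C" for k
      by (rule real_le_rsqrt)
    then have le: "norm (f (r (Suc k)) x - f (r k) x) \<le> sqrt C * (1/2)^k" for k
      by (simp add: power_divide pos_le_divide_eq mult.commute)
    have "summable (\<lambda>k. sqrt C * (1/2)^k)" by (intro summable_mult summable_geometric) simp
    then have "summable (\<lambda>k. f (r (Suc k)) x - f (r k) x)"
      by (rule summable_comparison_test'[where N = 0]) (rule le)
    then obtain s where "(\<lambda>n. \<Sum>k<n. f (r (Suc k)) x - f (r k) x) \<longlonglongrightarrow> s"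
      using summable_LIMSEQ by blast
    then have "(\<lambda>n. f (r n) x - f (r 0) x) \<longlonglongrightarrow> s"
      by (simp only: sum_lessThan_telescope[of "\<lambda>k. f (r k) x"])
    then have "(\<lambda>n. f (r n) x - f (r 0) x + f (r 0) x) \<longlonglongrightarrow> s + f (r 0) x"
      by (intro tendsto_intros)
    then show ?case by (auto simp: convergent_def)
  qed
  define l where "l x = lim (\<lambda>k. f (r k) x)" for x
  have lm[measurable]: "l \<in> borel_measurable M"
    unfolding l_def by (intro borel_measurable_lim_metric) simp
  \<comment> \<open>Fatou along \<open>r\<close> compares \<open>f n\<close> with \<open>l\<close>
    through the distances to \<open>f (r k)\<close>, all below \<open>e\<close> once
    \<open>r k\<close> is beyond \<open>K\<close>.\<close>
  have bound: "(\<integral>\<^sup>+x. ennreal ((norm (f n x - l x))\<^sup>2) \<partial>M) \<le> ennreal e"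
    if e: "e > 0" and M: "\<And>m. m \<ge> K \<Longrightarrow> (\<integral>x. (norm (f n x - f m x))\<^sup>2 \<partial>M) < e" for n K e
  proof -
    have "AE x in M. ennreal ((norm (f n x - l x))\<^sup>2) = liminf (\<lambda>k. ennreal ((norm (f n x - f (r k) x))\<^sup>2))"
      using conv
    proof eventually_elim
      case (elim x)
      then have "(\<lambda>k. f (r k) x) \<longlonglongrightarrow> l x" unfolding l_def by (simp add: convergent_LIMSEQ_iff)
      then have "(\<lambda>k. ennreal ((norm (f n x - f (r k) x))\<^sup>2)) \<longlonglongrightarrow> ennreal ((norm (f n x - l x))\<^sup>2)"
        by (intro tendsto_intros)
      then show ?case using lim_imp_Liminf trivial_limit_sequentially by metis
    qed
    then have "(\<integral>\<^sup>+x. ennreal ((norm (f n x - l x))\<^sup>2) \<partial>M)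
        = (\<integral>\<^sup>+x. liminf (\<lambda>k. ennreal ((norm (f n x - f (r k) x))\<^sup>2)) \<partial>M)"
      by (rule nn_integral_cong_AE)
    also have "\<dots> \<le> liminf (\<lambda>k. \<integral>\<^sup>+x. ennreal ((norm (f n x - f (r k) x))\<^sup>2) \<partial>M)"
      by (intro nn_integral_liminf) simp
    also have "\<dots> \<le> liminf (\<lambda>k. ennreal e)"
    proof (rule Liminf_mono, rule eventually_sequentiallyI)
      fix k assume "k \<ge> K"
      then have "r k \<ge> K" unfolding r_def by simp
      then show "(\<integral>\<^sup>+x. ennreal ((norm (f n x - f (r k) x))\<^sup>2) \<partial>M) \<le> ennreal e"
        unfolding nn using M by (intro ennreal_leI less_imp_le)
    qed
    also have "\<dots> = ennreal e" by (simp add: Liminf_const)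
    finally show ?thesis .
  qed
  have L2diff: "(\<lambda>x. f n x - l x) \<in> L2_on M"
    if e: "e > 0" and M: "\<And>m. m \<ge> K \<Longrightarrow> (\<integral>x. (norm (f n x - f m x))\<^sup>2 \<partial>M) < e" for n K e
  proof -
    have "(\<integral>\<^sup>+x. ennreal ((norm (f n x - l x))\<^sup>2) \<partial>M) \<le> ennreal e"
      by (rule bound[OF e M])
    also have "\<dots> < \<infinity>" by simp
    finally have "(\<integral>\<^sup>+x. ennreal ((norm (f n x - l x))\<^sup>2) \<partial>M) < \<infinity>" .
    then have "integrable M (\<lambda>x. (norm (f n x - l x))\<^sup>2)"
      by (intro integrableI_bounded) auto
    then show ?thesis by (simp add: L2_on_def)
  qed
  have lL2: "l \<in> L2_on M"
  proof -
    obtain K where K: "\<forall>m\<ge>K. \<forall>n\<ge>K. (\<integral>x. (norm (f m x - f n x))\<^sup>2 \<partial>M) < 1" using Cau[of 1] by auto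
    have "(\<lambda>x. f K x - l x) \<in> L2_on M" by (rule L2diff[of 1 K]) (simp, rule K[rule_format], auto)
    from lin_fun_L2_on[OF f[of K] this, of 1 "-1"] show ?thesis by (simp add: lin_fun_def)
  qed
  moreover have "(\<lambda>n. \<integral>x. (norm (f n x - l x))\<^sup>2 \<partial>M) \<longlonglongrightarrow> 0"
  proof (rule LIMSEQ_I)
    fix e :: real assume e: "e > 0"
    obtain K where K: "\<forall>m\<ge>K. \<forall>n\<ge>K. (\<integral>x. (norm (f m x - f n x))\<^sup>2 \<partial>M) < e/2" using Cau[of "e/2"] e by auto
    have "norm ((\<integral>x. (norm (f n x - l x))\<^sup>2 \<partial>M) - 0) < e" if n: "n \<ge> K" for n
    proof -
      have Kn: "(\<integral>x. (norm (f n x - f m x))\<^sup>2 \<partial>M) < e/2" if "m \<ge> K" for m using K n that by blast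
      have "ennreal (\<integral>x. (norm (f n x - l x))\<^sup>2 \<partial>M) = (\<integral>\<^sup>+x. ennreal ((norm (f n x - l x))\<^sup>2) \<partial>M)"
        using L2_onD(2)[OF L2diff[OF half_gt_zero[OF e] Kn]]
        by (intro nn_integral_eq_integral[symmetric]) auto
      also have "\<dots> \<le> ennreal (e/2)" by (rule bound[OF half_gt_zero[OF e] Kn])
      finally have "(\<integral>x. (norm (f n x - l x))\<^sup>2 \<partial>M) \<le> e/2" using e by (simp add: ennreal_le_iff)
      moreover have "0 \<le> (\<integral>x. (norm (f n x - l x))\<^sup>2 \<partial>M)" by simp
      ultimately show ?thesis using e by simp
    qed
    then show "\<exists>K. \<forall>n\<ge>K. norm ((\<integral>x. (norm (f n x - l x))\<^sup>2 \<partial>M) - 0) < e" by blast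
  qed
  ultimately show ?thesis by blast
qed

lemma semi_hilbert_L2_on: "semi_hilbert (L2_on M) lin_fun (ip_on M)"
proof
  have "(\<lambda>x. 0) \<in> L2_on M" by (simp add: L2_on_def)
  then show "L2_on M \<noteq> {}" by blast
  show "lin_fun a x b y \<in> L2_on M" if "x \<in> L2_on M" "y \<in> L2_on M" for a x b y
    using lin_fun_L2_on that .
  show "ip_on M x y = ip_on M y x" for x y by (simp add: ip_on_def inner_commute)
  show "0 \<le> ip_on M x x" for x by (simp add: ip_on_def)
  show "ip_on M (lin_fun a x b y) z = a * ip_on M x z + b * ip_on M y z"
    if "x \<in> L2_on M" "y \<in> L2_on M" "z \<in> L2_on M" for a x b y z
    using integrable_inner_L2_on[OF that(1,3)] integrable_inner_L2_on[OF that(2,3)]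
    by (simp add: ip_on_def lin_fun_def inner_add_left)
  show "\<exists>l\<in>L2_on M. (\<lambda>n. ip_on M (f n) (f n) - 2 * ip_on M (f n) l + ip_on M l l) \<longlonglongrightarrow> 0"
    if f: "\<And>n. f n \<in> L2_on M"
      and Cau: "\<And>e. e > 0 \<Longrightarrow> \<exists>N. \<forall>m\<ge>N. \<forall>n\<ge>N. ip_on M (f m) (f m) - 2 * ip_on M (f m) (f n) + ip_on M (f n) (f n) < e"
    for f :: "nat \<Rightarrow> 'a \<Rightarrow> 'b"
  proof -
    obtain l where l: "l \<in> L2_on M" and "(\<lambda>n. \<integral>x. (norm (f n x - l x))\<^sup>2 \<partial>M) \<longlonglongrightarrow> 0"
      using L2_on_complete[OF f Cau[unfolded ip_on_dsq[OF f f]]] by blast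
    then show ?thesis by (intro bexI[OF _ l]) (simp only: ip_on_dsq[OF f l])
  qed
qed

interpretation L2_on: semi_hilbert "L2_on M" lin_fun "ip_on M" for M :: "'a measure"
  by (rule semi_hilbert_L2_on)

lemma L2_on_dsq: "f \<in> L2_on M \<Longrightarrow> g \<in> L2_on M \<Longrightarrow> L2_on.dsq M f g = (\<integral>x. (norm (f x - g x))\<^sup>2 \<partial>M)"
  by (simp add: L2_on.dsq_def ip_on_dsq)

lemma L2_eq: "L2 \<Omega> = L2_on (lebesgue_on \<Omega>)"
  by (simp only: L2_def L2_on_def)

lemma L2_inner_eq: "L2_inner \<Omega> f g = ip_on (lebesgue_on \<Omega>) f g"
  by (simp only: L2_inner_def ip_on_def)

section \<open>Calculus of smooth functions\<close>

lemma has_derivative_partial: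
  assumes "\<And>x. (f has_derivative f' x) (at x)"
  shows "partial i f = (\<lambda>x. f' x (axis i 1))"
  unfolding partial_def using frechet_derivative_at[OF assms] by (auto simp: fun_eq_iff)

lemma has_derivative_frechet:
  "f differentiable (at x) \<Longrightarrow> (f has_derivative frechet_derivative f (at x)) (at x)"
  by (simp add: frechet_derivative_works)

lemma frechet_derivative_eq_sum_partial:
  fixes f :: "real^'n \<Rightarrow> 'b::real_normed_vector"
  assumes "f differentiable (at x)"
  shows "frechet_derivative f (at x) h = (\<Sum>i\<in>UNIV. (h $ i) *\<^sub>R partial i f x)"
proof -
  interpret linear "frechet_derivative f (at x)"
    using has_derivative_frechet[OF assms] by (rule has_derivative_linear)
  have "frechet_derivative f (at x) h = frechet_derivative f (at x) (\<Sum>i\<in>UNIV. (h $ i) *\<^sub>R axis i 1)"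
    using basis_expansion[of h] by (simp add: scalar_mult_eq_scaleR)
  then show ?thesis by (simp add: sum scaleR partial_def)
qed

lemma Ck_SucD: "Ck (Suc k) f \<Longrightarrow> Ck k f"
proof (induction k arbitrary: f)
  case 0
  then have "\<And>x. isCont f x" by (auto intro: differentiable_imp_continuous_within)
  then show ?case by (simp add: continuous_at_imp_continuous_on)
next
  case (Suc k)
  then show ?case by (simp only: Ck.simps(2)[of "Suc k"] Ck.simps(2)[of k]) blast
qed

lemma Ck_continuous: "Ck k f \<Longrightarrow> continuous_on UNIV f"
  by (induction k) (use Ck_SucD in \<open>auto simp del: Ck.simps(2)\<close>)

lemma Ck_differentiable: "Ck (Suc k) f \<Longrightarrow> (f has_derivative frechet_derivative f (at x)) (at x)"
  by (simp add: has_derivative_frechet)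

lemma smooth_continuous: "smooth f \<Longrightarrow> continuous_on UNIV f"
  unfolding smooth_def using Ck_continuous by blast

lemma smooth_differentiable: "smooth f \<Longrightarrow> f differentiable (at x)"
  unfolding smooth_def by (metis Ck.simps(2))

lemma smooth_partial: "smooth f \<Longrightarrow> smooth (partial i f)"
  unfolding smooth_def by (metis Ck.simps(2))

lemma Ck_const: "Ck k (\<lambda>x :: real^'n. c)"
proof (induction k arbitrary: c)
  case (Suc k)
  have "partial i (\<lambda>x :: real^'n. c) = (\<lambda>x. 0)" for i
    by (rule has_derivative_partial) (rule has_derivative_const)
  then show ?case using Suc by simp
qed simp

lemma partial_add:
  assumes "\<And>x. f differentiable (at x)" "\<And>x. g differentiable (at x)"
  shows "partial i (\<lambda>x. f x + g x) = (\<lambda>x. partial i f x + partial i g x)"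
  unfolding partial_def[of i f] partial_def[of i g]
  by (rule has_derivative_partial) (intro has_derivative_add has_derivative_frechet assms)

lemma Ck_add: "Ck k f \<Longrightarrow> Ck k g \<Longrightarrow> Ck k (\<lambda>x. f x + g x)"
proof (induction k arbitrary: f g)
  case 0
  then show ?case by (auto intro: continuous_on_add)
next
  case (Suc k)
  then have "partial i (\<lambda>x. f x + g x) = (\<lambda>x. partial i f x + partial i g x)" for i
    by (intro partial_add) auto
  then show ?case using Suc by (auto intro: differentiable_add)
qed

lemma partial_scaleR:
  fixes f :: "real^'n \<Rightarrow> real"
  assumes "\<And>x. f differentiable (at x)" "\<And>x. g differentiable (at x)"
  shows "partial i (\<lambda>x. f x *\<^sub>R g x) = (\<lambda>x. f x *\<^sub>R partial i g x + partial i f x *\<^sub>R g x)"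
  unfolding partial_def[of i f] partial_def[of i g]
  by (rule has_derivative_partial) (intro has_derivative_scaleR has_derivative_frechet assms)

lemma Ck_scaleR:
  fixes f :: "real^'n \<Rightarrow> real"
  shows "Ck k f \<Longrightarrow> Ck k g \<Longrightarrow> Ck k (\<lambda>x. f x *\<^sub>R g x)"
proof (induction k arbitrary: f g)
  case 0
  then show ?case by (auto intro: continuous_on_scaleR)
next
  case (Suc k)
  have eq: "partial i (\<lambda>x. f x *\<^sub>R g x) = (\<lambda>x. f x *\<^sub>R partial i g x + partial i f x *\<^sub>R g x)" for i
    using Suc.prems by (intro partial_scaleR) auto
  have "Ck k (\<lambda>x. f x *\<^sub>R partial i g x + partial i f x *\<^sub>R g x)" for i
    using Suc.prems Ck_SucD[OF Suc.prems(1)] Ck_SucD[OF Suc.prems(2)] by (intro Ck_add Suc.IH) auto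
  moreover have "(\<lambda>x. f x *\<^sub>R g x) differentiable (at x)" for x
    using has_derivative_scaleR[OF Ck_differentiable[OF Suc.prems(1)] Ck_differentiable[OF Suc.prems(2)], of x]
    by (auto simp: differentiable_def)
  ultimately show ?case by (simp add: eq)
qed

lemma Ck_mult:
  fixes f g :: "real^'n \<Rightarrow> real"
  shows "Ck k f \<Longrightarrow> Ck k g \<Longrightarrow> Ck k (\<lambda>x. f x * g x)"
  using Ck_scaleR[of k f g] by simp

lemma partial_reflect:
  fixes f :: "real^'n \<Rightarrow> 'b::real_normed_vector"
  assumes "\<And>x. f differentiable (at x)"
  shows "partial i (\<lambda>z. f (x - z)) = (\<lambda>z. (- 1) *\<^sub>R partial i f (x - z))"
proof -
  have *: "((\<lambda>z. f (x - z)) has_derivative (\<lambda>h. frechet_derivative f (at (x - z)) (- h))) (at z)" for z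
  proof (rule has_derivative_compose[of "\<lambda>z. x - z" "\<lambda>h. - h" z UNIV f])
    show "((\<lambda>z. x - z) has_derivative (\<lambda>h. - h)) (at z)"
      by (auto intro!: derivative_eq_intros)
  qed (rule has_derivative_frechet[OF assms])
  have "linear (frechet_derivative f (at y))" for y
    using has_derivative_frechet[OF assms] by (rule has_derivative_linear)
  then show ?thesis
    unfolding has_derivative_partial[OF *] by (simp add: linear_neg partial_def)
qed

lemma Ck_reflect: "Ck k f \<Longrightarrow> Ck k (\<lambda>z. f (x - z))"
proof (induction k arbitrary: f)
  case 0
  then show ?case by (auto intro!: continuous_on_compose2[of UNIV f] continuous_intros)
next
  case (Suc k)
  have eq: "partial i (\<lambda>z. f (x - z)) = (\<lambda>z. (- 1) *\<^sub>R partial i f (x - z))" for i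
    using Suc.prems by (intro partial_reflect) auto
  have "(\<lambda>z. f (x - z)) differentiable (at z)" for z
  proof (rule differentiable_compose[of f "\<lambda>z. x - z"])
    show "f differentiable at (x - z)" using Suc.prems by simp
  qed (auto intro: derivative_intros)
  moreover have "Ck k (\<lambda>z. (- 1) *\<^sub>R partial i f (x - z))" for i
    using Suc by (intro Ck_scaleR[of k "\<lambda>z. - 1"] Ck_const) auto
  ultimately show ?case by (simp add: eq)
qed

lemma partial_coordinate:
  fixes f f' :: "real \<Rightarrow> real"
  assumes "\<And>t. DERIV f t :> f' t"
  shows "partial i (\<lambda>x :: real^'n. f (a * x $ j + b)) = (\<lambda>x. (if i = j then a else 0) * f' (a * x $ j + b))"
    and "(\<lambda>x :: real^'n. f (a * x $ j + b)) differentiable (at x)"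
proof -
  have *: "((\<lambda>x :: real^'n. f (a * x $ j + b)) has_derivative (\<lambda>h. (a * h $ j) * f' (a * x $ j + b))) (at x)" for x
    by (rule DERIV_compose_FDERIV[where g = "\<lambda>x. a * x $ j + b" and f = f, OF assms])
      (auto intro!: derivative_eq_intros bounded_linear_imp_has_derivative bounded_linear_vec_nth)
  then show "(\<lambda>x :: real^'n. f (a * x $ j + b)) differentiable (at x)"
    by (auto simp: differentiable_def)
  show "partial i (\<lambda>x :: real^'n. f (a * x $ j + b)) = (\<lambda>x. (if i = j then a else 0) * f' (a * x $ j + b))"
    unfolding has_derivative_partial[OF *] by (auto simp: axis_def)
qed

lemma Ck_coordinate:
  fixes f f' :: "real \<Rightarrow> real"
  assumes "\<And>t. DERIV f t :> f' t" "Ck k (\<lambda>x :: real^'n. f' (a * x $ j + b))"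
  shows "Ck (Suc k) (\<lambda>x :: real^'n. f (a * x $ j + b))"
  using assms(2) by (auto simp: partial_coordinate[OF assms(1)] intro!: Ck_mult Ck_const)

text \<open>The family \<open>D\<close> lists a function of one variable together with its
  successive derivatives, so that the induction on \<open>k\<close> can move along the
  family.\<close>

lemma Ck_coordinate_derivatives:
  fixes D :: "nat \<Rightarrow> real \<Rightarrow> real"
  assumes "\<And>n t. DERIV (D n) t :> D (Suc n) t"
  shows "Ck k (\<lambda>x :: real^'n. D n (a * x $ j + b))"
proof (induction k arbitrary: n)
  case 0
  have "(\<lambda>x :: real^'n. D n (a * x $ j + b)) differentiable (at x)" for x
    by (rule partial_coordinate(2)[OF assms])
  then show ?case
    by (auto intro!: continuous_at_imp_continuous_on differentiable_imp_continuous_within)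
next
  case (Suc k)
  then show ?case by (intro Ck_coordinate[OF assms])
qed

section \<open>Supports and test functions\<close>

lemma closed_supp: "closed (supp f)"
  by (simp add: supp_def)

lemma partial_outside_supp:
  assumes "x \<notin> supp f"
  shows "partial i f x = 0"
proof -
  have "((\<lambda>x. 0) has_derivative (\<lambda>h. 0)) (at x)" by simp
  then have "(f has_derivative (\<lambda>h. 0)) (at x)"
  proof (rule has_derivative_transform_within_open[of _ _ _ _ "- supp f"])
    show "open (- supp f)" by (simp add: closed_supp open_Compl)
    show "0 = f y" if "y \<in> - supp f" for y
      using that closure_subset[of "{x. f x \<noteq> 0}"] by (auto simp: supp_def)
  qed (use assms in auto)
  from frechet_derivative_at[OF this] show ?thesis by (simp add: partial_def fun_eq_iff)
qed

lemma not_in_supp: "x \<notin> supp f \<Longrightarrow> f x = 0"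
  using closure_subset[of "{x. f x \<noteq> 0}"] by (auto simp: supp_def)

lemma supp_subset: "closed C \<Longrightarrow> (\<And>x. x \<notin> C \<Longrightarrow> f x = 0) \<Longrightarrow> supp f \<subseteq> C"
  unfolding supp_def by (rule closure_minimal) auto

lemma supp_partial: "supp (partial i f) \<subseteq> supp f"
  by (intro supp_subset closed_supp partial_outside_supp)

lemma compact_supp_subset:
  fixes f :: "'a::t2_space \<Rightarrow> 'b::zero"
  assumes "compact C" "\<And>x. x \<notin> C \<Longrightarrow> f x = 0"
  shows "compact (supp f)"
proof -
  have "supp f \<subseteq> C" using assms by (intro supp_subset compact_imp_closed)
  then have "supp f = supp f \<inter> C" by blast
  then show ?thesis using closed_Int_compact[OF closed_supp assms(1), of f] by simp
qed

lemma test_functions_partial: "f \<in> test_functions \<Omega> \<Longrightarrow> partial i f \<in> test_functions \<Omega>"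
  using supp_partial[of i f] compact_supp_subset[of "supp f" "partial i f"] partial_outside_supp[of _ f i]
  by (auto simp: test_functions_def smooth_partial)

section \<open>A smooth step\<close>

text \<open>The classical flat function exp(-1/t) times a polynomial in 1/t. Allowing all
  polynomials closes the family under differentiation, also at 0.\<close>

definition exp_recip :: "real poly \<Rightarrow> real \<Rightarrow> real" where
  "exp_recip p t = (if t > 0 then poly p (1 / t) * exp (- (1 / t)) else 0)"

lemma tendsto_poly_exp: "((\<lambda>x. poly p x * exp (- x)) \<longlongrightarrow> (0::real)) at_top"
proof -
  have "((\<lambda>x. \<Sum>i\<le>degree p. coeff p i * (x ^ i / exp x)) \<longlongrightarrow> (\<Sum>i\<le>degree p. coeff p i * 0)) at_top"
    by (intro tendsto_intros tendsto_power_div_exp_0)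
  moreover have "(\<Sum>i\<le>degree p. coeff p i * (x ^ i / exp x)) = poly p x * exp (- x)" for x
    by (simp add: poly_altdef sum_distrib_right exp_minus divide_inverse mult.assoc)
  ultimately show ?thesis by simp
qed

lemma tendsto_exp_recip: "(exp_recip p \<longlongrightarrow> 0) (at 0)"
proof (rule filterlim_split_at)
  have "\<forall>\<^sub>F t in at_left 0. exp_recip p t = 0"
    by (auto simp: exp_recip_def eventually_at_filter)
  then show "(exp_recip p \<longlongrightarrow> 0) (at_left 0)" by (rule tendsto_eventually)
  have "((\<lambda>t. poly p (inverse t) * exp (- inverse t)) \<longlongrightarrow> 0) (at_right 0)"
    by (rule filterlim_compose[OF tendsto_poly_exp filterlim_inverse_at_top_right])
  moreover have "\<forall>\<^sub>F t in at_right 0. poly p (inverse t) * exp (- inverse t) = exp_recip p t"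
    by (auto simp: exp_recip_def eventually_at_filter inverse_eq_divide)
  ultimately show "(exp_recip p \<longlongrightarrow> 0) (at_right 0)" by (rule Lim_transform_eventually)
qed

text \<open>By the product and chain rules the derivative of p(1/t) exp(-1/t) is (p(1/t) - p'(1/t))
  exp(-1/t) / t^2, and the factor 1/t^2 is the monomial of degree two.\<close>

definition exp_recip_poly :: "real poly \<Rightarrow> real poly" where
  "exp_recip_poly p = monom 1 2 * (p - pderiv p)"

lemma DERIV_exp_recip: "DERIV (exp_recip p) t :> exp_recip (exp_recip_poly p) t"
proof -
  consider "t > 0" | "t < 0" | "t = 0" by linarith
  then show ?thesis
  proof cases
    case 1
    have "DERIV (\<lambda>t. poly p (1 / t) * exp (- (1 / t))) t :> exp_recip (exp_recip_poly p) t"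
      using 1 by (auto intro!: derivative_eq_intros poly_DERIV[THEN DERIV_chain2]
          simp: exp_recip_def exp_recip_poly_def poly_monom field_simps power2_eq_square)
    then show ?thesis
      by (rule has_field_derivative_transform_within_open[of _ _ _ "{0<..}"]) (use 1 in \<open>auto simp: exp_recip_def\<close>)
  next
    case 2
    have "DERIV (\<lambda>t::real. 0::real) t :> exp_recip (exp_recip_poly p) t"
      using 2 by (simp add: exp_recip_def)
    then show ?thesis
      by (rule has_field_derivative_transform_within_open[of _ _ _ "{..<0}"]) (use 2 in \<open>auto simp: exp_recip_def\<close>)
  next
    case 3
    \<comment> \<open>At the origin the difference quotient is again a member of the family, with
      the polynomial multiplied by its variable, so the limit is
      \<open>tendsto_exp_recip\<close>.\<close>
    have "exp_recip (pCons 0 p) h = (exp_recip p (0 + h) - exp_recip p 0) / h" for h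
      by (simp add: exp_recip_def)
    then have "exp_recip (pCons 0 p) = (\<lambda>h. (exp_recip p (0 + h) - exp_recip p 0) / h)"
      by (rule ext)
    then have "(\<lambda>h. (exp_recip p (0 + h) - exp_recip p 0) / h) \<midarrow>0\<rightarrow> 0"
      using tendsto_exp_recip[of "pCons 0 p"] by metis
    then show ?thesis using 3 by (simp add: DERIV_def exp_recip_def)
  qed
qed

lemma Ck_exp_recip: "Ck k (\<lambda>x :: real^'n. exp_recip p (a * x $ j + b))"
  using Ck_coordinate_derivatives[of "\<lambda>n. exp_recip ((exp_recip_poly ^^ n) p)" k 0 a j b] DERIV_exp_recip
  by simp

definition raw_bump :: "real \<Rightarrow> real" where
  "raw_bump t = exp_recip 1 (1 + t) * exp_recip 1 (1 - t)"

lemma raw_bump_pos: "\<bar>t\<bar> < 1 \<Longrightarrow> raw_bump t > 0"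
  by (simp add: raw_bump_def exp_recip_def)

lemma raw_bump_zero: "\<bar>t\<bar> \<ge> 1 \<Longrightarrow> raw_bump t = 0"
  by (auto simp: raw_bump_def exp_recip_def)

lemma raw_bump_nonneg: "raw_bump t \<ge> 0"
  using raw_bump_pos[of t] raw_bump_zero[of t] by (cases "\<bar>t\<bar> < 1") auto

lemma isCont_raw_bump: "isCont raw_bump t"
proof -
  have "isCont (\<lambda>t. exp_recip 1 (1 + t) * exp_recip 1 (1 - t)) t"
    by (intro continuous_intros isCont_o2[OF _ DERIV_isCont[OF DERIV_exp_recip]])
  then show ?thesis by (simp add: raw_bump_def[abs_def])
qed

text \<open>Take an antiderivative of the bump, constant on either side of the interval, and rescale
  it to climb from 0 to 1. The factor \<open>c\<close> is the reciprocal of the mass of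
  \<open>raw_bump\<close>, so step and normalised bump arise together.\<close>

lemma ex_smooth_step:
  "\<exists>(\<Phi> :: real \<Rightarrow> real) c. c > 0 \<and> (\<forall>t. DERIV \<Phi> t :> c * raw_bump t) \<and> (\<forall>t\<le>-1. \<Phi> t = 0) \<and> (\<forall>t\<ge>1. \<Phi> t = 1)"
proof -
  obtain F where F: "\<And>t. DERIV F t :> raw_bump t"
    using einterval_antiderivative[of "-\<infinity>" "\<infinity>" raw_bump] isCont_raw_bump
    by (auto simp: has_real_derivative_iff_has_vector_derivative)
  have "continuous_on {-1..1} F"
    using F DERIV_isCont by (blast intro: continuous_at_imp_continuous_on)
  moreover have "\<exists>y. DERIV F x :> y \<and> y > 0" if "-1 < x" "x < 1" for x
    using F raw_bump_pos[of x] that by (intro exI[of _ "raw_bump x"]) auto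
  ultimately have pos: "F (-1) < F 1"
    by (intro DERIV_pos_imp_increasing_open[of "-1" 1 F]) auto
  have left: "F t = F (-1)" if "t \<le> -1" for t
  proof -
    have "\<exists>c. \<forall>x\<in>{..-1}. F x = c"
      by (rule has_field_derivative_zero_constant)
        (auto intro!: has_field_derivative_at_within[OF F, THEN DERIV_cong] simp: raw_bump_zero)
    then show ?thesis using that by auto
  qed
  have right: "F t = F 1" if "t \<ge> 1" for t
  proof -
    have "\<exists>c. \<forall>x\<in>{1..}. F x = c"
      by (rule has_field_derivative_zero_constant)
        (auto intro!: has_field_derivative_at_within[OF F, THEN DERIV_cong] simp: raw_bump_zero)
    then show ?thesis using that by auto
  qed
  define c where "c = 1 / (F 1 - F (-1))"
  have "DERIV (\<lambda>t. c * (F t - F (-1))) t :> c * raw_bump t" for t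
    by (auto intro!: derivative_eq_intros F)
  moreover have "c > 0" "c * (F 1 - F (-1)) = 1" using pos by (auto simp: c_def)
  moreover have "\<forall>t\<le>-1. c * (F t - F (-1)) = 0"
  proof (intro allI impI)
    fix t :: real assume "t \<le> -1"
    from left[OF this] show "c * (F t - F (-1)) = 0" by simp
  qed
  moreover have "\<forall>t\<ge>1. c * (F t - F (-1)) = 1"
  proof (intro allI impI)
    fix t :: real assume "t \<ge> 1"
    from right[OF this] show "c * (F t - F (-1)) = 1" using \<open>c * (F 1 - F (-1)) = 1\<close> by simp
  qed
  ultimately show ?thesis by blast
qed

text \<open>Chosen as a pair, so that \<open>bump\<close> is exactly the derivative of
  \<open>step\<close>.\<close>

definition step_mass :: "(real \<Rightarrow> real) \<times> real" where
  "step_mass = (SOME (\<Phi>, c). c > 0 \<and> (\<forall>t. DERIV \<Phi> t :> c * raw_bump t) \<and> (\<forall>t\<le>-1. \<Phi> t = 0) \<and> (\<forall>t\<ge>1. \<Phi> t = 1))"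

definition step :: "real \<Rightarrow> real" where
  "step = fst step_mass"

definition bump :: "real \<Rightarrow> real" where
  "bump t = snd step_mass * raw_bump t"

lemma step_mass:
  "snd step_mass > 0" "DERIV step t :> bump t" "t \<le> -1 \<Longrightarrow> step t = 0" "t \<ge> 1 \<Longrightarrow> step t = 1"
proof -
  have "\<exists>p. case p of (\<Phi>, c) \<Rightarrow> c > 0 \<and> (\<forall>t. DERIV \<Phi> t :> c * raw_bump t) \<and> (\<forall>t\<le>-1. \<Phi> t = 0) \<and> (\<forall>t\<ge>1. \<Phi> t = 1)"
    using ex_smooth_step by auto
  from someI_ex[OF this]
  show "snd step_mass > 0" "DERIV step t :> bump t" "t \<le> -1 \<Longrightarrow> step t = 0" "t \<ge> 1 \<Longrightarrow> step t = 1"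
    unfolding step_mass_def[symmetric] by (auto simp: step_def bump_def[abs_def] split_beta)
qed

lemma bump_nonneg: "bump t \<ge> 0"
  using step_mass(1) raw_bump_nonneg[of t] by (simp add: bump_def)

lemma bump_zero: "\<bar>t\<bar> \<ge> 1 \<Longrightarrow> bump t = 0"
  by (simp add: bump_def raw_bump_zero)

lemma Ck_bump: "Ck k (\<lambda>x :: real^'n. bump (a * x $ j))"
proof -
  have "Ck k (\<lambda>x :: real^'n. snd step_mass * (exp_recip 1 (a * x $ j + 1) * exp_recip 1 ((- a) * x $ j + 1)))"
    by (intro Ck_mult Ck_const Ck_exp_recip)
  then show ?thesis by (simp add: bump_def raw_bump_def add.commute)
qed

lemma Ck_step: "Ck k (\<lambda>x :: real^'n. step (a * x $ j))"
proof -
  have "Ck (Suc k) (\<lambda>x :: real^'n. step (a * x $ j + 0))"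
    by (rule Ck_coordinate[OF step_mass(2)]) (simp add: Ck_bump)
  then show ?thesis using Ck_SucD by fastforce
qed

lemma step_bounds: "0 \<le> step t" "step t \<le> 1"
proof -
  have mono: "step a \<le> step b" if "a \<le> b" for a b
    using that step_mass(2) bump_nonneg by (intro DERIV_nonneg_imp_nondecreasing[of a b step]) blast+
  show "0 \<le> step t" using mono[of "min t (-1)" t] step_mass(3)[of "min t (-1)"] by simp
  show "step t \<le> 1" using mono[of t "max t 1"] step_mass(4)[of "max t 1"] by simp
qed

lemma isCont_bump: "isCont bump t"
  unfolding bump_def[abs_def] by (intro continuous_intros isCont_raw_bump)

lemma nn_integral_bump:
  assumes e: "e > 0"
  shows "(\<integral>\<^sup>+t. ennreal (bump (t / e) / e) \<partial>lborel) = 1"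
proof -
  have c: "continuous_on UNIV (\<lambda>t. bump (t / e) / e)"
  proof (rule continuous_at_imp_continuous_on, rule ballI)
    fix t
    have "isCont (\<lambda>t. t / e) t" using e by (intro continuous_intros) auto
    then have "isCont (\<lambda>t. bump (t / e)) t" by (rule isCont_o2) (rule isCont_bump)
    then show "isCont (\<lambda>t. bump (t / e) / e) t" using e by (intro continuous_intros) auto
  qed
  have "(\<integral>\<^sup>+t. ennreal (bump (t / e) / e) * indicator {-e..e} t \<partial>lborel) = ennreal (step (e / e) - step (- e / e))"
  proof (rule nn_integral_FTC_Icc)
    show "DERIV (\<lambda>t. step (t / e)) t :> bump (t / e) / e" for t
    proof -
      have "DERIV (\<lambda>t. t / e) t :> 1 / e" using e by (auto intro!: derivative_eq_intros)
      from DERIV_chain2[where f = step and g = "\<lambda>t. t / e", OF step_mass(2) this] show ?thesis by simp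
    qed
    show "(\<lambda>t. bump (t / e) / e) \<in> borel_measurable borel"
      using c by (rule borel_measurable_continuous_onI)
    show "0 \<le> bump (t / e) / e" for t using e bump_nonneg by simp
  qed (use e in auto)
  also have "(\<integral>\<^sup>+t. ennreal (bump (t / e) / e) * indicator {-e..e} t \<partial>lborel) = (\<integral>\<^sup>+t. ennreal (bump (t / e) / e) \<partial>lborel)"
  proof (rule nn_integral_cong)
    fix t
    have "bump (t / e) = 0" if "t \<notin> {-e..e}"
    proof (rule bump_zero)
      have "e \<le> \<bar>t\<bar>" using that by auto
      then show "1 \<le> \<bar>t / e\<bar>" using e by (simp add: abs_divide)
    qed
    then show "ennreal (bump (t / e) / e) * indicator {-e..e} t = ennreal (bump (t / e) / e)"
      by (cases "t \<in> {-e..e}") auto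
  qed
  finally show ?thesis using e step_mass(3)[of "-1"] step_mass(4)[of 1] by simp
qed

section \<open>Convolution\<close>

text \<open>The integral runs over the whole space: fields given on \<Omega> are first cut off to
  vanish outside it and only then convolved.\<close>

definition conv :: "(real^'n \<Rightarrow> real) \<Rightarrow> (real^'n \<Rightarrow> 'b::euclidean_space) \<Rightarrow> real^'n \<Rightarrow> 'b" where
  "conv k b x = (\<integral>z. k (x - z) *\<^sub>R b z \<partial>lebesgue)"

lemma uniformly_continuous_compact_supp:
  fixes f :: "'a::euclidean_space \<Rightarrow> 'b::real_normed_vector"
  assumes f: "continuous_on UNIV f" and C: "compact C" "\<And>x. x \<notin> C \<Longrightarrow> f x = 0" and e: "e > 0"
  obtains d where "d > 0" "\<And>x y. norm (x - y) < d \<Longrightarrow> norm (f x - f y) \<le> e"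
proof -
  \<comment> \<open>The set thickened by 1: if one of two points closer than 1 lies in
    \<open>C\<close>, both lie in \<open>C'\<close>; otherwise \<open>f\<close> vanishes at
    both.\<close>
  define C' where "C' = {x + y | x y. x \<in> C \<and> y \<in> cball 0 1}"
  have "compact C'" unfolding C'_def using C by (intro compact_sums) auto
  then have "uniformly_continuous_on C' f"
    using f by (intro compact_uniformly_continuous) (auto intro: continuous_on_subset)
  then obtain d where d: "d > 0" "\<And>x y. x \<in> C' \<Longrightarrow> y \<in> C' \<Longrightarrow> dist y x < d \<Longrightarrow> dist (f y) (f x) < e"
    using e unfolding uniformly_continuous_on_def by metis
  have near: "y \<in> C'" if "x \<in> C" "norm (x - y) < 1" for x y
  proof -
    have "y = x + (y - x)" "y - x \<in> cball 0 1" using that by (auto simp: norm_minus_commute)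
    then show ?thesis using that(1) unfolding C'_def by blast
  qed
  have "norm (f x - f y) \<le> e" if xy: "norm (x - y) < min d 1" for x y
  proof (cases "x \<in> C \<or> y \<in> C")
    case True
    then have "x \<in> C' \<and> y \<in> C'"
      using near[of x y] near[of y x] near[of x x] near[of y y] xy by (auto simp: norm_minus_commute)
    then show ?thesis using d(2)[of y x] xy by (auto simp: dist_norm)
  next
    case False
    then show ?thesis using C(2) e by simp
  qed
  with d(1) that[of "min d 1"] show ?thesis by simp
qed

lemma bounded_compact_supp:
  fixes f :: "'a::euclidean_space \<Rightarrow> 'b::real_normed_vector"
  assumes "continuous_on UNIV f" "compact C" "\<And>x. x \<notin> C \<Longrightarrow> f x = 0"
  obtains M where "M > 0" "\<And>x. norm (f x) \<le> M"
proof -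
  have "bounded (f ` C)"
    using assms by (intro compact_imp_bounded compact_continuous_image) (auto intro: continuous_on_subset)
  then obtain M where M: "M > 0" "\<And>x. x \<in> C \<Longrightarrow> norm (f x) \<le> M" by (auto simp: bounded_pos)
  have "norm (f x) \<le> M" for x using M assms(3)[of x] by (cases "x \<in> C") auto
  with M(1) that show ?thesis by blast
qed

lemma continuous_borel_lebesgue: "continuous_on UNIV f \<Longrightarrow> f \<in> borel_measurable lebesgue"
  for f :: "'a::euclidean_space \<Rightarrow> 'b::real_normed_vector"
  by (intro measurable_completion) (simp add: borel_measurable_continuous_onI)

lemma continuous_reflect: "continuous_on UNIV k \<Longrightarrow> continuous_on UNIV (\<lambda>z. k (x - z))"
  for k :: "'a::real_normed_vector \<Rightarrow> 'b::topological_space"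
  by (rule continuous_on_compose2[of UNIV k]) (auto intro!: continuous_intros)

lemma test_functionsD:
  assumes "k \<in> test_functions \<Omega>"
  shows "smooth k" "continuous_on UNIV k" "compact (supp k)" "\<And>x. x \<notin> supp k \<Longrightarrow> k x = 0" "supp k \<subseteq> \<Omega>"
  using assms by (auto simp: test_functions_def smooth_continuous not_in_supp)

lemma test_function_bounded:
  assumes "k \<in> test_functions \<Omega>"
  obtains M where "M > 0" "\<And>x. norm (k x) \<le> M"
  using bounded_compact_supp[of k "supp k"] test_functionsD[OF assms] by metis

lemma integrable_conv:
  fixes b :: "real^'n \<Rightarrow> 'b::euclidean_space"
  assumes k: "k \<in> test_functions UNIV" and b: "integrable lebesgue b"
  shows "integrable lebesgue (\<lambda>z. k (x - z) *\<^sub>R b z)"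
proof -
  obtain M where M: "M > 0" "\<And>x. norm (k x) \<le> M" using test_function_bounded[OF k] by blast
  show ?thesis
  proof (rule Bochner_Integration.integrable_bound)
    show "integrable lebesgue (\<lambda>z. M *\<^sub>R b z)" using b by simp
    have "(\<lambda>z. k (x - z)) \<in> borel_measurable lebesgue"
      using test_functionsD(2)[OF k] by (intro continuous_borel_lebesgue continuous_reflect)
    then show "(\<lambda>z. k (x - z) *\<^sub>R b z) \<in> borel_measurable lebesgue"
      using b by (intro borel_measurable_scaleR) auto
    have "norm (k (x - z) *\<^sub>R b z) \<le> norm (M *\<^sub>R b z)" for z
      using M(1) M(2)[of "x - z"] by (simp add: mult_right_mono)
    then show "AE z in lebesgue. norm (k (x - z) *\<^sub>R b z) \<le> norm (M *\<^sub>R b z)" by simp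
  qed
qed

text \<open>The partials are uniformly continuous, so the mean value inequality gives a first-order
  remainder that is small uniformly in \<open>y\<close>. This uniformity allows differentiation of a
  convolution under the integral.\<close>

lemma uniform_differentiability:
  fixes k :: "real^'n \<Rightarrow> real"
  assumes k: "k \<in> test_functions UNIV" and e: "e > 0"
  obtains d where "d > 0"
    "\<And>y h. norm h < d \<Longrightarrow> \<bar>k (y + h) - k y - (\<Sum>i\<in>UNIV. h $ i * partial i k y)\<bar> \<le> e * norm h"
proof -
  define N where "N = real CARD('n)"
  have N: "N > 0" by (simp add: N_def)
  have "\<exists>d>0. \<forall>x y. norm (x - y) < d \<longrightarrow> norm (partial i k x - partial i k y) \<le> e / N" for i
  proof -
    have "partial i k \<in> test_functions UNIV" by (rule test_functions_partial[OF k])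
    note p = test_functionsD[OF this]
    show ?thesis
      using uniformly_continuous_compact_supp[OF p(2,3,4), of "e / N"] e N
      by (metis divide_pos_pos)
  qed
  then obtain D where D: "\<And>i. D i > 0"
    "\<And>i x y. norm (x - y) < D i \<Longrightarrow> norm (partial i k x - partial i k y) \<le> e / N" by metis
  define d where "d = Min (range D)"
  have d: "d > 0" "\<And>i. d \<le> D i" using D(1) by (auto simp: d_def)
  have diff: "k differentiable (at x)" for x using test_functionsD(1)[OF k] smooth_differentiable by blast
  have "\<bar>k (y + h) - k y - (\<Sum>i\<in>UNIV. h $ i * partial i k y)\<bar> \<le> e * norm h" if h: "norm h < d" for y h
  proof -
    let ?f = "\<lambda>x. frechet_derivative k (at x)"
    have "norm (k (y + h) - k y - ?f y (y + h - y)) \<le> norm (y + h - y) * e"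
    proof (rule differentiable_bound_linearization[where S = "ball y d"])
      show "y + t *\<^sub>R (y + h - y) \<in> ball y d" if "t \<in> {0..1}" for t
      proof -
        have "\<bar>t\<bar> * norm h \<le> 1 * norm h" using that by (intro mult_right_mono) auto
        then show ?thesis using h by (simp add: dist_norm)
      qed
      show "(k has_derivative ?f x) (at x within ball y d)" for x
        by (rule has_derivative_at_withinI[OF has_derivative_frechet[OF diff]])
      show "onorm (?f x - ?f y) \<le> e" if x: "x \<in> ball y d" for x
      proof (rule onorm_bound)
        fix v
        have "norm ((?f x - ?f y) v) = norm (\<Sum>i\<in>UNIV. v $ i * (partial i k x - partial i k y))"
          using diff by (simp add: frechet_derivative_eq_sum_partial algebra_simps sum_subtractf)
        also have "\<dots> \<le> (\<Sum>i::'n\<in>UNIV. norm v * (e / N))"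
        proof (rule sum_norm_le)
          fix i
          have "norm (partial i k x - partial i k y) \<le> e / N"
            using D(2)[of x y i] d(2)[of i] x by (simp add: dist_norm norm_minus_commute)
          then show "norm (v $ i * (partial i k x - partial i k y)) \<le> norm v * (e / N)"
            unfolding norm_mult using component_le_norm_cart[of v i] by (intro mult_mono) auto
        qed
        also have "\<dots> = e * norm v" using N by (simp add: N_def)
        finally show "norm ((?f x - ?f y) v) \<le> e * norm v" .
      qed (use e in simp)
      show "y \<in> ball y d" using d by simp
    qed
    then show ?thesis
      using diff by (simp add: frechet_derivative_eq_sum_partial mult.commute)
  qed
  with d(1) that show ?thesis by blast
qed

text \<open>Integrating the uniform remainder of \<open>k\<close> against \<open>norm (b z)\<close>
  bounds the remainder of the convolution; dividing \<open>e\<close> by \<open>A\<close>, the L1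
  norm of \<open>b\<close> plus 1, absorbs that integral.\<close>

lemma has_derivative_conv:
  fixes b :: "real^'n \<Rightarrow> 'b::euclidean_space"
  assumes k: "k \<in> test_functions UNIV" and b: "integrable lebesgue b"
  shows "(conv k b has_derivative (\<lambda>h. \<Sum>i\<in>UNIV. (h $ i) *\<^sub>R conv (partial i k) b x)) (at x)"
  unfolding has_derivative_at_alt
proof (intro conjI allI impI)
  show "bounded_linear (\<lambda>h. \<Sum>i\<in>UNIV. (h $ i) *\<^sub>R conv (partial i k) b x)"
    by (intro bounded_linear_sum bounded_linear_scaleR_const[OF bounded_linear_vec_nth])
  fix e :: real assume e: "e > 0"
  define A where "A = (\<integral>z. norm (b z) \<partial>lebesgue) + 1"
  have A: "A > 0" unfolding A_def by (intro add_nonneg_pos) auto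
  have eA: "e / A > 0" using e A by simp
  obtain d where d: "d > 0" "\<And>y h. norm h < d \<Longrightarrow>
      \<bar>k (y + h) - k y - (\<Sum>i\<in>UNIV. h $ i * partial i k y)\<bar> \<le> e / A * norm h"
    by (rule uniform_differentiability[OF k eA]) blast
  have "norm (conv k b y - conv k b x - (\<Sum>i\<in>UNIV. ((y - x) $ i) *\<^sub>R conv (partial i k) b x)) \<le> e * norm (y - x)"
    if y: "norm (y - x) < d" for y
  proof -
    define h where "h = y - x"
    have ik: "integrable lebesgue (\<lambda>z. k (x' - z) *\<^sub>R b z)"
      and ip: "integrable lebesgue (\<lambda>z. partial i k (x' - z) *\<^sub>R b z)" for x' i
      using integrable_conv[OF k b] integrable_conv[OF test_functions_partial[OF k] b] by blast+
    let ?r = "\<lambda>z. k (y - z) *\<^sub>R b z - k (x - z) *\<^sub>R b z - (\<Sum>i\<in>UNIV. (h $ i) *\<^sub>R (partial i k (x - z) *\<^sub>R b z))"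
    have "conv k b y - conv k b x - (\<Sum>i\<in>UNIV. (h $ i) *\<^sub>R conv (partial i k) b x) = (\<integral>z. ?r z \<partial>lebesgue)"
      by (simp add: conv_def ik ip del: scaleR_scaleR)
    also have "norm \<dots> \<le> (\<integral>z. (e / A * norm h) * norm (b z) \<partial>lebesgue)"
    proof (rule Bochner_Integration.integral_norm_bound_integral)
      show "integrable lebesgue ?r"
        by (intro Bochner_Integration.integrable_diff Bochner_Integration.integrable_sum integrable_scaleR_right ik ip)
      show "integrable lebesgue (\<lambda>z. (e / A * norm h) * norm (b z))" using b by auto
      fix z
      have "?r z = (k (x - z + h) - k (x - z) - (\<Sum>i\<in>UNIV. h $ i * partial i k (x - z))) *\<^sub>R b z"
        by (simp add: h_def scaleR_diff_left scaleR_sum_left algebra_simps)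
      then have "norm (?r z) = \<bar>k (x - z + h) - k (x - z) - (\<Sum>i\<in>UNIV. h $ i * partial i k (x - z))\<bar> * norm (b z)"
        by (simp only: norm_scaleR)
      also have "\<dots> \<le> (e / A * norm h) * norm (b z)"
        using d(2)[of h "x - z"] y by (intro mult_right_mono) (auto simp: h_def)
      finally show "norm (?r z) \<le> (e / A * norm h) * norm (b z)" .
    qed
    also have "\<dots> = e * norm h * ((\<integral>z. norm (b z) \<partial>lebesgue) / A)" by simp
    also have "\<dots> \<le> e * norm h * 1"
      using e A by (intro mult_left_mono) (auto simp: A_def)
    finally show ?thesis by (simp add: h_def)
  qed
  then show "\<exists>d>0. \<forall>y. norm (y - x) < d \<longrightarrow>
      norm (conv k b y - conv k b x - (\<Sum>i\<in>UNIV. ((y - x) $ i) *\<^sub>R conv (partial i k) b x)) \<le> e * norm (y - x)"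
    using d(1) by blast
qed

lemma partial_conv:
  fixes b :: "real^'n \<Rightarrow> 'b::euclidean_space"
  assumes "k \<in> test_functions UNIV" "integrable lebesgue b"
  shows "partial i (conv k b) = conv (partial i k) b"
  unfolding has_derivative_partial[OF has_derivative_conv[OF assms]]
  by (auto simp: axis_def if_distrib[where f = "\<lambda>c. c *\<^sub>R _"] cong: if_cong)

lemma conv_differentiable:
  fixes b :: "real^'n \<Rightarrow> 'b::euclidean_space"
  assumes "k \<in> test_functions UNIV" "integrable lebesgue b"
  shows "conv k b differentiable (at x)"
  using has_derivative_conv[OF assms] by (auto simp: differentiable_def)

text \<open>All derivatives fall on the kernel, and partials of test functions are test functions.
  Hence the induction is over all kernels at once, with a merely integrable
  \<open>b\<close>.\<close>

lemma smooth_conv: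
  fixes b :: "real^'n \<Rightarrow> 'b::euclidean_space"
  assumes "k \<in> test_functions UNIV" "integrable lebesgue b"
  shows "smooth (conv k b)"
  unfolding smooth_def
proof
  fix m show "Ck m (conv k b)" using assms
  proof (induction m arbitrary: k)
    case 0
    then show ?case
      by (auto intro!: continuous_at_imp_continuous_on differentiable_imp_continuous_within conv_differentiable)
  next
    case (Suc m)
    then show ?case by (auto simp: partial_conv conv_differentiable test_functions_partial)
  qed
qed

lemma conv_zero:
  assumes "\<And>z. z \<in> K \<Longrightarrow> k (x - z) = 0" "\<And>z. z \<notin> K \<Longrightarrow> b z = 0"
  shows "conv k b x = 0"
proof -
  have "(\<lambda>z. k (x - z) *\<^sub>R b z) = (\<lambda>z. 0)" using assms by fastforce
  then show ?thesis by (simp only: conv_def) simp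
qed

lemma nn_integral_shift:
  fixes f :: "real^'n \<Rightarrow> ennreal"
  assumes [measurable]: "f \<in> borel_measurable borel"
  shows "(\<integral>\<^sup>+z. f (x - z) \<partial>lborel) = (\<integral>\<^sup>+z. f z \<partial>lborel)" "(\<integral>\<^sup>+y. f (y - x) \<partial>lborel) = (\<integral>\<^sup>+z. f z \<partial>lborel)"
proof -
  have *: "(\<integral>\<^sup>+z. f z \<partial>lborel) = (\<integral>\<^sup>+z. f (t + c *\<^sub>R z) \<partial>lborel)" if "\<bar>c\<bar> = 1" for c t
    using that by (subst lborel_affine[of c t]) (auto simp: nn_integral_density nn_integral_distr)
  show "(\<integral>\<^sup>+z. f (x - z) \<partial>lborel) = (\<integral>\<^sup>+z. f z \<partial>lborel)" using *[of "-1" x] by simp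
  show "(\<integral>\<^sup>+y. f (y - x) \<partial>lborel) = (\<integral>\<^sup>+z. f z \<partial>lborel)" using *[of 1 "- x"] by simp
qed

text \<open>Split \<open>\<bar>k\<bar>\<close> into two square roots. Cauchy-Schwarz then bounds the
  square of the convolution at each point by \<open>A\<close> times the convolution of
  \<open>\<bar>k\<bar>\<close> with the square of \<open>b\<close>, and Tonelli gives the second
  factor \<open>A\<close>.\<close>

theorem Young_L2:
  fixes b :: "real^'n \<Rightarrow> 'b::euclidean_space"
  assumes k: "k \<in> test_functions UNIV" and A: "(\<integral>\<^sup>+x. ennreal \<bar>k x\<bar> \<partial>lborel) \<le> ennreal A" "A \<ge> 0"
    and b: "b \<in> L2_on lebesgue" "integrable lebesgue b"
  shows "conv k b \<in> L2_on lebesgue" "ip_on lebesgue (conv k b) (conv k b) \<le> A\<^sup>2 * ip_on lebesgue b b"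
proof -
  note kc = test_functionsD(2)[OF k]
  have km[measurable]: "k \<in> borel_measurable borel" using kc by (rule borel_measurable_continuous_onI)
  have kml[measurable]: "(\<lambda>z. k (x - z)) \<in> borel_measurable lebesgue" for x
    by (intro continuous_borel_lebesgue continuous_reflect kc)
  have bm[measurable]: "b \<in> borel_measurable lebesgue" using b(2) by auto
  have cm: "continuous_on UNIV (conv k b)" by (rule smooth_continuous[OF smooth_conv[OF k b(2)]])
  \<comment> \<open>\<open>b\<close> is only Lebesgue measurable, whereas the iterated integrals are
    exchanged for Borel functions; \<open>B\<close> is a Borel version of the squared norm.\<close>
  obtain B where Bm[measurable]: "B \<in> borel_measurable lborel" and B: "AE z in lborel. ennreal ((norm (b z))\<^sup>2) = B z"
    using completion_ex_borel_measurable[of "\<lambda>z. ennreal ((norm (b z))\<^sup>2)" lborel] by auto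
  have pt: "ennreal ((norm (conv k b x))\<^sup>2) \<le> ennreal A * (\<integral>\<^sup>+z. ennreal \<bar>k (x - z)\<bar> * B z \<partial>lborel)" for x
  proof -
    let ?f = "\<lambda>z. ennreal (sqrt \<bar>k (x - z)\<bar>)" and ?g = "\<lambda>z. ennreal (sqrt \<bar>k (x - z)\<bar> * norm (b z))"
    have "ennreal (norm (conv k b x)) \<le> (\<integral>\<^sup>+z. ennreal (norm (k (x - z) *\<^sub>R b z)) \<partial>lebesgue)"
      unfolding conv_def by (rule integral_norm_bound_ennreal[OF integrable_conv[OF k b(2)]])
    also have "\<dots> = (\<integral>\<^sup>+z. ?f z * ?g z \<partial>lebesgue)"
      by (intro nn_integral_cong) (simp flip: ennreal_mult mult.assoc)
    finally have "ennreal (norm (conv k b x)) ^ 2 \<le> (\<integral>\<^sup>+z. ?f z * ?g z \<partial>lebesgue)\<^sup>2"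
      by (rule power_mono) simp
    also have "\<dots> \<le> (\<integral>\<^sup>+z. (?f z)\<^sup>2 \<partial>lebesgue) * (\<integral>\<^sup>+z. (?g z)\<^sup>2 \<partial>lebesgue)"
      by (rule Cauchy_Schwarz_nn_integral) measurable
    also have "(\<integral>\<^sup>+z. (?f z)\<^sup>2 \<partial>lebesgue) = (\<integral>\<^sup>+z. ennreal \<bar>k (x - z)\<bar> \<partial>lborel)"
      by (simp add: ennreal_power nn_integral_completion)
    also have "\<dots> = (\<integral>\<^sup>+z. ennreal \<bar>k z\<bar> \<partial>lborel)"
      using nn_integral_shift(1)[of "\<lambda>z. ennreal \<bar>k z\<bar>" x] by simp
    also have "(\<integral>\<^sup>+z. (?g z)\<^sup>2 \<partial>lebesgue) = (\<integral>\<^sup>+z. ennreal \<bar>k (x - z)\<bar> * B z \<partial>lborel)"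
      unfolding nn_integral_completion
    proof (rule nn_integral_cong_AE, use B in eventually_elim)
      case (elim z)
      then show ?case by (simp add: ennreal_power power_mult_distrib ennreal_mult)
    qed
    finally have "ennreal (norm (conv k b x)) ^ 2 \<le> (\<integral>\<^sup>+z. ennreal \<bar>k z\<bar> \<partial>lborel) * (\<integral>\<^sup>+z. ennreal \<bar>k (x - z)\<bar> * B z \<partial>lborel)" .
    also have "\<dots> \<le> ennreal A * (\<integral>\<^sup>+z. ennreal \<bar>k (x - z)\<bar> * B z \<partial>lborel)"
      by (intro mult_right_mono A) simp
    finally show ?thesis by (simp add: ennreal_power)
  qed
  have "(\<integral>\<^sup>+x. ennreal ((norm (conv k b x))\<^sup>2) \<partial>lborel) \<le> (\<integral>\<^sup>+x. ennreal A * (\<integral>\<^sup>+z. ennreal \<bar>k (x - z)\<bar> * B z \<partial>lborel) \<partial>lborel)"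
    by (intro nn_integral_mono pt)
  also have "\<dots> = ennreal A * (\<integral>\<^sup>+x. (\<integral>\<^sup>+z. ennreal \<bar>k (x - z)\<bar> * B z \<partial>lborel) \<partial>lborel)"
    by (rule nn_integral_cmult) measurable
  also have "(\<integral>\<^sup>+x. (\<integral>\<^sup>+z. ennreal \<bar>k (x - z)\<bar> * B z \<partial>lborel) \<partial>lborel)
      = (\<integral>\<^sup>+z. (\<integral>\<^sup>+x. ennreal \<bar>k (x - z)\<bar> * B z \<partial>lborel) \<partial>lborel)"
    by (rule lborel_pair.Fubini') measurable
  also have "\<dots> = (\<integral>\<^sup>+z. (\<integral>\<^sup>+x. ennreal \<bar>k x\<bar> \<partial>lborel) * B z \<partial>lborel)"
    using nn_integral_shift(2)[of "\<lambda>z. ennreal \<bar>k z\<bar>"] by (intro nn_integral_cong) (simp add: nn_integral_multc)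
  also have "\<dots> = (\<integral>\<^sup>+x. ennreal \<bar>k x\<bar> \<partial>lborel) * (\<integral>\<^sup>+z. B z \<partial>lborel)"
    by (rule nn_integral_cmult) measurable
  also have "\<dots> \<le> ennreal A * (\<integral>\<^sup>+z. B z \<partial>lborel)"
    by (intro mult_right_mono A) simp
  also have "(\<integral>\<^sup>+z. B z \<partial>lborel) = (\<integral>\<^sup>+z. ennreal ((norm (b z))\<^sup>2) \<partial>lborel)"
    by (rule nn_integral_cong_AE) (use B in \<open>auto\<close>)
  also have "\<dots> = (\<integral>\<^sup>+z. ennreal ((norm (b z))\<^sup>2) \<partial>lebesgue)" by (simp add: nn_integral_completion)
  also have "\<dots> = ennreal (ip_on lebesgue b b)"
    unfolding ip_on_def power2_norm_eq_inner[symmetric]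
    using L2_onD(2)[OF b(1)] by (intro nn_integral_eq_integral) auto
  finally have le: "(\<integral>\<^sup>+x. ennreal ((norm (conv k b x))\<^sup>2) \<partial>lebesgue) \<le> ennreal (A\<^sup>2 * ip_on lebesgue b b)"
    using A(2) by (simp add: mult_left_mono nn_integral_completion power2_eq_square ennreal_mult L2_on.ip_nonneg[OF b(1)] mult.assoc)
  have cml[measurable]: "conv k b \<in> borel_measurable lebesgue" by (rule continuous_borel_lebesgue[OF cm])
  have int: "integrable lebesgue (\<lambda>x. (norm (conv k b x))\<^sup>2)"
    using le_less_trans[OF le] by (intro integrableI_bounded) auto
  then show L2: "conv k b \<in> L2_on lebesgue" by (simp add: L2_on_def cml)
  have "ennreal (ip_on lebesgue (conv k b) (conv k b)) = (\<integral>\<^sup>+x. ennreal ((norm (conv k b x))\<^sup>2) \<partial>lebesgue)"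
    unfolding ip_on_def power2_norm_eq_inner[symmetric]
    using int by (intro nn_integral_eq_integral[symmetric]) auto
  with le have "ennreal (ip_on lebesgue (conv k b) (conv k b)) \<le> ennreal (A\<^sup>2 * ip_on lebesgue b b)" by simp
  then show "ip_on lebesgue (conv k b) (conv k b) \<le> A\<^sup>2 * ip_on lebesgue b b"
    by (subst (asm) ennreal_le_iff) (use L2_on.ip_nonneg[OF b(1)] in simp)
qed

section \<open>Mollifiers on three-dimensional space\<close>

definition prod3 :: "(real \<Rightarrow> real) \<Rightarrow> (real \<Rightarrow> real) \<Rightarrow> (real \<Rightarrow> real) \<Rightarrow> real^3 \<Rightarrow> real" where
  "prod3 f g h x = f (x $ 1) * g (x $ 2) * h (x $ 3)"

definition bumps :: "real \<Rightarrow> real \<Rightarrow> real" where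
  "bumps e t = bump (t / e) / e"

text \<open>This is the primitive of \<open>bumps e - bumps d\<close>. Both bumps have mass one, so
  it vanishes outside the larger of the two intervals.\<close>

definition step_diff :: "real \<Rightarrow> real \<Rightarrow> real \<Rightarrow> real" where
  "step_diff e d t = step (t / e) - step (t / d)"

definition mollifier :: "real \<Rightarrow> real^3 \<Rightarrow> real" where
  "mollifier e = prod3 (bumps e) (bumps e) (bumps e)"

text \<open>In kernel \<open>j\<close> the factors before \<open>j\<close> have already been changed
  to scale \<open>d\<close>, those after \<open>j\<close> still have scale \<open>e\<close>, and
  factor \<open>j\<close> is the primitive of the change. The derivative in direction
  \<open>j\<close> is thus the \<open>j\<close>-th term of the telescoping sum.\<close>

definition telescope_kernel :: "real \<Rightarrow> real \<Rightarrow> 3 \<Rightarrow> real^3 \<Rightarrow> real" where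
  "telescope_kernel e d j =
    (if j = 1 then prod3 (step_diff e d) (bumps e) (bumps e)
     else if j = 2 then prod3 (bumps d) (step_diff e d) (bumps e)
     else prod3 (bumps d) (bumps d) (step_diff e d))"

lemma norm_le_sum3: "norm x \<le> \<bar>x $ 1\<bar> + \<bar>x $ 2\<bar> + \<bar>x $ 3\<bar>" for x :: "real^3"
  using norm_le_l1_cart[of x] by (simp add: sum_3)

text \<open>The norm is at most the sum of the three absolute coordinates. This is the origin of the
  radius \<open>3 * e\<close> used for all kernels.\<close>

lemma prod3_zero:
  assumes "\<And>t. \<bar>t\<bar> > e \<Longrightarrow> f t = 0" "\<And>t. \<bar>t\<bar> > e \<Longrightarrow> g t = 0" "\<And>t. \<bar>t\<bar> > e \<Longrightarrow> h t = 0" "norm x > 3 * e"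
  shows "prod3 f g h x = 0"
proof -
  have "\<bar>x $ 1\<bar> > e \<or> \<bar>x $ 2\<bar> > e \<or> \<bar>x $ 3\<bar> > e"
    using norm_le_sum3[of x] assms(4) by linarith
  then show ?thesis using assms(1-3) by (auto simp: prod3_def)
qed

lemma prod3_test_function:
  assumes "\<And>k. Ck k (\<lambda>x :: real^3. f (x $ 1))" "\<And>k. Ck k (\<lambda>x :: real^3. g (x $ 2))" "\<And>k. Ck k (\<lambda>x :: real^3. h (x $ 3))"
    and "\<And>x. norm x > r \<Longrightarrow> prod3 f g h x = 0"
  shows "prod3 f g h \<in> test_functions UNIV"
proof -
  have "smooth (prod3 f g h)"
    unfolding smooth_def prod3_def[abs_def] by (intro allI Ck_mult assms)
  moreover have "compact (supp (prod3 f g h))"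
    by (rule compact_supp_subset[of "cball 0 r"]) (use assms(4) in auto)
  ultimately show ?thesis by (simp add: test_functions_def)
qed

lemma nn_integral_prod3:
  assumes [measurable]: "f \<in> borel_measurable borel" "g \<in> borel_measurable borel" "h \<in> borel_measurable borel"
    and nn: "\<And>t. f t \<ge> 0" "\<And>t. g t \<ge> 0" "\<And>t. h t \<ge> 0"
  shows "(\<integral>\<^sup>+x. ennreal (prod3 f g h x) \<partial>lborel) =
    (\<integral>\<^sup>+t. ennreal (f t) \<partial>lborel) * (\<integral>\<^sup>+t. ennreal (g t) \<partial>lborel) * (\<integral>\<^sup>+t. ennreal (h t) \<partial>lborel)"
proof -
  \<comment> \<open>The product formula for \<open>lborel\<close> indexes its factors by the basis
    vectors, so the coordinate functions are encoded over them.\<close>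
  define F :: "real^3 \<Rightarrow> real \<Rightarrow> ennreal" where
    "F b t = ennreal (if b = axis 1 1 then f t else if b = axis 2 1 then g t else h t)" for b t
  have B: "(Basis :: (real^3) set) = (\<lambda>i. axis i 1) ` UNIV" by (auto simp: Basis_vec_def)
  have inj: "inj (\<lambda>i :: 3. axis i (1 :: real))" by (auto simp: inj_def axis_eq_axis)
  have prod: "(\<Prod>b\<in>Basis. G b) = G (axis 1 1) * G (axis 2 1) * G (axis 3 1)" for G :: "real^3 \<Rightarrow> ennreal"
  proof -
    have "(\<Prod>b\<in>Basis. G b) = (\<Prod>i\<in>(UNIV :: 3 set). G (axis i 1))"
      unfolding B by (subst prod.reindex[OF inj]) (simp add: o_def)
    then show ?thesis unfolding UNIV_3 by (simp add: mult.assoc)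
  qed
  have "ennreal (prod3 f g h x) = (\<Prod>b\<in>Basis. F b (x \<bullet> b))" for x
    using nn unfolding prod by (simp add: F_def prod3_def axis_eq_axis inner_axis ennreal_mult)
  then have "(\<integral>\<^sup>+x. ennreal (prod3 f g h x) \<partial>lborel) = (\<integral>\<^sup>+x. (\<Prod>b\<in>Basis. F b (x \<bullet> b)) \<partial>lborel)"
    by simp
  also have "\<dots> = (\<Prod>b\<in>Basis. \<integral>\<^sup>+t. F b t \<partial>lborel)"
    by (rule nn_integral_lborel_prod) (auto simp: F_def)
  finally show ?thesis unfolding prod by (simp add: F_def[abs_def] axis_eq_axis)
qed

lemma bumps_nonneg: "e > 0 \<Longrightarrow> bumps e t \<ge> 0"
  by (simp add: bumps_def bump_nonneg)

lemma bumps_zero: "e > 0 \<Longrightarrow> \<bar>t\<bar> > e \<Longrightarrow> bumps e t = 0"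
  by (simp add: bumps_def bump_zero abs_divide)

lemma step_diff_zero:
  assumes "0 < d" "d \<le> e" "\<bar>t\<bar> > e"
  shows "step_diff e d t = 0"
proof (cases "t \<ge> 0")
  case True
  then have "t / e \<ge> 1" "t / d \<ge> 1" using assms by (auto simp: field_simps)
  then show ?thesis by (simp add: step_diff_def step_mass)
next
  case False
  then have "t / e \<le> -1" "t / d \<le> -1" using assms by (auto simp: field_simps)
  then show ?thesis by (simp add: step_diff_def step_mass)
qed

lemma abs_step_diff_le: "\<bar>step_diff e d t\<bar> \<le> 1"
  using step_bounds[of "t / e"] step_bounds[of "t / d"] by (simp add: step_diff_def)

lemma borel_measurable_bumps: "bumps e \<in> borel_measurable borel"
proof -
  have [measurable]: "bump \<in> borel_measurable borel"
    by (intro borel_measurable_continuous_onI continuous_at_imp_continuous_on) (simp add: isCont_bump)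
  show ?thesis unfolding bumps_def[abs_def] by measurable
qed

lemma borel_measurable_step_diff: "step_diff e d \<in> borel_measurable borel"
proof -
  have "isCont step t" for t using step_mass(2) by (rule DERIV_isCont)
  then have [measurable]: "step \<in> borel_measurable borel"
    by (intro borel_measurable_continuous_onI continuous_at_imp_continuous_on) simp
  show ?thesis unfolding step_diff_def[abs_def] by measurable
qed

lemma Ck_bumps: "Ck k (\<lambda>x :: real^'n. bumps e (x $ j))"
  using Ck_mult[OF Ck_bump[of k "1 / e" j] Ck_const[of k "1 / e"]] by (simp add: bumps_def)

lemma Ck_step_diff: "Ck k (\<lambda>x :: real^'n. step_diff e d (x $ j))"
  using Ck_add[OF Ck_step[of k "1 / e" j] Ck_mult[OF Ck_const[of k "-1"] Ck_step[of k "1 / d" j]]]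
  by (simp add: step_diff_def)

lemma mollifier_zero: "e > 0 \<Longrightarrow> norm x > 3 * e \<Longrightarrow> mollifier e x = 0"
  unfolding mollifier_def by (rule prod3_zero[of e]) (auto simp: bumps_zero)

lemma mollifier_test_function: "e > 0 \<Longrightarrow> mollifier e \<in> test_functions UNIV"
  unfolding mollifier_def
  by (rule prod3_test_function[of _ _ _ "3 * e"]) (auto simp: Ck_bumps mollifier_zero simp flip: mollifier_def)

lemma mollifier_nonneg: "e > 0 \<Longrightarrow> mollifier e x \<ge> 0"
  by (simp add: mollifier_def prod3_def bumps_nonneg)

lemma nn_integral_mollifier: "e > 0 \<Longrightarrow> (\<integral>\<^sup>+x. ennreal (mollifier e x) \<partial>lborel) = 1"
  unfolding mollifier_def
  by (subst nn_integral_prod3) (auto simp: borel_measurable_bumps bumps_nonneg, simp add: bumps_def nn_integral_bump)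

lemma telescope_kernel_zero:
  assumes "0 < d" "d \<le> e" "norm x > 3 * e"
  shows "telescope_kernel e d j x = 0"
proof -
  have "bumps d t = 0" "bumps e t = 0" "step_diff e d t = 0" if "\<bar>t\<bar> > e" for t
    using assms that by (auto intro: bumps_zero step_diff_zero)
  then show ?thesis
    unfolding telescope_kernel_def using assms(3) by (auto intro: prod3_zero[of e])
qed

lemma telescope_kernel_test_function:
  assumes "0 < d" "d \<le> e"
  shows "telescope_kernel e d j \<in> test_functions UNIV"
  using telescope_kernel_zero[OF assms, where j = j] unfolding telescope_kernel_def
  by (auto intro!: prod3_test_function[of _ _ _ "3 * e"] Ck_bumps Ck_step_diff split: if_splits)

text \<open>The bump factors integrate to 1, and \<open>step_diff\<close> is at most 1 in absolute
  value on \<open>{-e..e}\<close>. The length of this interval is the whole bound, so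
  \<open>d\<close> does not enter.\<close>

lemma nn_integral_telescope_kernel:
  assumes "0 < d" "d \<le> e"
  shows "(\<integral>\<^sup>+x. ennreal \<bar>telescope_kernel e d j x\<bar> \<partial>lborel) \<le> ennreal (2 * e)"
proof -
  have [measurable]: "bumps r \<in> borel_measurable borel" "step_diff e d \<in> borel_measurable borel" for r
    by (rule borel_measurable_bumps borel_measurable_step_diff)+
  have one: "(\<integral>\<^sup>+t. ennreal (bumps r t) \<partial>lborel) = 1" if "r > 0" for r
    using nn_integral_bump[OF that] by (simp add: bumps_def)
  have "(\<integral>\<^sup>+t. ennreal \<bar>step_diff e d t\<bar> \<partial>lborel) \<le> (\<integral>\<^sup>+t. indicator {-e..e} t \<partial>lborel)"
  proof (rule nn_integral_mono)
    fix t
    show "ennreal \<bar>step_diff e d t\<bar> \<le> indicator {-e..e} t"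
      using abs_step_diff_le[of e d t] step_diff_zero[OF assms, of t] by (cases "\<bar>t\<bar> > e") (auto simp: indicator_def)
  qed
  also have "\<dots> = ennreal (2 * e)" using assms by simp
  finally have "(\<integral>\<^sup>+t. ennreal \<bar>step_diff e d t\<bar> \<partial>lborel) \<le> ennreal (2 * e)" .
  moreover have "\<bar>telescope_kernel e d j x\<bar> =
    (if j = 1 then prod3 (\<lambda>t. \<bar>step_diff e d t\<bar>) (bumps e) (bumps e) x
     else if j = 2 then prod3 (bumps d) (\<lambda>t. \<bar>step_diff e d t\<bar>) (bumps e) x
     else prod3 (bumps d) (bumps d) (\<lambda>t. \<bar>step_diff e d t\<bar>) x)" for x
    using assms by (simp add: telescope_kernel_def prod3_def abs_mult bumps_nonneg)
  moreover have "0 < e" using assms by simp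
  ultimately show ?thesis
    using assms(1) exhaust_3[of j] by (auto simp: nn_integral_prod3 bumps_nonneg one)
qed

lemma partial_prod3:
  assumes "\<And>t. DERIV f t :> f' t" "\<And>t. DERIV g t :> g' t" "\<And>t. DERIV h t :> h' t"
  shows "partial i (prod3 f g h) =
    (if i = 1 then prod3 f' g h else if i = 2 then prod3 f g' h else prod3 f g h')"
proof -
  have c: "((\<lambda>x :: real^3. F (x $ j)) has_derivative (\<lambda>v. v $ j * F' (x $ j))) (at x)"
    if "\<And>t. DERIV F t :> F' t" for F F' :: "real \<Rightarrow> real" and j x
    by (rule DERIV_compose_FDERIV[where g = "\<lambda>x. x $ j" and f = F, OF that])
      (intro bounded_linear_imp_has_derivative bounded_linear_vec_nth)
  have "(prod3 f g h has_derivative (\<lambda>v. f (x $ 1) * g (x $ 2) * (v $ 3 * h' (x $ 3)) +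
      (f (x $ 1) * (v $ 2 * g' (x $ 2)) + v $ 1 * f' (x $ 1) * g (x $ 2)) * h (x $ 3))) (at x)" for x
    unfolding prod3_def[abs_def] by (intro has_derivative_mult c assms)
  from has_derivative_partial[OF this] show ?thesis
    using exhaust_3[of i] by (auto simp: prod3_def fun_eq_iff axis_def)
qed

lemma sum_partial_telescope_kernel:
  assumes "0 < d" "0 < e"
  shows "(\<Sum>j\<in>UNIV. partial j (telescope_kernel e d j) x) = mollifier e x - mollifier d x"
proof -
  obtain b' where b': "\<And>t. DERIV bump t :> b' t"
  proof
    show "DERIV bump t :> snd step_mass * (exp_recip 1 (1 + t) * - exp_recip (exp_recip_poly 1) (1 - t)
        + exp_recip (exp_recip_poly 1) (1 + t) * exp_recip 1 (1 - t))" for t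
      unfolding bump_def[abs_def] raw_bump_def[abs_def]
      by (auto intro!: derivative_eq_intros DERIV_exp_recip[THEN DERIV_chain2])
  qed
  have scale: "DERIV (\<lambda>t. t / r) t :> 1 / r" if "r > 0" for r t :: real
    using that by (auto intro!: derivative_eq_intros)
  have bumps: "DERIV (bumps r) t :> b' (t / r) / r / r" if "r > 0" for r t
    unfolding bumps_def[abs_def]
    using DERIV_cdivide[OF DERIV_chain2[where f = bump, OF b' scale[OF that]], of r] by simp
  have step_diff: "DERIV (step_diff e d) t :> bumps e t - bumps d t" for t
    unfolding step_diff_def[abs_def] bumps_def
    using DERIV_diff[OF DERIV_chain2[where f = step, OF step_mass(2) scale[OF assms(2)]]
        DERIV_chain2[where f = step, OF step_mass(2) scale[OF assms(1)]]] by simp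
  note p1 = partial_prod3[OF step_diff bumps[OF assms(2)] bumps[OF assms(2)]]
    and p2 = partial_prod3[OF bumps[OF assms(1)] step_diff bumps[OF assms(2)]]
    and p3 = partial_prod3[OF bumps[OF assms(1)] bumps[OF assms(1)] step_diff]
  show ?thesis
    by (simp add: sum_3 telescope_kernel_def p1 p2 p3 mollifier_def) (simp add: prod3_def algebra_simps)
qed

section \<open>Mollification as approximation in L2\<close>

lemma integrable_indicator_cball: "integrable lebesgue (indicator (cball x R) :: 'a::euclidean_space \<Rightarrow> real)"
  using lmeasurable_cball[of x R] by (simp add: fmeasurable_def)

text \<open>From 2 a \<le> 1 + a^2. It makes square integrable functions of bounded support
  integrable, with an explicit bound for the L1 norm.\<close>

lemma norm_le_indicator_plus_square:
  fixes b :: "'a::real_normed_vector \<Rightarrow> 'b::real_normed_vector"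
  assumes "\<And>z. norm z > R \<Longrightarrow> b z = 0"
  shows "norm (b z) \<le> indicator (cball 0 R) z + (norm (b z))\<^sup>2"
proof (cases "norm z > R")
  case True
  then show ?thesis using assms by simp
next
  case False
  have "2 * norm (b z) \<le> 1 + (norm (b z))\<^sup>2" "0 \<le> norm (b z)"
    using sum_squares_bound[of 1 "norm (b z)"] by simp_all
  then have "norm (b z) \<le> 1 + (norm (b z))\<^sup>2" by linarith
  then show ?thesis using False by (simp add: indicator_def)
qed

lemma L2_on_lebesgue_integrable:
  assumes b: "b \<in> L2_on lebesgue" and R: "\<And>z. norm z > R \<Longrightarrow> b z = 0"
  shows "integrable lebesgue (b :: 'a::euclidean_space \<Rightarrow> 'b::euclidean_space)"
proof (rule Bochner_Integration.integrable_bound)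
  show "integrable lebesgue (\<lambda>z. indicator (cball 0 R) z + (norm (b z))\<^sup>2)"
    using integrable_indicator_cball L2_onD(2)[OF b] by (rule Bochner_Integration.integrable_add)
  show "AE z in lebesgue. norm (b z) \<le> norm (indicator (cball 0 R) z + (norm (b z))\<^sup>2)"
    by (intro AE_I2 order_trans[OF norm_le_indicator_plus_square[of R b, OF R]]) auto
qed (use L2_onD[OF b] in simp)

lemma bounded_L2_on_lebesgue:
  fixes f :: "'a::euclidean_space \<Rightarrow> 'b::euclidean_space"
  assumes f: "f \<in> borel_measurable lebesgue" and R: "\<And>z. norm z > R \<Longrightarrow> f z = 0" and M: "\<And>z. norm (f z) \<le> M"
  shows "f \<in> L2_on lebesgue"
    and "(\<integral>z. (norm (f z))\<^sup>2 \<partial>lebesgue) \<le> M\<^sup>2 * measure lebesgue (cball (0 :: 'a) R)"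
proof -
  have i: "integrable lebesgue (\<lambda>z :: 'a. M\<^sup>2 * indicator (cball 0 R) z :: real)"
    by (intro integrable_mult_right integrable_indicator_cball)
  have le: "(norm (f z))\<^sup>2 \<le> M\<^sup>2 * indicator (cball 0 R) z" for z
    using R[of z] power_mono[OF M[of z], of 2] by (cases "norm z > R") (auto simp: indicator_def)
  have int: "integrable lebesgue (\<lambda>z. (norm (f z))\<^sup>2)"
    using le f by (intro Bochner_Integration.integrable_bound[OF i]) auto
  then show "f \<in> L2_on lebesgue" using f by (simp add: L2_on_def)
  have "(\<integral>z. (norm (f z))\<^sup>2 \<partial>lebesgue) \<le> (\<integral>z. (M\<^sup>2 * indicator (cball 0 R) (z :: 'a)) \<partial>lebesgue)"
    by (rule Bochner_Integration.integral_mono[OF int i le])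
  then show "(\<integral>z. (norm (f z))\<^sup>2 \<partial>lebesgue) \<le> M\<^sup>2 * measure lebesgue (cball (0 :: 'a) R)" by simp
qed

text \<open>Mass one turns the difference into an average of \<open>g z - g x\<close>, taken over
  points \<open>z\<close> within \<open>3 * e\<close> of \<open>x\<close>.\<close>

lemma conv_mollifier_close:
  fixes g :: "real^3 \<Rightarrow> 'b::euclidean_space"
  assumes e: "e > 0" and g: "integrable lebesgue g"
    and close: "\<And>y. norm (y - x) \<le> 3 * e \<Longrightarrow> norm (g y - g x) \<le> \<eta>"
  shows "norm (conv (mollifier e) g x - g x) \<le> \<eta>"
proof -
  note k = mollifier_test_function[OF e]
  have km[measurable]: "mollifier e \<in> borel_measurable borel"
    using test_functionsD(2)[OF k] by (rule borel_measurable_continuous_onI)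
  have "(\<integral>\<^sup>+z. ennreal (mollifier e (x - z)) \<partial>lborel) = 1"
    using nn_integral_shift(1)[of "\<lambda>z. ennreal (mollifier e z)" x] nn_integral_mollifier[OF e] by simp
  then have nn: "(\<integral>\<^sup>+z. ennreal (mollifier e (x - z)) \<partial>lebesgue) = ennreal 1"
    by (simp add: nn_integral_completion)
  have m: "(\<lambda>z. mollifier e (x - z)) \<in> borel_measurable lebesgue"
    by (intro continuous_borel_lebesgue continuous_reflect test_functionsD(2)[OF k])
  have int: "integrable lebesgue (\<lambda>z. mollifier e (x - z))"
    by (rule integrableI_nn_integral_finite[OF m _ nn]) (use mollifier_nonneg[OF e] in auto)
  have one: "(\<integral>z. mollifier e (x - z) \<partial>lebesgue) = 1"
    by (rule integral_eq_nn_integral[OF m, THEN trans]) (use nn mollifier_nonneg[OF e] in auto)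
  have ig: "integrable lebesgue (\<lambda>z. mollifier e (x - z) *\<^sub>R g z)" by (rule integrable_conv[OF k g])
  have ic: "integrable lebesgue (\<lambda>z. mollifier e (x - z) *\<^sub>R g x)" using int by simp
  have "conv (mollifier e) g x - g x = (\<integral>z. mollifier e (x - z) *\<^sub>R g z - mollifier e (x - z) *\<^sub>R g x \<partial>lebesgue)"
    using one int by (simp add: conv_def Bochner_Integration.integral_diff[OF ig ic])
  also have "norm \<dots> \<le> (\<integral>z. mollifier e (x - z) * \<eta> \<partial>lebesgue)"
  proof (rule Bochner_Integration.integral_norm_bound_integral)
    show "integrable lebesgue (\<lambda>z. mollifier e (x - z) *\<^sub>R g z - mollifier e (x - z) *\<^sub>R g x)"
      using ig ic by (rule Bochner_Integration.integrable_diff)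
    show "integrable lebesgue (\<lambda>z. mollifier e (x - z) * \<eta>)" using int by simp
    fix z
    have "norm (mollifier e (x - z) *\<^sub>R g z - mollifier e (x - z) *\<^sub>R g x) = mollifier e (x - z) * norm (g z - g x)"
      using mollifier_nonneg[OF e] by (simp flip: scaleR_diff_right)
    also have "\<dots> \<le> mollifier e (x - z) * \<eta>"
    proof (cases "norm (z - x) \<le> 3 * e")
      case True
      then show ?thesis using close mollifier_nonneg[OF e] by (intro mult_left_mono) auto
    next
      case False
      then show ?thesis using mollifier_zero[OF e, of "x - z"] by (simp add: norm_minus_commute)
    qed
    finally show "norm (mollifier e (x - z) *\<^sub>R g z - mollifier e (x - z) *\<^sub>R g x) \<le> mollifier e (x - z) * \<eta>" .
  qed
  also have "\<dots> = \<eta>" using one by simp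
  finally show ?thesis .
qed

lemma mollifier_uniform:
  fixes g :: "real^3 \<Rightarrow> 'b::euclidean_space"
  assumes g: "continuous_on UNIV g" "\<And>z. norm z > R \<Longrightarrow> g z = 0" and \<eta>: "\<eta> > 0"
  obtains \<delta> where "\<delta> > 0" "\<And>e x. 0 < e \<Longrightarrow> e < \<delta> \<Longrightarrow> norm (conv (mollifier e) g x - g x) \<le> \<eta>"
proof -
  have zero: "g z = 0" if "z \<notin> cball 0 R" for z using g(2) that by simp
  obtain M where M: "\<And>z. norm (g z) \<le> M"
    using bounded_compact_supp[OF g(1) compact_cball zero] by blast
  have int: "integrable lebesgue g"
    using L2_on_lebesgue_integrable[OF bounded_L2_on_lebesgue(1)[OF continuous_borel_lebesgue[OF g(1)] g(2) M] g(2)] .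
  obtain d where d: "d > 0" "\<And>x y. norm (x - y) < d \<Longrightarrow> norm (g x - g y) \<le> \<eta>"
    using uniformly_continuous_compact_supp[OF g(1) compact_cball zero \<eta>] by blast
  show ?thesis
  proof (rule that[of "d / 3"])
    show "norm (conv (mollifier e) g x - g x) \<le> \<eta>" if "0 < e" "e < d / 3" for e x
      by (rule conv_mollifier_close[OF that(1) int]) (use d(2) that in auto)
  qed (use d in simp)
qed

lemma conv_diff:
  assumes "k \<in> test_functions UNIV" "integrable lebesgue b" "integrable lebesgue c"
  shows "conv k (\<lambda>z. b z - c z) x = conv k b x - conv k c x"
  using integrable_conv[OF assms(1,2), of x] integrable_conv[OF assms(1,3), of x]
  by (simp add: conv_def scaleR_diff_right)

lemma conv_zero_far:
  assumes k: "\<And>x. norm x > r \<Longrightarrow> k x = 0" and b: "\<And>z. z \<notin> K \<Longrightarrow> b z = 0" and x: "\<And>z. z \<in> K \<Longrightarrow> norm (x - z) > r"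
  shows "conv k b x = 0"
  by (rule conv_zero[of K]) (use assms in auto)

lemma conv_test_function:
  fixes b :: "real^'n \<Rightarrow> 'b::euclidean_space"
  assumes k: "k \<in> test_functions UNIV" "\<And>x. norm x > r \<Longrightarrow> k x = 0"
    and b: "integrable lebesgue b" "\<And>z. z \<notin> K \<Longrightarrow> b z = 0"
    and K: "compact K" "(\<Union>z\<in>K. cball z r) \<subseteq> \<Omega>"
  shows "conv k b \<in> test_functions \<Omega>"
proof -
  define C where "C = {z + y | z y. z \<in> K \<and> y \<in> cball 0 r}"
  have C: "compact C" unfolding C_def using K by (intro compact_sums) auto
  have zero: "conv k b x = 0" if x: "x \<notin> C" for x
  proof (rule conv_zero_far[OF k(2) b(2)])
    fix z assume z: "z \<in> K"
    show "norm (x - z) > r"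
    proof (rule ccontr)
      assume "\<not> norm (x - z) > r"
      then have "x - z \<in> cball 0 r" by simp
      moreover have "x = z + (x - z)" by simp
      ultimately have "x \<in> C" using z unfolding C_def by blast
      with x show False by simp
    qed
  qed
  have "C \<subseteq> \<Omega>"
  proof
    fix x assume "x \<in> C"
    then obtain z y where "z \<in> K" "norm y \<le> r" "x = z + y" by (auto simp: C_def)
    then have "x \<in> cball z r" by (simp add: dist_norm)
    then show "x \<in> \<Omega>" using K(2) \<open>z \<in> K\<close> by blast
  qed
  then show ?thesis
    using supp_subset[of C "conv k b", OF compact_imp_closed[OF C] zero] compact_supp_subset[OF C zero] smooth_conv[OF k(1) b(1)]
    by (auto simp: test_functions_def)
qed

definition cut_ball :: "real \<Rightarrow> 'a::real_normed_vector \<Rightarrow> real" where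
  "cut_ball R x = min 1 (max 0 (R + 1 - norm x))"

text \<open>A measurable function is almost everywhere a limit of continuous functions. Projecting
  their values onto the ball of radius \<open>M\<close> and multiplying by \<open>cut_ball\<close>
  leaves the limit unchanged and supplies a dominating function.\<close>

lemma continuous_approx_bounded:
  fixes b :: "'a::euclidean_space \<Rightarrow> 'b::euclidean_space"
  assumes b: "b \<in> borel_measurable lebesgue" "\<And>z. norm z > R \<Longrightarrow> b z = 0" "\<And>z. norm (b z) \<le> M" and e: "e > 0"
  obtains g where "continuous_on UNIV g" "\<And>z. norm z > R + 1 \<Longrightarrow> g z = 0" "\<And>z. norm (g z) \<le> M"
    "(\<integral>z. (norm (b z - g z))\<^sup>2 \<partial>lebesgue) < e"
proof -
  have M0: "M \<ge> 0" using b(3)[of 0] norm_ge_zero order_trans by blast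
  obtain N h where N: "negligible N" and h: "\<And>n. continuous_on UNIV (h n)"
    and lim: "\<And>x. x \<notin> N \<Longrightarrow> (\<lambda>n. h n x) \<longlonglongrightarrow> b x"
    using lebesgue_measurable_imp_measurable_on[OF b(1), of UNIV] by (auto simp: measurable_on_def)
  let ?p = "closest_point (cball (0 :: 'b) M)"
  have cp: "continuous_on UNIV ?p"
    using M0 by (intro continuous_on_closest_point) auto
  define g where "g n x = cut_ball R x *\<^sub>R ?p (h n x)" for n x
  have gc: "continuous_on UNIV (g n)" for n
    unfolding g_def cut_ball_def
    by (intro continuous_intros continuous_on_compose2[OF cp h]) auto
  have g0: "g n z = 0" if "norm z > R + 1" for n z using that by (simp add: g_def cut_ball_def)
  have p_le: "norm (?p y) \<le> M" for y
    using closest_point_in_set[of "cball (0 :: 'b) M" y] M0 by auto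
  have cut: "0 \<le> cut_ball R z" "cut_ball R z \<le> 1" for z :: 'a by (auto simp: cut_ball_def)
  have gM: "norm (g n z) \<le> M" for n z
    using mult_mono[OF cut(2)[of z] p_le[of "h n z"]] cut(1)[of z] by (simp add: g_def)
  have glim: "(\<lambda>n. g n x) \<longlonglongrightarrow> b x" if "x \<notin> N" for x
  proof -
    have "isCont ?p (b x)" using cp by (simp add: continuous_on_eq_continuous_at)
    then have "(\<lambda>n. g n x) \<longlonglongrightarrow> cut_ball R x *\<^sub>R ?p (b x)"
      unfolding g_def by (intro tendsto_scaleR tendsto_const isCont_tendsto_compose[OF _ lim[OF that]])
    moreover have "?p (b x) = b x" using b(3)[of x] by (intro closest_point_self) simp
    moreover have "cut_ball R x *\<^sub>R b x = b x"
      using b(2)[of x] by (cases "norm x > R") (auto simp: cut_ball_def)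
    ultimately show ?thesis by simp
  qed
  have AEN: "AE x in lebesgue. x \<notin> N"
    using N by (intro AE_not_in) (simp add: negligible_iff_null_sets)
  have gm: "g n \<in> borel_measurable lebesgue" for n by (rule continuous_borel_lebesgue[OF gc])
  have "(\<lambda>n. \<integral>z. (norm (b z - g n z))\<^sup>2 \<partial>lebesgue) \<longlonglongrightarrow> (\<integral>z. 0 \<partial>(lebesgue :: 'a measure))"
  proof (rule integral_dominated_convergence)
    show "integrable lebesgue (\<lambda>z :: 'a. (2 * M)\<^sup>2 * indicator (cball 0 (R + 1)) z :: real)"
      by (intro integrable_mult_right integrable_indicator_cball)
    show "AE x in lebesgue. (\<lambda>n. (norm (b x - g n x))\<^sup>2) \<longlonglongrightarrow> 0"
      using AEN
    proof eventually_elim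
      case (elim x)
      have "(\<lambda>n. (norm (b x - g n x))\<^sup>2) \<longlonglongrightarrow> (norm (b x - b x))\<^sup>2"
        by (intro tendsto_intros glim elim)
      then show ?case by simp
    qed
    have "(norm (b x - g n x))\<^sup>2 \<le> (2 * M)\<^sup>2 * indicator (cball 0 (R + 1)) x" for n x
    proof (cases "norm x > R + 1")
      case True
      then show ?thesis using g0 b(2)[of x] by simp
    next
      case False
      have "norm (b x - g n x) \<le> 2 * M"
        using norm_triangle_ineq4[of "b x" "g n x"] b(3)[of x] gM[of n x] by linarith
      then show ?thesis using False power_mono[of "norm (b x - g n x)" "2 * M" 2] by (simp add: indicator_def)
    qed
    then show "AE x in lebesgue. norm ((norm (b x - g n x))\<^sup>2) \<le> (2 * M)\<^sup>2 * indicator (cball 0 (R + 1)) x" for n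
      by simp
  qed (use b(1) gm in measurable)
  then have "(\<lambda>n. \<integral>z. (norm (b z - g n z))\<^sup>2 \<partial>lebesgue) \<longlonglongrightarrow> 0" by simp
  from order_tendstoD(2)[OF this e] obtain n where "(\<integral>z. (norm (b z - g n z))\<^sup>2 \<partial>lebesgue) < e"
    using eventually_happens'[OF sequentially_bot] by blast
  with gc g0 gM that show ?thesis by blast
qed

text \<open>Projecting the values onto balls of growing radius \<open>m\<close> changes nothing at a
  point once \<open>m\<close> exceeds the norm there, and the error never exceeds
  \<open>norm (b z)\<close>, so dominated convergence applies.\<close>

lemma bounded_approx_L2:
  fixes b :: "'a \<Rightarrow> 'b::euclidean_space"
  assumes b: "b \<in> L2_on M" and e: "e > 0"
  obtains m :: nat where "(\<integral>z. (norm (b z - closest_point (cball 0 (real m)) (b z)))\<^sup>2 \<partial>M) < e"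
proof -
  let ?p = "\<lambda>m. closest_point (cball (0 :: 'b) (real m))"
  note bm[measurable] = L2_onD(1)[OF b]
  have pm: "?p m \<in> borel_measurable borel" for m
    by (intro borel_measurable_continuous_onI continuous_on_closest_point) auto
  have "(\<lambda>m. \<integral>z. (norm (b z - ?p m (b z)))\<^sup>2 \<partial>M) \<longlonglongrightarrow> (\<integral>z. 0 \<partial>M)"
  proof (rule integral_dominated_convergence)
    show "integrable M (\<lambda>z. (norm (b z))\<^sup>2)" by (rule L2_onD(2)[OF b])
    show "AE z in M. (\<lambda>m. (norm (b z - ?p m (b z)))\<^sup>2) \<longlonglongrightarrow> 0"
    proof (rule AE_I2)
      fix z
      obtain k where k: "norm (b z) \<le> real k" using real_arch_simple by blast
      have "\<forall>\<^sub>F m in sequentially. (norm (b z - ?p m (b z)))\<^sup>2 = 0"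
        using eventually_ge_at_top[of k]
      proof eventually_elim
        case (elim m)
        then have "?p m (b z) = b z" using k by (intro closest_point_self) simp
        then show ?case by simp
      qed
      then show "(\<lambda>m. (norm (b z - ?p m (b z)))\<^sup>2) \<longlonglongrightarrow> 0" by (rule tendsto_eventually)
    qed
    have "norm (b z - ?p m (b z)) \<le> norm (b z)" for m z
      using closest_point_le[of "cball (0 :: 'b) (real m)" 0 "b z"] by (simp add: dist_norm)
    then show "AE z in M. norm ((norm (b z - ?p m (b z)))\<^sup>2) \<le> (norm (b z))\<^sup>2" for m
      by (simp add: power_mono)
    show "(\<lambda>z. (norm (b z - ?p m (b z)))\<^sup>2) \<in> borel_measurable M" for m
      using measurable_compose[OF bm pm[of m]] by measurable
  qed simp
  then have "(\<lambda>m. \<integral>z. (norm (b z - ?p m (b z)))\<^sup>2 \<partial>M) \<longlonglongrightarrow> 0" by simp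
  from order_tendstoD(2)[OF this e] show ?thesis
    using eventually_happens'[OF sequentially_bot] that by blast
qed

lemma continuous_approx_L2:
  fixes b :: "'a::euclidean_space \<Rightarrow> 'b::euclidean_space"
  assumes b: "b \<in> L2_on lebesgue" "\<And>z. norm z > R \<Longrightarrow> b z = 0" and e: "e > 0"
  obtains g where "continuous_on UNIV g" "\<And>z. norm z > R + 1 \<Longrightarrow> g z = 0" "g \<in> L2_on lebesgue"
    "sqrt (L2_on.dsq lebesgue b g) < e"
proof -
  have e4: "(e / 2)\<^sup>2 > 0" using e by simp
  obtain m :: nat where m: "(\<integral>z. (norm (b z - closest_point (cball 0 (real m)) (b z)))\<^sup>2 \<partial>lebesgue) < (e / 2)\<^sup>2"
    using bounded_approx_L2[OF b(1) e4] by blast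
  define c where "c z = closest_point (cball 0 (real m)) (b z)" for z
  have pm: "closest_point (cball (0 :: 'b) (real m)) \<in> borel_measurable borel"
    by (intro borel_measurable_continuous_onI continuous_on_closest_point) auto
  have cm: "c \<in> borel_measurable lebesgue"
    unfolding c_def using measurable_compose[OF L2_onD(1)[OF b(1)] pm] .
  have c0: "c z = 0" if "norm z > R" for z
    using b(2)[OF that] by (simp add: c_def closest_point_self)
  have cM: "norm (c z) \<le> real m" for z
    unfolding c_def using closest_point_in_set[of "cball (0 :: 'b) (real m)" "b z"] by auto
  have cL: "c \<in> L2_on lebesgue" by (rule bounded_L2_on_lebesgue(1)[OF cm c0 cM])
  obtain g where g: "continuous_on UNIV g" "\<And>z. norm z > R + 1 \<Longrightarrow> g z = 0" "\<And>z. norm (g z) \<le> real m"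
    "(\<integral>z. (norm (c z - g z))\<^sup>2 \<partial>lebesgue) < (e / 2)\<^sup>2"
    using continuous_approx_bounded[OF cm c0 cM e4] by blast
  have gL: "g \<in> L2_on lebesgue"
    by (rule bounded_L2_on_lebesgue(1)[OF continuous_borel_lebesgue[OF g(1)] g(2,3)])
  have sq: "sqrt x < e / 2" if "x < (e / 2)\<^sup>2" for x
    using real_sqrt_less_mono[OF that] e by simp
  have "sqrt (L2_on.dsq lebesgue b c) < e / 2"
    unfolding L2_on_dsq[OF b(1) cL] c_def by (rule sq[OF m])
  moreover have "sqrt (L2_on.dsq lebesgue c g) < e / 2"
    unfolding L2_on_dsq[OF cL gL] by (rule sq[OF g(4)])
  ultimately have "sqrt (L2_on.dsq lebesgue b g) < e"
    using L2_on.sqrt_dsq_triangle[OF b(1) cL gL] by linarith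
  with g(1,2) gL that show ?thesis by blast
qed

text \<open>Convolution with a mollifier is a contraction of L2 by Young's inequality with
  \<open>A = 1\<close>. It therefore suffices to treat a continuous \<open>g\<close> near
  \<open>b\<close>, for which the convergence is uniform on a fixed ball.\<close>

theorem mollifier_L2:
  fixes b :: "real^3 \<Rightarrow> 'b::euclidean_space"
  assumes b: "b \<in> L2_on lebesgue" "\<And>z. norm z > R \<Longrightarrow> b z = 0" and \<epsilon>: "\<epsilon> > 0"
  obtains \<delta> where "\<delta> > 0"
    "\<And>e. 0 < e \<Longrightarrow> e < \<delta> \<Longrightarrow> conv (mollifier e) b \<in> L2_on lebesgue \<and> sqrt (L2_on.dsq lebesgue (conv (mollifier e) b) b) < \<epsilon>"
proof -
  have \<epsilon>3: "\<epsilon> / 3 > 0" using \<epsilon> by simp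
  obtain g where g: "continuous_on UNIV g" "\<And>z. norm z > R + 1 \<Longrightarrow> g z = 0" and gL: "g \<in> L2_on lebesgue"
    and bg: "sqrt (L2_on.dsq lebesgue b g) < \<epsilon> / 3"
    using continuous_approx_L2[OF b \<epsilon>3] by blast
  have ib: "integrable lebesgue b" by (rule L2_on_lebesgue_integrable[OF b])
  have ig: "integrable lebesgue g" by (rule L2_on_lebesgue_integrable[OF gL g(2)])
  define V where "V = measure lebesgue (cball (0 :: real^3) (R + 4)) + 1"
  have V: "V > 0" unfolding V_def by (intro add_nonneg_pos) auto
  \<comment> \<open>A uniform error \<eta> on a set of measure at most \<open>V\<close> has L2 norm
    at most \<open>\<eta> * sqrt V\<close>, here a quarter of \<epsilon>.\<close>
  define \<eta> where "\<eta> = \<epsilon> / (4 * sqrt V)"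
  have \<eta>: "\<eta> > 0" using \<epsilon> V by (simp add: \<eta>_def)
  obtain \<delta> where \<delta>: "\<delta> > 0" "\<And>e x. 0 < e \<Longrightarrow> e < \<delta> \<Longrightarrow> norm (conv (mollifier e) g x - g x) \<le> \<eta>"
    by (rule mollifier_uniform[OF g \<eta>]) auto
  have main: "conv (mollifier e) b \<in> L2_on lebesgue \<and> sqrt (L2_on.dsq lebesgue (conv (mollifier e) b) b) < \<epsilon>"
    if e: "0 < e" "e < min \<delta> 1" for e
  proof -
    note k = mollifier_test_function[OF e(1)]
    have one: "(\<integral>\<^sup>+x. ennreal \<bar>mollifier e x\<bar> \<partial>lborel) \<le> ennreal 1"
      using nn_integral_mollifier[OF e(1)] mollifier_nonneg[OF e(1)] by simp
    note Y = Young_L2[OF k one zero_le_one]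
    have cb: "conv (mollifier e) b \<in> L2_on lebesgue" by (rule Y(1)[OF b(1) ib])
    have cg: "conv (mollifier e) g \<in> L2_on lebesgue" by (rule Y(1)[OF gL ig])
    have bgL: "(\<lambda>z. b z - g z) \<in> L2_on lebesgue"
      using lin_fun_L2_on[OF b(1) gL, of 1 "-1"] by (simp add: lin_fun_def)
    have "L2_on.dsq lebesgue (conv (mollifier e) b) (conv (mollifier e) g)
        = ip_on lebesgue (conv (mollifier e) (\<lambda>z. b z - g z)) (conv (mollifier e) (\<lambda>z. b z - g z))"
      unfolding L2_on_dsq[OF cb cg] by (simp add: ip_on_def conv_diff[OF k ib ig] power2_norm_eq_inner)
    also have "\<dots> \<le> 1\<^sup>2 * ip_on lebesgue (\<lambda>z. b z - g z) (\<lambda>z. b z - g z)"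
      using ib ig by (intro Y(2) bgL Bochner_Integration.integrable_diff)
    also have "\<dots> = L2_on.dsq lebesgue b g"
      unfolding L2_on_dsq[OF b(1) gL] by (simp add: ip_on_def power2_norm_eq_inner)
    finally have 1: "sqrt (L2_on.dsq lebesgue (conv (mollifier e) b) (conv (mollifier e) g)) < \<epsilon> / 3"
      using bg by (meson le_less_trans real_sqrt_le_mono)
    \<comment> \<open>\<open>g\<close> lives within radius \<open>R + 1\<close> and the kernel
      reaches \<open>3 * e < 3\<close> further.\<close>
    have far: "conv (mollifier e) g x - g x = 0" if "norm x > R + 4" for x
    proof -
      have "conv (mollifier e) g x = 0"
      proof (rule conv_zero_far[where K = "cball 0 (R + 1)" and r = "3 * e"])
        fix z assume "z \<in> cball (0 :: real^3) (R + 1)"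
        then show "norm (x - z) > 3 * e"
          using that e norm_triangle_ineq2[of x z] by simp
      qed (use g(2) mollifier_zero[OF e(1)] in auto)
      then show ?thesis using g(2)[of x] that by simp
    qed
    have "L2_on.dsq lebesgue (conv (mollifier e) g) g \<le> \<eta>\<^sup>2 * measure lebesgue (cball (0 :: real^3) (R + 4))"
      unfolding L2_on_dsq[OF cg gL]
    proof (rule bounded_L2_on_lebesgue(2)[OF _ far])
      show "(\<lambda>x. conv (mollifier e) g x - g x) \<in> borel_measurable lebesgue"
        using L2_onD(1)[OF cg] L2_onD(1)[OF gL] by measurable
      show "norm (conv (mollifier e) g x - g x) \<le> \<eta>" for x using \<delta>(2) e by simp
    qed
    also have "\<dots> \<le> \<eta>\<^sup>2 * V" by (intro mult_left_mono) (auto simp: V_def)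
    also have "\<dots> = (\<epsilon> / 4)\<^sup>2" using V by (simp add: \<eta>_def power_divide power_mult_distrib)
    finally have "sqrt (L2_on.dsq lebesgue (conv (mollifier e) g) g) \<le> \<epsilon> / 4"
      using \<epsilon> by (intro real_le_lsqrt) auto
    then have 2: "sqrt (L2_on.dsq lebesgue (conv (mollifier e) g) g) < \<epsilon> / 3" using \<epsilon> by simp
    have "sqrt (L2_on.dsq lebesgue (conv (mollifier e) b) b) \<le>
        sqrt (L2_on.dsq lebesgue (conv (mollifier e) b) (conv (mollifier e) g)) +
        (sqrt (L2_on.dsq lebesgue (conv (mollifier e) g) g) + sqrt (L2_on.dsq lebesgue g b))"
      using L2_on.sqrt_dsq_triangle[OF cb cg b(1)] L2_on.sqrt_dsq_triangle[OF cg gL b(1)] by linarith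
    also have "\<dots> < \<epsilon> / 3 + (\<epsilon> / 3 + \<epsilon> / 3)"
      using bg L2_on.dsq_commute[OF b(1) gL] by (intro add_strict_mono 1 2) simp
    finally show ?thesis using cb by simp
  qed
  show ?thesis by (rule that[of "min \<delta> 1"]) (use \<delta>(1) main in auto)
qed

section \<open>Restriction to subsets, extension by zero and density of test functions\<close>

lemma integrable_lebesgue_on_subset:
  fixes f :: "'a::euclidean_space \<Rightarrow> 'b::euclidean_space"
  assumes "integrable (lebesgue_on T) f" "S \<in> sets lebesgue" "T \<in> sets lebesgue" "S \<subseteq> T"
  shows "integrable (lebesgue_on S) f"
proof -
  have "integrable lebesgue (\<lambda>x. indicator T x *\<^sub>R f x)"
    using assms by (simp add: integrable_restrict_space)
  from integrable_mult_indicator[OF assms(2) this]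
  have "integrable lebesgue (\<lambda>x. indicator S x *\<^sub>R (indicator T x *\<^sub>R f x))" .
  also have "(\<lambda>x. indicator S x *\<^sub>R (indicator T x *\<^sub>R f x)) = (\<lambda>x. indicator S x *\<^sub>R f x)"
    using assms(4) by (auto simp: indicator_def fun_eq_iff)
  finally show ?thesis using assms by (simp add: integrable_restrict_space)
qed

lemma L2_on_subset:
  fixes f :: "'a::euclidean_space \<Rightarrow> 'b::euclidean_space"
  assumes "f \<in> L2_on (lebesgue_on T)" "S \<in> sets lebesgue" "T \<in> sets lebesgue" "S \<subseteq> T"
  shows "f \<in> L2_on (lebesgue_on S)"
  using measurable_restrict_mono[OF L2_onD(1)[OF assms(1)] assms(4)]
    integrable_lebesgue_on_subset[OF L2_onD(2)[OF assms(1)] assms(2-4)]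
  by (simp add: L2_on_def)

lemma L2_on_lebesgue_on:
  fixes f :: "'a::euclidean_space \<Rightarrow> 'b::euclidean_space"
  assumes "f \<in> L2_on lebesgue" "S \<in> sets lebesgue"
  shows "f \<in> L2_on (lebesgue_on S)"
  using L2_on_subset[of f UNIV S] assms by (simp add: lebesgue_on_UNIV_eq)

lemma L2_on_zero_extension:
  fixes f :: "'a::euclidean_space \<Rightarrow> 'b::euclidean_space"
  assumes f: "f \<in> L2_on (lebesgue_on S)" and S: "S \<in> sets lebesgue"
  shows "(\<lambda>x. if x \<in> S then f x else 0) \<in> L2_on lebesgue"
proof -
  have "(\<lambda>x. if x \<in> S then f x else 0) \<in> borel_measurable lebesgue"
    using L2_onD(1)[OF f] by (rule borel_measurable_if_I) (rule S)
  moreover have "(\<lambda>x. (norm (if x \<in> S then f x else 0))\<^sup>2) = (\<lambda>x. indicator S x *\<^sub>R (norm (f x))\<^sup>2)"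
    by (auto simp: fun_eq_iff)
  ultimately show ?thesis
    using L2_onD(2)[OF f] S by (simp add: L2_on_def integrable_restrict_space)
qed

lemma integral_lebesgue_on_superset:
  fixes f :: "'a::euclidean_space \<Rightarrow> real"
  assumes "S \<in> sets lebesgue" "T \<in> sets lebesgue" "S \<subseteq> T" "\<And>x. x \<in> T - S \<Longrightarrow> f x = 0"
  shows "integral\<^sup>L (lebesgue_on T) f = integral\<^sup>L (lebesgue_on S) f"
proof -
  have "(\<lambda>x. indicator T x *\<^sub>R f x) = (\<lambda>x. indicator S x *\<^sub>R f x)"
    using assms(3,4) by (auto simp: indicator_def fun_eq_iff)
  then show ?thesis using assms by (simp add: integral_restrict_space)
qed

lemma ip_on_superset:
  assumes "S \<in> sets lebesgue" "T \<in> sets lebesgue" "S \<subseteq> T" "\<And>x. x \<in> T - S \<Longrightarrow> f x \<bullet> g x = 0"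
  shows "ip_on (lebesgue_on T) f g = ip_on (lebesgue_on S) f g"
  unfolding ip_on_def using assms by (rule integral_lebesgue_on_superset)

lemma ip_on_lebesgue:
  assumes "S \<in> sets lebesgue" "\<And>x. x \<notin> S \<Longrightarrow> f x \<bullet> g x = 0"
  shows "ip_on lebesgue f g = ip_on (lebesgue_on S) f g"
  using ip_on_superset[of S UNIV f g] assms by (simp add: lebesgue_on_UNIV_eq)

lemma L2_on_scale:
  assumes f: "f \<in> L2_on M" and \<phi>: "\<phi> \<in> borel_measurable M" "\<And>x. \<bar>\<phi> x\<bar> \<le> C"
  shows "(\<lambda>x. \<phi> x *\<^sub>R f x) \<in> L2_on M"
    "ip_on M (\<lambda>x. \<phi> x *\<^sub>R f x) (\<lambda>x. \<phi> x *\<^sub>R f x) \<le> C\<^sup>2 * ip_on M f f"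
proof -
  have m: "(\<lambda>x. \<phi> x *\<^sub>R f x) \<in> borel_measurable M"
    using L2_onD(1)[OF f] \<phi>(1) by measurable
  have le: "(norm (\<phi> x *\<^sub>R f x))\<^sup>2 \<le> C\<^sup>2 * (norm (f x))\<^sup>2" for x
    using power_mono[OF \<phi>(2)[of x], of 2] by (simp add: power_mult_distrib mult_right_mono)
  have i: "integrable M (\<lambda>x. C\<^sup>2 * (norm (f x))\<^sup>2)" using L2_onD(2)[OF f] by simp
  have int: "integrable M (\<lambda>x. (norm (\<phi> x *\<^sub>R f x))\<^sup>2)"
  proof (rule Bochner_Integration.integrable_bound[OF i])
    show "(\<lambda>x. (norm (\<phi> x *\<^sub>R f x))\<^sup>2) \<in> borel_measurable M"
      using L2_onD(1)[OF f] \<phi>(1) by measurable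
    show "AE x in M. norm ((norm (\<phi> x *\<^sub>R f x))\<^sup>2) \<le> norm (C\<^sup>2 * (norm (f x))\<^sup>2)"
      using le by (simp del: norm_scaleR)
  qed
  then show "(\<lambda>x. \<phi> x *\<^sub>R f x) \<in> L2_on M" using m by (simp add: L2_on_def)
  have "(\<integral>x. (norm (\<phi> x *\<^sub>R f x))\<^sup>2 \<partial>M) \<le> (\<integral>x. C\<^sup>2 * (norm (f x))\<^sup>2 \<partial>M)"
    by (rule Bochner_Integration.integral_mono[OF int i le])
  then show "ip_on M (\<lambda>x. \<phi> x *\<^sub>R f x) (\<lambda>x. \<phi> x *\<^sub>R f x) \<le> C\<^sup>2 * ip_on M f f"
    unfolding ip_on_def power2_norm_eq_inner by simp
qed

lemma continuous_supp_L2_on: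
  fixes f :: "'a::euclidean_space \<Rightarrow> 'b::euclidean_space"
  assumes f: "continuous_on UNIV f" and C: "compact C" "\<And>x. x \<notin> C \<Longrightarrow> f x = 0"
  shows "f \<in> L2_on lebesgue"
proof -
  obtain R where R: "\<And>x. x \<in> C \<Longrightarrow> norm x \<le> R"
    using compact_imp_bounded[OF C(1)] by (auto simp: bounded_iff)
  obtain M where M: "\<And>x. norm (f x) \<le> M" using bounded_compact_supp[OF assms] by blast
  show ?thesis
    by (rule bounded_L2_on_lebesgue(1)[OF continuous_borel_lebesgue[OF f] _ M, of R])
      (use R C(2) in force)
qed

lemma open_sets_lebesgue: "open S \<Longrightarrow> S \<in> sets lebesgue" for S :: "'a::euclidean_space set"
  by (simp add: lmeasurable_open borel_open sets_completionI_sets)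

lemma compact_sets_lebesgue: "compact S \<Longrightarrow> S \<in> sets lebesgue" for S :: "'a::euclidean_space set"
  by (simp add: borel_compact sets_completionI_sets)

lemma test_functions_L2_on: "\<psi> \<in> test_functions \<Omega> \<Longrightarrow> \<psi> \<in> L2_on lebesgue"
  for \<psi> :: "real^'n \<Rightarrow> 'b::euclidean_space"
  using test_functionsD[of \<psi> \<Omega>] continuous_supp_L2_on[of \<psi> "supp \<psi>"] by blast

text \<open>Along a compact exhaustion of \<open>S\<close> every point is eventually inside, so the
  truncation error tends to zero pointwise and is dominated by the square of
  \<open>f\<close>.\<close>

lemma compactly_supported_approx:
  fixes f :: "'a::euclidean_space \<Rightarrow> 'b::euclidean_space"
  assumes S: "open S" and f: "f \<in> L2_on (lebesgue_on S)" and e: "e > 0"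
  obtains C where "compact C" "C \<subseteq> S"
    "(\<integral>x. (norm (f x - (if x \<in> C then f x else 0)))\<^sup>2 \<partial>lebesgue_on S) < e"
proof -
  obtain C :: "nat \<Rightarrow> 'a set" where C: "\<And>n. compact (C n)" "\<And>n. C n \<subseteq> S"
    and ev: "\<And>K. \<lbrakk>compact K; K \<subseteq> S\<rbrakk> \<Longrightarrow> \<exists>N. \<forall>n\<ge>N. K \<subseteq> C n"
  proof (rule open_Union_compact_subsets[OF S])
    fix C :: "nat \<Rightarrow> 'a set"
    assume "\<And>n. compact (C n)" "\<And>n. C n \<subseteq> S" "\<And>K. \<lbrakk>compact K; K \<subseteq> S\<rbrakk> \<Longrightarrow> \<exists>N. \<forall>n\<ge>N. K \<subseteq> C n"
    then show thesis by (rule that)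
  qed
  note fm[measurable] = L2_onD(1)[OF f]
  have Cm: "C n \<in> sets (lebesgue_on S)" for n
    using C compact_sets_lebesgue[OF C(1)[of n]] open_sets_lebesgue[OF S]
    by (auto simp: sets_restrict_space_iff)
  have "(\<lambda>n. \<integral>x. (norm (f x - (if x \<in> C n then f x else 0)))\<^sup>2 \<partial>lebesgue_on S) \<longlonglongrightarrow> (\<integral>x. 0 \<partial>lebesgue_on S)"
  proof (rule integral_dominated_convergence)
    show "integrable (lebesgue_on S) (\<lambda>x. (norm (f x))\<^sup>2)" by (rule L2_onD(2)[OF f])
    show "AE x in lebesgue_on S. (\<lambda>n. (norm (f x - (if x \<in> C n then f x else 0)))\<^sup>2) \<longlonglongrightarrow> 0"
    proof (rule AE_I2)
      fix x assume "x \<in> space (lebesgue_on S)"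
      then obtain N where "\<forall>n\<ge>N. {x} \<subseteq> C n" using ev[of "{x}"] by (auto simp: space_restrict_space)
      then have "\<forall>\<^sub>F n in sequentially. (norm (f x - (if x \<in> C n then f x else 0)))\<^sup>2 = 0"
        by (intro eventually_sequentiallyI[of N]) auto
      then show "(\<lambda>n. (norm (f x - (if x \<in> C n then f x else 0)))\<^sup>2) \<longlonglongrightarrow> 0" by (rule tendsto_eventually)
    qed
    show "(\<lambda>x. (norm (f x - (if x \<in> C n then f x else 0)))\<^sup>2) \<in> borel_measurable (lebesgue_on S)" for n
      using Cm[of n] by measurable
  qed (auto intro!: AE_I2)
  then have "(\<lambda>n. \<integral>x. (norm (f x - (if x \<in> C n then f x else 0)))\<^sup>2 \<partial>lebesgue_on S) \<longlonglongrightarrow> 0" by simp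
  from order_tendstoD(2)[OF this e] obtain n
    where "(\<integral>x. (norm (f x - (if x \<in> C n then f x else 0)))\<^sup>2 \<partial>lebesgue_on S) < e"
    using eventually_happens'[OF sequentially_bot] by blast
  with C that show ?thesis by blast
qed

text \<open>Truncation to a compact \<open>C\<close> creates room between the support and the
  complement of \<open>S\<close>; mollifying at a scale below this room gives a test function of
  \<open>S\<close>.\<close>

theorem test_functions_dense:
  fixes f :: "real^3 \<Rightarrow> 'b::euclidean_space"
  assumes S: "open S" and f: "f \<in> L2_on (lebesgue_on S)" and e: "e > 0"
  shows "\<exists>\<psi>\<in>test_functions S. L2_on.dsq (lebesgue_on S) f \<psi> < e"
proof -
  define s where "s = sqrt e / 2"
  have s: "s > 0" "s\<^sup>2 > 0" using e by (auto simp: s_def)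
  obtain C where C: "compact C" "C \<subseteq> S"
    and le: "(\<integral>x. (norm (f x - (if x \<in> C then f x else 0)))\<^sup>2 \<partial>lebesgue_on S) < s\<^sup>2"
    using compactly_supported_approx[OF S f s(2)] by blast
  define b where "b x = (if x \<in> C then f x else 0)" for x
  note Sl = open_sets_lebesgue[OF S] and Cl = compact_sets_lebesgue[OF C(1)]
  have bL: "b \<in> L2_on lebesgue"
    unfolding b_def using L2_on_zero_extension[OF L2_on_subset[OF f Cl Sl C(2)] Cl] .
  have bS: "b \<in> L2_on (lebesgue_on S)" by (rule L2_on_lebesgue_on[OF bL Sl])
  obtain R where R: "\<And>x. x \<in> C \<Longrightarrow> norm x \<le> R"
    using compact_imp_bounded[OF C(1)] by (auto simp: bounded_iff)
  have b0: "b z = 0" if "norm z > R" for z using R[of z] that by (auto simp: b_def)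
  have bi: "integrable lebesgue b" by (rule L2_on_lebesgue_integrable[OF bL b0])
  obtain \<delta> where \<delta>: "\<delta> > 0" "\<And>e. 0 < e \<Longrightarrow> e < \<delta> \<Longrightarrow> conv (mollifier e) b \<in> L2_on lebesgue \<and>
      sqrt (L2_on.dsq lebesgue (conv (mollifier e) b) b) < s"
    using mollifier_L2[OF bL b0 s(1)] by blast
  obtain r where r: "r > 0" "(\<Union>x\<in>C. cball x r) \<subseteq> S"
    using compact_subset_open_imp_cball_epsilon_subset[OF C(1) S C(2)] by blast
  \<comment> \<open>Small enough for the L2 error, and with \<open>3 * h\<close> below the room
    \<open>r\<close> around \<open>C\<close>.\<close>
  define h where "h = min \<delta> r / 4"
  have h: "0 < h" "h < \<delta>" "3 * h \<le> r" using \<delta>(1) r(1) by (auto simp: h_def)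
  let ?\<psi> = "conv (mollifier h) b"
  have "(\<Union>x\<in>C. cball x (3 * h)) \<subseteq> S" using r(2) h(3) by force
  then have \<psi>: "?\<psi> \<in> test_functions S"
    by (intro conv_test_function[OF mollifier_test_function[OF h(1)] mollifier_zero[OF h(1)] bi _ C(1)])
      (auto simp: b_def)
  have \<psi>L: "?\<psi> \<in> L2_on lebesgue" and close: "sqrt (L2_on.dsq lebesgue ?\<psi> b) < s"
    using \<delta>(2)[OF h(1,2)] by auto
  have \<psi>S: "?\<psi> \<in> L2_on (lebesgue_on S)" by (rule L2_on_lebesgue_on[OF \<psi>L Sl])
  have \<psi>0: "?\<psi> x = 0" if "x \<notin> S" for x
    using test_functionsD(4)[OF \<psi>, of x] test_functionsD(5)[OF \<psi>] that by auto
  have "ip_on lebesgue u v = ip_on (lebesgue_on S) u v" if "u \<in> {?\<psi>, b}" for u v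
    using that C(2) \<psi>0 by (intro ip_on_lebesgue[OF Sl]) (auto simp: b_def)
  then have "L2_on.dsq lebesgue ?\<psi> b = L2_on.dsq (lebesgue_on S) ?\<psi> b"
    by (simp add: L2_on.dsq_def)
  then have 1: "sqrt (L2_on.dsq (lebesgue_on S) b ?\<psi>) < s"
    using close L2_on.dsq_commute[OF bS \<psi>S] by simp
  have 2: "sqrt (L2_on.dsq (lebesgue_on S) f b) < s"
    using real_sqrt_less_mono[OF le] s(1) unfolding L2_on_dsq[OF f bS] b_def by simp
  have "sqrt (L2_on.dsq (lebesgue_on S) f ?\<psi>) < sqrt e"
    using L2_on.sqrt_dsq_triangle[OF f bS \<psi>S] 1 2 unfolding s_def by linarith
  then show ?thesis using \<psi> by (intro bexI[of _ ?\<psi>]) auto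
qed

section \<open>The spaces of the weak curl and divergence\<close>

lemma vector_3_axis: "(vector [a, b, c] :: real^3) = a *\<^sub>R axis 1 1 + b *\<^sub>R axis 2 1 + c *\<^sub>R axis 3 1"
  by (simp add: vec_eq_iff forall_3 axis_def)

lemma partial_component:
  assumes "\<And>x. f differentiable (at x)"
  shows "partial i (\<lambda>y. f y $ j) = (\<lambda>x. partial i f x $ j)"
proof -
  have *: "((\<lambda>y. f y $ j) has_derivative (\<lambda>h. frechet_derivative f (at x) h $ j)) (at x)" for x
    by (rule bounded_linear.has_derivative[OF bounded_linear_vec_nth has_derivative_frechet[OF assms]])
  show ?thesis unfolding has_derivative_partial[OF *] by (simp add: partial_def)
qed

lemma curl_eq:
  assumes "\<And>x. f differentiable (at x)"
  shows "curl f x =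
     (partial 2 f x $ 3 - partial 3 f x $ 2) *\<^sub>R axis 1 1 +
     (partial 3 f x $ 1 - partial 1 f x $ 3) *\<^sub>R axis 2 1 +
     (partial 1 f x $ 2 - partial 2 f x $ 1) *\<^sub>R axis 3 1"
  unfolding curl_def vector_3_axis partial_component[OF assms] ..

lemma grad_eq: "grad f x = partial 1 f x *\<^sub>R axis 1 1 + partial 2 f x *\<^sub>R axis 2 1 + partial 3 f x *\<^sub>R axis 3 1"
  by (simp add: grad_def vec_eq_iff forall_3 axis_def)

lemma curl_test_function_L2_on:
  assumes "\<Psi> \<in> test_functions \<Omega>"
  shows "curl \<Psi> \<in> L2_on lebesgue"
proof (rule continuous_supp_L2_on)
  note \<Psi> = test_functionsD[OF assms]
  note eq = curl_eq[OF smooth_differentiable[OF \<Psi>(1)]]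
  show "continuous_on UNIV (curl \<Psi>)"
    unfolding eq[abs_def] by (intro continuous_intros smooth_continuous smooth_partial \<Psi>)
  show "compact (supp \<Psi>)" by (rule \<Psi>)
  show "curl \<Psi> x = 0" if "x \<notin> supp \<Psi>" for x
    unfolding eq by (simp add: partial_outside_supp[OF that])
qed

lemma grad_test_function_L2_on:
  assumes "\<psi> \<in> test_functions \<Omega>"
  shows "grad \<psi> \<in> L2_on lebesgue"
proof (rule continuous_supp_L2_on)
  note \<psi> = test_functionsD[OF assms]
  show "continuous_on UNIV (grad \<psi>)"
    unfolding grad_eq[abs_def] by (intro continuous_intros smooth_continuous smooth_partial \<psi>)
  show "compact (supp \<psi>)" by (rule \<psi>)
  show "grad \<psi> x = 0" if "x \<notin> supp \<psi>" for x
    unfolding grad_eq by (simp add: partial_outside_supp[OF that])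
qed

lemma weak_operator_test_functions:
  fixes T :: "(real^3 \<Rightarrow> 'b::euclidean_space) \<Rightarrow> real^3 \<Rightarrow> 'c::euclidean_space"
  assumes \<Omega>: "open \<Omega>" and T: "\<And>\<psi>. \<psi> \<in> test_functions \<Omega> \<Longrightarrow> T \<psi> \<in> L2_on lebesgue"
  shows "weak_operator (L2_on (lebesgue_on \<Omega>)) lin_fun (ip_on (lebesgue_on \<Omega>))
    (L2_on (lebesgue_on \<Omega>)) lin_fun (ip_on (lebesgue_on \<Omega>)) (test_functions \<Omega>) T"
proof (intro weak_operator.intro weak_operator_axioms.intro semi_hilbert_L2_on)
  note L = L2_on_lebesgue_on[OF _ open_sets_lebesgue[OF \<Omega>]]
  show "test_functions \<Omega> \<subseteq> L2_on (lebesgue_on \<Omega>)" using L[OF test_functions_L2_on] by blast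
  show "T \<psi> \<in> L2_on (lebesgue_on \<Omega>)" if "\<psi> \<in> test_functions \<Omega>" for \<psi> using L[OF T[OF that]] .
  show "\<exists>\<psi>\<in>test_functions \<Omega>. L2_on.dsq (lebesgue_on \<Omega>) w \<psi> < e"
    if "w \<in> L2_on (lebesgue_on \<Omega>)" "e > 0" for w :: "real^3 \<Rightarrow> 'b" and e
    using test_functions_dense[OF \<Omega> that] .
qed

section \<open>The weak curl and the weak divergence as instances of the abstract adjoint\<close>

context
  fixes \<Omega> :: "(real^3) set"
  assumes \<Omega>: "open \<Omega>"
begin

interpretation C: weak_operator "L2_on (lebesgue_on \<Omega>)" lin_fun "ip_on (lebesgue_on \<Omega>)"
  "L2_on (lebesgue_on \<Omega>)" lin_fun "ip_on (lebesgue_on \<Omega>)" "test_functions \<Omega>" curl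
  by (rule weak_operator_test_functions[OF \<Omega> curl_test_function_L2_on])

text \<open>The operator is \<open>- grad\<close>, whose weak adjoint is the divergence. The form as
  a linear combination, with a dummy second summand, gives square integrability by
  \<open>lin_fun_L2_on\<close>.\<close>

interpretation D: weak_operator "L2_on (lebesgue_on \<Omega>)" lin_fun "ip_on (lebesgue_on \<Omega>)"
  "L2_on (lebesgue_on \<Omega>)" lin_fun "ip_on (lebesgue_on \<Omega>)" "test_functions \<Omega>" "\<lambda>\<psi>. lin_fun (-1) (grad \<psi>) 0 (grad \<psi>)"
  by (rule weak_operator_test_functions[OF \<Omega> lin_fun_L2_on[OF grad_test_function_L2_on grad_test_function_L2_on]])

lemma curl_eqs: "has_weak_curl \<Omega> E G \<longleftrightarrow> C.has_adj E G" "D_curl \<Omega> = C.dom" "weak_curl \<Omega> E = C.adj E"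
  "D_curl_inner \<Omega> E F = C.ipD E F"
proof -
  show h: "has_weak_curl \<Omega> E G \<longleftrightarrow> C.has_adj E G" for E G
    unfolding has_weak_curl_def C.has_adj_def L2_inner_eq ..
  show "D_curl \<Omega> = C.dom" unfolding D_curl_def C.dom_def h L2_eq ..
  show w: "weak_curl \<Omega> E = C.adj E" for E unfolding weak_curl_def C.adj_def h L2_eq ..
  show "D_curl_inner \<Omega> E F = C.ipD E F" unfolding D_curl_inner_def C.ipD_def w L2_inner_eq ..
qed

lemma div_eqs: "has_weak_div \<Omega> H g \<longleftrightarrow> D.has_adj H g" "D_div \<Omega> = D.dom" "weak_div \<Omega> H = D.adj H"
  "D_div_inner \<Omega> H K = D.ipD H K"
proof -
  have "ip_on (lebesgue_on \<Omega>) H (lin_fun (-1) (grad \<psi>) 0 (grad \<psi>)) = - ip_on (lebesgue_on \<Omega>) H (grad \<psi>)" for H \<psi>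
    by (simp add: ip_on_def lin_fun_def)
  then show h: "has_weak_div \<Omega> H g \<longleftrightarrow> D.has_adj H g" for H g
    unfolding has_weak_div_def D.has_adj_def L2_inner_eq by simp
  show "D_div \<Omega> = D.dom" unfolding D_div_def D.dom_def h L2_eq ..
  show w: "weak_div \<Omega> H = D.adj H" for H unfolding weak_div_def D.adj_def h L2_eq ..
  show "D_div_inner \<Omega> H K = D.ipD H K" unfolding D_div_inner_def D.ipD_def w L2_inner_eq ..
qed

lemma D_curlD:
  assumes "E \<in> D_curl \<Omega>"
  shows "E \<in> L2 \<Omega>" "weak_curl \<Omega> E \<in> L2 \<Omega>" "has_weak_curl \<Omega> E (weak_curl \<Omega> E)"
    "L2_inner \<Omega> E E \<le> D_curl_inner \<Omega> E E"
    "L2_inner \<Omega> (weak_curl \<Omega> E) (weak_curl \<Omega> E) \<le> D_curl_inner \<Omega> E E"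
  using C.domD[of E] C.ip_le_ipD[of E] assms unfolding curl_eqs L2_eq L2_inner_eq by auto

lemma D_divD:
  assumes "H \<in> D_div \<Omega>"
  shows "H \<in> L2 \<Omega>" "weak_div \<Omega> H \<in> L2 \<Omega>" "has_weak_div \<Omega> H (weak_div \<Omega> H)"
    "L2_inner \<Omega> H H \<le> D_div_inner \<Omega> H H"
    "L2_inner \<Omega> (weak_div \<Omega> H) (weak_div \<Omega> H) \<le> D_div_inner \<Omega> H H"
  using D.domD[of H] D.ip_le_ipD[of H] assms unfolding div_eqs L2_eq L2_inner_eq by auto

lemma D_curl_weak_limit:
  assumes "\<And>n. En n \<in> D_curl \<Omega>" "\<And>n. D_curl_inner \<Omega> (En n) (En n) \<le> B"
    and "E \<in> L2 \<Omega>" "weakly_converges (L2 \<Omega>) (L2_inner \<Omega>) En E"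
  shows "E \<in> D_curl \<Omega>" "weakly_converges (D_curl \<Omega>) (D_curl_inner \<Omega>) En E"
  using C.dom_weak_limit[of En B E] assms unfolding weakly_converges_def curl_eqs L2_eq L2_inner_eq by blast+

lemma D_div_weak_limit:
  assumes "\<And>n. Hn n \<in> D_div \<Omega>" "\<And>n. D_div_inner \<Omega> (Hn n) (Hn n) \<le> B"
    and "H \<in> L2 \<Omega>" "weakly_converges (L2 \<Omega>) (L2_inner \<Omega>) Hn H"
  shows "H \<in> D_div \<Omega>" "weakly_converges (D_div \<Omega>) (D_div_inner \<Omega>) Hn H"
  using D.dom_weak_limit[of Hn B H] assms unfolding weakly_converges_def div_eqs L2_eq L2_inner_eq by blast+

lemma D_curl_weak_convergence:
  assumes "\<And>n. En n \<in> D_curl \<Omega>" "E \<in> D_curl \<Omega>" "weakly_converges (D_curl \<Omega>) (D_curl_inner \<Omega>) En E"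
  shows "\<exists>B. \<forall>n. D_curl_inner \<Omega> (En n) (En n) \<le> B" "weakly_converges (L2 \<Omega>) (L2_inner \<Omega>) En E"
  using C.dom_weak_convergence[of En E] assms unfolding weakly_converges_def curl_eqs L2_eq L2_inner_eq by blast+

lemma D_div_weak_convergence:
  assumes "\<And>n. Hn n \<in> D_div \<Omega>" "H \<in> D_div \<Omega>" "weakly_converges (D_div \<Omega>) (D_div_inner \<Omega>) Hn H"
  shows "\<exists>B. \<forall>n. D_div_inner \<Omega> (Hn n) (Hn n) \<le> B" "weakly_converges (L2 \<Omega>) (L2_inner \<Omega>) Hn H"
  using D.dom_weak_convergence[of Hn H] assms unfolding weakly_converges_def div_eqs L2_eq L2_inner_eq by blast+

end

section \<open>The mollification error\<close>

lemma conv_component: "integrable lebesgue b \<Longrightarrow> k \<in> test_functions UNIV \<Longrightarrow> conv k b x $ l = conv k (\<lambda>z. b z $ l) x"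
  for b :: "real^'n \<Rightarrow> real^'m"
  using integral_bounded_linear[OF bounded_linear_vec_nth[of l] integrable_conv[of k b x]] by (simp add: conv_def)

lemma integrable_component: "integrable M b \<Longrightarrow> integrable M (\<lambda>z. b z $ l)" for b :: "'a \<Rightarrow> real^'m"
  by (rule integrable_bounded_linear[OF bounded_linear_vec_nth])

lemma conv_uminus: "conv k (\<lambda>z. - b z) x = - conv k b x"
  by (simp add: conv_def)

lemma conv_zero_right: "conv k (\<lambda>z. 0) x = 0"
  by (simp add: conv_def)

lemma integral_lebesgue_on_zero_outside:
  fixes f :: "'a::euclidean_space \<Rightarrow> real"
  assumes "S \<in> sets lebesgue" "\<And>x. x \<notin> S \<Longrightarrow> f x = 0"
  shows "integral\<^sup>L lebesgue f = integral\<^sup>L (lebesgue_on S) f"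
  using integral_lebesgue_on_superset[of S UNIV f] assms by (simp add: lebesgue_on_UNIV_eq)

lemma test_function_zero: "k \<in> test_functions \<Omega> \<Longrightarrow> x \<notin> \<Omega> \<Longrightarrow> k x = 0"
  using test_functionsD(4,5)[of k \<Omega>] by blast

lemma partial_zero_far: "(\<And>x. norm x > r \<Longrightarrow> k x = 0) \<Longrightarrow> norm x > r \<Longrightarrow> partial i k x = 0"
  using supp_subset[of "cball 0 r" k] by (intro partial_outside_supp) force

text \<open>Here \<open>h\<close> is an arbitrary weak divergence of \<open>H\<close>, and \<phi> is
  smooth so that it may multiply test functions.\<close>

locale localized_fields =
  fixes \<Omega> :: "(real^3) set" and \<phi> :: "real^3 \<Rightarrow> real" and H :: "real^3 \<Rightarrow> real^3" and h :: "real^3 \<Rightarrow> real"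
  assumes \<Omega>: "open \<Omega>" and \<phi>: "\<phi> \<in> test_functions \<Omega>"
    and H: "H \<in> L2_on (lebesgue_on \<Omega>)" and h: "h \<in> L2_on (lebesgue_on \<Omega>)" and div: "has_weak_div \<Omega> H h"
begin

definition v :: "real^3 \<Rightarrow> real^3" where
  "v z = \<phi> z *\<^sub>R H z"

text \<open>The divergence of \<open>v\<close> by the product rule; \<open>conv_div\<close> is where
  it acts as such.\<close>

definition g :: "real^3 \<Rightarrow> real" where
  "g z = \<phi> z * h z + grad \<phi> z \<bullet> H z"

lemmas \<phi>D = test_functionsD[OF \<phi>]

lemma \<Omega>_sets: "\<Omega> \<in> sets lebesgue"
  by (rule open_sets_lebesgue[OF \<Omega>])

lemma grad_zero: "z \<notin> supp \<phi> \<Longrightarrow> grad \<phi> z = 0"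
  by (simp add: grad_eq partial_outside_supp)

lemma v_zero: "z \<notin> supp \<phi> \<Longrightarrow> v z = 0"
  by (simp add: v_def \<phi>D)

lemma g_zero: "z \<notin> supp \<phi> \<Longrightarrow> g z = 0"
  by (simp add: g_def \<phi>D grad_zero)

lemma outside: "z \<notin> \<Omega> \<Longrightarrow> z \<notin> supp \<phi>"
  using \<phi>D(5) by blast

lemma grad_continuous: "continuous_on UNIV (grad \<phi>)"
  unfolding grad_eq[abs_def] by (intro continuous_intros smooth_continuous smooth_partial \<phi>D(1))

lemma ex_bounds: "\<exists>M>0. \<forall>z. \<bar>\<phi> z\<bar> \<le> M \<and> norm (grad \<phi> z) \<le> M"
proof -
  obtain M1 where M1: "M1 > 0" "\<And>z. norm (\<phi> z) \<le> M1" using test_function_bounded[OF \<phi>] by blast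
  obtain M2 where M2: "M2 > 0" "\<And>z. norm (grad \<phi> z) \<le> M2"
    using bounded_compact_supp[OF grad_continuous \<phi>D(3) grad_zero] by blast
  have "\<bar>\<phi> z\<bar> \<le> max M1 M2 \<and> norm (grad \<phi> z) \<le> max M1 M2" for z
    using M1(2)[of z] M2(2)[of z] by (simp add: le_max_iff_disj)
  then show ?thesis using M1(1) by (intro exI[of _ "max M1 M2"]) auto
qed

lemma v_L2: "v \<in> L2_on (lebesgue_on \<Omega>)"
  and ip_v_le: "(\<And>z. \<bar>\<phi> z\<bar> \<le> M) \<Longrightarrow> ip_on (lebesgue_on \<Omega>) v v \<le> M\<^sup>2 * ip_on (lebesgue_on \<Omega>) H H"
proof -
  have m: "\<phi> \<in> borel_measurable (lebesgue_on \<Omega>)"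
    using measurable_restrict_space1[OF continuous_borel_lebesgue[OF \<phi>D(2)]] .
  obtain C where C: "\<And>z. \<bar>\<phi> z\<bar> \<le> C" using ex_bounds by blast
  show "v \<in> L2_on (lebesgue_on \<Omega>)"
    unfolding v_def[abs_def] by (rule L2_on_scale(1)[OF H m C])
  show "(\<And>z. \<bar>\<phi> z\<bar> \<le> M) \<Longrightarrow> ip_on (lebesgue_on \<Omega>) v v \<le> M\<^sup>2 * ip_on (lebesgue_on \<Omega>) H H"
    unfolding v_def[abs_def] by (rule L2_on_scale(2)[OF H m])
qed

lemma g_sq_le:
  assumes "\<bar>\<phi> z\<bar> \<le> M" "norm (grad \<phi> z) \<le> M"
  shows "(g z)\<^sup>2 \<le> 2 * M\<^sup>2 * ((norm (h z))\<^sup>2 + (norm (H z))\<^sup>2)"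
proof -
  have "\<bar>g z\<bar> \<le> \<bar>\<phi> z\<bar> * norm (h z) + norm (grad \<phi> z) * norm (H z)"
    using Cauchy_Schwarz_ineq2[of "grad \<phi> z" "H z"] by (simp add: g_def abs_mult abs_triangle_ineq[THEN order_trans])
  also have "\<dots> \<le> M * norm (h z) + M * norm (H z)"
    by (intro add_mono mult_right_mono assms) auto
  finally have "\<bar>g z\<bar> \<le> M * (norm (h z) + norm (H z))" by (simp add: distrib_left)
  then have "(g z)\<^sup>2 \<le> M\<^sup>2 * (norm (h z) + norm (H z))\<^sup>2"
    using power_mono[OF _ abs_ge_zero, of "g z" _ 2] by (simp flip: power_mult_distrib)
  also have "\<dots> \<le> M\<^sup>2 * (2 * ((norm (h z))\<^sup>2 + (norm (H z))\<^sup>2))"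
    using sum_squares_bound[of "norm (h z)" "norm (H z)"] by (intro mult_left_mono) (auto simp: power2_sum)
  finally show ?thesis by (simp add: algebra_simps)
qed

lemma g_L2: "g \<in> L2_on (lebesgue_on \<Omega>)"
  and ip_g_le: "(\<And>z. \<bar>\<phi> z\<bar> \<le> M) \<Longrightarrow> (\<And>z. norm (grad \<phi> z) \<le> M) \<Longrightarrow>
    ip_on (lebesgue_on \<Omega>) g g \<le> 2 * M\<^sup>2 * (ip_on (lebesgue_on \<Omega>) h h + ip_on (lebesgue_on \<Omega>) H H)"
proof -
  have [measurable]: "\<phi> \<in> borel_measurable (lebesgue_on \<Omega>)" "grad \<phi> \<in> borel_measurable (lebesgue_on \<Omega>)"
    using measurable_restrict_space1[OF continuous_borel_lebesgue[OF \<phi>D(2)]]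
      measurable_restrict_space1[OF continuous_borel_lebesgue[OF grad_continuous]] by auto
  have [measurable]: "H \<in> borel_measurable (lebesgue_on \<Omega>)" "h \<in> borel_measurable (lebesgue_on \<Omega>)"
    using L2_onD[OF H] L2_onD[OF h] by auto
  have m: "g \<in> borel_measurable (lebesgue_on \<Omega>)" unfolding g_def[abs_def] by measurable
  have i: "integrable (lebesgue_on \<Omega>) (\<lambda>z. 2 * M\<^sup>2 * ((norm (h z))\<^sup>2 + (norm (H z))\<^sup>2))" for M
    using L2_onD(2)[OF H] L2_onD(2)[OF h] by simp
  have int: "integrable (lebesgue_on \<Omega>) (\<lambda>z. (norm (g z))\<^sup>2)"
  proof -
    obtain C where C: "\<And>z. \<bar>\<phi> z\<bar> \<le> C" "\<And>z. norm (grad \<phi> z) \<le> C" using ex_bounds by blast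
    show ?thesis
    proof (rule Bochner_Integration.integrable_bound[OF i[of C]])
      show "AE z in lebesgue_on \<Omega>. norm ((norm (g z))\<^sup>2) \<le> norm (2 * C\<^sup>2 * ((norm (h z))\<^sup>2 + (norm (H z))\<^sup>2))"
        using g_sq_le[OF C] by (intro AE_I2) (simp add: abs_of_nonneg)
    qed (use m in measurable)
  qed
  then show "g \<in> L2_on (lebesgue_on \<Omega>)" using m by (simp add: L2_on_def)
  assume M: "\<And>z. \<bar>\<phi> z\<bar> \<le> M" "\<And>z. norm (grad \<phi> z) \<le> M"
  have "(\<integral>z. (norm (g z))\<^sup>2 \<partial>lebesgue_on \<Omega>) \<le> (\<integral>z. 2 * M\<^sup>2 * ((norm (h z))\<^sup>2 + (norm (H z))\<^sup>2) \<partial>lebesgue_on \<Omega>)"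
    using g_sq_le[OF M] by (intro Bochner_Integration.integral_mono int i) simp
  also have "\<dots> = 2 * M\<^sup>2 * ((\<integral>z. (norm (h z))\<^sup>2 \<partial>lebesgue_on \<Omega>) + (\<integral>z. (norm (H z))\<^sup>2 \<partial>lebesgue_on \<Omega>))"
    using L2_onD(2)[OF H] L2_onD(2)[OF h] by simp
  finally show "ip_on (lebesgue_on \<Omega>) g g \<le> 2 * M\<^sup>2 * (ip_on (lebesgue_on \<Omega>) h h + ip_on (lebesgue_on \<Omega>) H H)"
    by (simp only: ip_on_def power2_norm_eq_inner)
qed

text \<open>A field that is zero off \<open>supp \<phi>\<close> is its own extension by zero from
  \<Omega>; bounded support adds integrability on the whole space, which the convolution
  needs.\<close>

lemma extension_L2:
  fixes b :: "real^3 \<Rightarrow> 'b::euclidean_space"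
  assumes b: "b \<in> L2_on (lebesgue_on \<Omega>)" "\<And>z. z \<notin> supp \<phi> \<Longrightarrow> b z = 0"
  shows "b \<in> L2_on lebesgue" "integrable lebesgue b" "ip_on lebesgue b b = ip_on (lebesgue_on \<Omega>) b b"
proof -
  have "(\<lambda>z. if z \<in> \<Omega> then b z else 0) = b" using b(2) outside by (auto simp: fun_eq_iff)
  then show L: "b \<in> L2_on lebesgue" using L2_on_zero_extension[OF b(1) \<Omega>_sets] by simp
  obtain R where R: "\<And>z. z \<in> supp \<phi> \<Longrightarrow> norm z \<le> R"
    using compact_imp_bounded[OF \<phi>D(3)] by (auto simp: bounded_iff)
  show "integrable lebesgue b"
    by (rule L2_on_lebesgue_integrable[OF L, of R]) (use R b(2) in force)
  show "ip_on lebesgue b b = ip_on (lebesgue_on \<Omega>) b b"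
    by (rule ip_on_lebesgue[OF \<Omega>_sets]) (use b(2) outside in auto)
qed

lemmas v_ext = extension_L2[OF v_L2 v_zero] and g_ext = extension_L2[OF g_L2 g_zero]

text \<open>The weak form of \<open>div (\<phi> H) = g\<close>, tested with \<open>\<kappa> (x - \<cdot>)\<close>.\<close>

lemma conv_div:
  assumes \<kappa>: "\<kappa> \<in> test_functions UNIV"
  shows "(\<Sum>i\<in>UNIV. conv (partial i \<kappa>) (\<lambda>z. v z $ i) x) = conv \<kappa> g x"
proof -
  note \<kappa>D = test_functionsD[OF \<kappa>]
  have d\<phi>: "\<phi> differentiable (at y)" and d\<kappa>: "\<kappa> differentiable (at y)" for y
    using smooth_differentiable \<phi>D(1) \<kappa>D(1) by blast+
  have sr: "smooth (\<lambda>z. \<kappa> (x - z))" using \<kappa>D(1) by (simp add: smooth_def Ck_reflect)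
  have dr: "(\<lambda>z. \<kappa> (x - z)) differentiable (at y)" for y by (rule smooth_differentiable[OF sr])
  \<comment> \<open>The support of \<kappa> is unrelated to \<Omega>; the factor \<phi> is what
    makes the product an admissible test function.\<close>
  define \<psi> where "\<psi> z = \<phi> z * \<kappa> (x - z)" for z
  have \<psi>0: "\<psi> z = 0" if "z \<notin> supp \<phi>" for z using \<phi>D(4)[OF that] by (simp add: \<psi>_def)
  have sm: "smooth \<psi>"
    unfolding \<psi>_def[abs_def] smooth_def
    using \<phi>D(1) sr by (intro allI Ck_mult) (auto simp: smooth_def)
  have "supp \<psi> \<subseteq> supp \<phi>" by (rule supp_subset[OF closed_supp \<psi>0])
  then have \<psi>: "\<psi> \<in> test_functions \<Omega>"
    using sm compact_supp_subset[OF \<phi>D(3) \<psi>0] \<phi>D(5) by (simp add: test_functions_def)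
  then have *: "ip_on (lebesgue_on \<Omega>) h \<psi> = - ip_on (lebesgue_on \<Omega>) H (grad \<psi>)"
    using div by (simp add: has_weak_div_def L2_inner_eq)
  have p\<psi>: "partial i \<psi> z = \<kappa> (x - z) * partial i \<phi> z - \<phi> z * partial i \<kappa> (x - z)" for i z
    using partial_scaleR[of \<phi> "\<lambda>z. \<kappa> (x - z)" i] d\<phi> dr partial_reflect[of \<kappa> i x] d\<kappa>
    by (simp add: \<psi>_def[abs_def])
  have ig: "integrable lebesgue (\<lambda>z. \<kappa> (x - z) * g z)"
    using integrable_conv[OF \<kappa> g_ext(2), of x] by simp
  have iv: "integrable lebesgue (\<lambda>z. partial i \<kappa> (x - z) * (v z $ i))" for i
    using integrable_conv[OF test_functions_partial[OF \<kappa>] integrable_component[OF v_ext(2)], of i x] by simp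
  \<comment> \<open>The minus sign comes from differentiating the reflected kernel. With it the
    integrand becomes the weak divergence identity for \<psi>, whose integral vanishes.\<close>
  have pt: "\<kappa> (x - z) * g z - (\<Sum>i\<in>UNIV. partial i \<kappa> (x - z) * (v z $ i)) = h z * \<psi> z + H z \<bullet> grad \<psi> z" for z
    by (simp add: inner_vec_def g_def v_def grad_def p\<psi> \<psi>_def algebra_simps sum.distrib sum_subtractf sum_distrib_left)
  have "conv \<kappa> g x - (\<Sum>i\<in>UNIV. conv (partial i \<kappa>) (\<lambda>z. v z $ i) x)
      = (\<integral>z. \<kappa> (x - z) * g z - (\<Sum>i\<in>UNIV. partial i \<kappa> (x - z) * (v z $ i)) \<partial>lebesgue)"
    using ig iv by (simp add: conv_def)
  also have "\<dots> = (\<integral>z. h z * \<psi> z + H z \<bullet> grad \<psi> z \<partial>lebesgue)" unfolding pt ..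
  also have "\<dots> = (\<integral>z. h z * \<psi> z + H z \<bullet> grad \<psi> z \<partial>lebesgue_on \<Omega>)"
    by (rule integral_lebesgue_on_zero_outside[OF \<Omega>_sets])
      (use outside \<psi>0 in \<open>auto simp: grad_eq p\<psi> partial_outside_supp \<phi>D(4)\<close>)
  also have "\<dots> = ip_on (lebesgue_on \<Omega>) h \<psi> + ip_on (lebesgue_on \<Omega>) H (grad \<psi>)"
  proof -
    have "\<psi> \<in> L2_on (lebesgue_on \<Omega>)" "grad \<psi> \<in> L2_on (lebesgue_on \<Omega>)"
      using \<psi> L2_on_lebesgue_on[OF _ \<Omega>_sets] test_functions_L2_on grad_test_function_L2_on
      by blast+
    then show ?thesis
      using integrable_inner_L2_on[OF h] integrable_inner_L2_on[OF H] by (simp add: ip_on_def)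
  qed
  finally show ?thesis using * by simp
qed

section \<open>Writing a derivative as a divergence term minus a curl\<close>

lemma norm_cross3_axis_le: "norm (cross3 (axis j 1) w) \<le> norm w"
proof -
  have "(norm (cross3 (axis j 1) w))\<^sup>2 + (axis j 1 \<bullet> w)\<^sup>2 = (norm w)\<^sup>2"
    using norm_cross_dot[of "axis j 1" w] by simp
  then have "(norm (cross3 (axis j 1) w))\<^sup>2 \<le> (norm w)\<^sup>2"
    using zero_le_power2[of "axis j 1 \<bullet> w"] by linarith
  then show ?thesis by (rule power2_le_imp_le) simp
qed

lemma cross_L2: "(\<lambda>z. cross3 (axis j 1) (v z)) \<in> L2_on (lebesgue_on \<Omega>)"
  and ip_cross_le: "ip_on (lebesgue_on \<Omega>) (\<lambda>z. cross3 (axis j 1) (v z)) (\<lambda>z. cross3 (axis j 1) (v z))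
    \<le> ip_on (lebesgue_on \<Omega>) v v"
proof -
  have le: "(norm (cross3 (axis j 1) (v z)))\<^sup>2 \<le> (norm (v z))\<^sup>2" for z
    by (intro power_mono norm_cross3_axis_le) simp
  have "linear (cross3 (axis j 1))" by (intro linearI) (simp_all add: cross_add_right cross_mult_right)
  then have m: "cross3 (axis j 1) \<in> borel_measurable borel"
    by (intro borel_measurable_continuous_onI linear_continuous_on) (simp add: linear_conv_bounded_linear)
  have m: "(\<lambda>z. cross3 (axis j 1) (v z)) \<in> borel_measurable (lebesgue_on \<Omega>)"
    using measurable_compose[OF L2_onD(1)[OF v_L2] m] .
  have int: "integrable (lebesgue_on \<Omega>) (\<lambda>z. (norm (cross3 (axis j 1) (v z)))\<^sup>2)"
    by (rule Bochner_Integration.integrable_bound[OF L2_onD(2)[OF v_L2]]) (use m le in \<open>auto intro!: AE_I2\<close>)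
  then show "(\<lambda>z. cross3 (axis j 1) (v z)) \<in> L2_on (lebesgue_on \<Omega>)" using m by (simp add: L2_on_def)
  show "ip_on (lebesgue_on \<Omega>) (\<lambda>z. cross3 (axis j 1) (v z)) (\<lambda>z. cross3 (axis j 1) (v z))
    \<le> ip_on (lebesgue_on \<Omega>) v v"
    using Bochner_Integration.integral_mono[OF int L2_onD(2)[OF v_L2] le] by (simp add: ip_on_def power2_norm_eq_inner)
qed

lemma cross_zero: "z \<notin> supp \<phi> \<Longrightarrow> cross3 (axis j 1) (v z) = 0"
  by (simp add: v_zero)

lemmas cross_ext = extension_L2[OF cross_L2 cross_zero]

lemma g_axis_L2: "(\<lambda>z. g z *\<^sub>R (axis j 1 :: real^3)) \<in> L2_on (lebesgue_on \<Omega>)"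
  and ip_g_axis: "ip_on (lebesgue_on \<Omega>) (\<lambda>z. g z *\<^sub>R (axis j 1 :: real^3)) (\<lambda>z. g z *\<^sub>R axis j 1) = ip_on (lebesgue_on \<Omega>) g g"
  using L2_onD[OF g_L2] by (auto simp: L2_on_def ip_on_def inner_axis_axis)

lemma g_axis_zero: "z \<notin> supp \<phi> \<Longrightarrow> g z *\<^sub>R (axis j 1 :: real^3) = 0"
  by (simp add: g_zero)

lemmas g_axis_ext = extension_L2[OF g_axis_L2 g_axis_zero]

lemma cross3_axis_component:
  "cross3 (axis 1 1) w $ 1 = 0" "cross3 (axis 1 1) w $ 2 = - (w $ 3)" "cross3 (axis 1 1) w $ 3 = w $ 2"
  "cross3 (axis 2 1) w $ 1 = w $ 3" "cross3 (axis 2 1) w $ 2 = 0" "cross3 (axis 2 1) w $ 3 = - (w $ 1)"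
  "cross3 (axis 3 1) w $ 1 = - (w $ 2)" "cross3 (axis 3 1) w $ 2 = w $ 1" "cross3 (axis 3 1) w $ 3 = 0"
  by (simp_all add: cross3_def axis_def)

text \<open>For a constant vector a one has curl (a \<times> w) = (div w) a - (a . grad) w. Apply
  this to a = \<open>axis j 1\<close> and w = \<kappa> * v, whose divergence is the convolution of
  \<kappa> with \<open>g\<close> by \<open>conv_div\<close>.\<close>

lemma curl_conv_cross:
  assumes \<kappa>: "\<kappa> \<in> test_functions UNIV"
  shows "curl (conv \<kappa> (\<lambda>z. cross3 (axis j 1) (v z))) x =
    conv \<kappa> (\<lambda>z. g z *\<^sub>R axis j 1) x - conv (partial j \<kappa>) v x"
proof -
  let ?b = "\<lambda>z. cross3 (axis j 1) (v z)"
  define c where "c i l = conv (partial i \<kappa>) (\<lambda>z. v z $ l) x" for i l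
  have g: "conv \<kappa> g x = c 1 1 + c 2 2 + c 3 3"
    using conv_div[OF \<kappa>, of x] by (simp add: sum_3 c_def)
  have F: "partial i (conv \<kappa> ?b) x $ l = conv (partial i \<kappa>) (\<lambda>z. ?b z $ l) x" for i l
    using conv_component[OF cross_ext(2) test_functions_partial[OF \<kappa>]] by (simp add: partial_conv[OF \<kappa> cross_ext(2)])
  have ga: "conv \<kappa> (\<lambda>z. g z *\<^sub>R (axis j 1 :: real^3)) x $ l = (if l = j then conv \<kappa> g x else 0)" for l
    using conv_component[OF g_axis_ext(2) \<kappa>, of j x l] by (simp add: axis_def conv_zero_right if_distrib cong: if_cong)
  have vc: "conv (partial j \<kappa>) v x $ l = c j l" for l
    using conv_component[OF v_ext(2) test_functions_partial[OF \<kappa>]] by (simp add: c_def)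
  have curl: "curl (conv \<kappa> ?b) x =
     (partial 2 (conv \<kappa> ?b) x $ 3 - partial 3 (conv \<kappa> ?b) x $ 2) *\<^sub>R axis 1 1 +
     (partial 3 (conv \<kappa> ?b) x $ 1 - partial 1 (conv \<kappa> ?b) x $ 3) *\<^sub>R axis 2 1 +
     (partial 1 (conv \<kappa> ?b) x $ 2 - partial 2 (conv \<kappa> ?b) x $ 1) *\<^sub>R axis 3 1"
    by (rule curl_eq) (rule conv_differentiable[OF \<kappa> cross_ext(2)])
  have "curl (conv \<kappa> ?b) x $ l = conv \<kappa> (\<lambda>z. g z *\<^sub>R axis j 1) x $ l - conv (partial j \<kappa>) v x $ l" for l
    unfolding curl F ga vc g
    using exhaust_3[of j] exhaust_3[of l]
    by (auto simp: cross3_axis_component conv_uminus conv_zero_right c_def) (simp_all add: axis_def)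
  then show ?thesis by (simp add: vec_eq_iff)
qed

text \<open>The derivative of \<kappa> disappears: the divergence term is paired with
  \<open>E\<close> directly, and in the other term the curl passes to \<open>E\<close>. What remains
  are convolutions with \<kappa> itself, and Young's inequality costs only its L1 norm
  \<open>A\<close>.\<close>

lemma conv_derivative_bound:
  fixes E G :: "real^3 \<Rightarrow> real^3"
  assumes \<kappa>: "\<kappa> \<in> test_functions UNIV" "\<And>x. norm x > r \<Longrightarrow> \<kappa> x = 0"
    and A: "(\<integral>\<^sup>+x. ennreal \<bar>\<kappa> x\<bar> \<partial>lborel) \<le> ennreal A" "A \<ge> 0"
    and r: "(\<Union>z\<in>supp \<phi>. cball z r) \<subseteq> \<Omega>"
    and E: "E \<in> L2_on (lebesgue_on \<Omega>)" and G: "G \<in> L2_on (lebesgue_on \<Omega>)" and EG: "has_weak_curl \<Omega> E G"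
  shows "\<bar>ip_on (lebesgue_on \<Omega>) E (conv (partial j \<kappa>) v)\<bar> \<le>
    A * (sqrt (ip_on (lebesgue_on \<Omega>) E E) * sqrt (ip_on (lebesgue_on \<Omega>) g g) +
         sqrt (ip_on (lebesgue_on \<Omega>) G G) * sqrt (ip_on (lebesgue_on \<Omega>) v v))"
proof -
  let ?ip = "ip_on (lebesgue_on \<Omega>)"
  let ?b = "\<lambda>z. cross3 (axis j 1) (v z)" and ?a = "\<lambda>z. g z *\<^sub>R (axis j 1 :: real^3)"
  have tf: "conv k b \<in> test_functions \<Omega>"
    if "integrable lebesgue b" "\<And>z. z \<notin> supp \<phi> \<Longrightarrow> b z = 0" "k \<in> test_functions UNIV" "\<And>x. norm x > r \<Longrightarrow> k x = 0"
    for b :: "real^3 \<Rightarrow> real^3" and k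
    using conv_test_function[OF that(3,4,1,2) \<phi>D(3) r] .
  have tb: "conv \<kappa> ?b \<in> test_functions \<Omega>" by (rule tf[OF cross_ext(2) cross_zero \<kappa>])
  have ta: "conv \<kappa> ?a \<in> test_functions \<Omega>" by (rule tf[OF g_axis_ext(2) g_axis_zero \<kappa>])
  have norm: "conv \<kappa> b \<in> L2_on (lebesgue_on \<Omega>) \<and> sqrt (?ip (conv \<kappa> b) (conv \<kappa> b)) \<le> A * sqrt (?ip b b)"
    if b: "b \<in> L2_on lebesgue" "integrable lebesgue b" "ip_on lebesgue b b = ?ip b b" and t: "conv \<kappa> b \<in> test_functions \<Omega>"
    for b :: "real^3 \<Rightarrow> real^3"
  proof -
    have "ip_on lebesgue (conv \<kappa> b) (conv \<kappa> b) = ?ip (conv \<kappa> b) (conv \<kappa> b)"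
      using test_function_zero[OF t] by (intro ip_on_lebesgue[OF \<Omega>_sets]) auto
    then have "sqrt (?ip (conv \<kappa> b) (conv \<kappa> b)) \<le> sqrt (A\<^sup>2 * ?ip b b)"
      using Young_L2(2)[OF \<kappa>(1) A b(1,2)] b(3) by simp
    also have "\<dots> = A * sqrt (?ip b b)" using A(2) by (simp add: real_sqrt_mult)
    finally show ?thesis using L2_on_lebesgue_on[OF Young_L2(1)[OF \<kappa>(1) A b(1,2)] \<Omega>_sets] by simp
  qed
  note na = norm[OF g_axis_ext ta] and nb = norm[OF cross_ext tb]
  have cL: "curl (conv \<kappa> ?b) \<in> L2_on (lebesgue_on \<Omega>)"
    by (rule L2_on_lebesgue_on[OF curl_test_function_L2_on[OF tb] \<Omega>_sets])
  have "conv (partial j \<kappa>) v = lin_fun 1 (conv \<kappa> ?a) (-1) (curl (conv \<kappa> ?b))"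
    using curl_conv_cross[OF \<kappa>(1)] by (simp add: lin_fun_def fun_eq_iff)
  then have "?ip E (conv (partial j \<kappa>) v) = ?ip E (conv \<kappa> ?a) - ?ip E (curl (conv \<kappa> ?b))"
    using L2_on.ip_lin2[OF na[THEN conjunct1] cL E, of 1 "-1"] by simp
  \<comment> \<open>The definition of the weak curl applies because the convolution is supported
    within distance \<open>r\<close> of \<open>supp \<phi>\<close>, hence inside \<Omega>.\<close>
  also have "?ip E (curl (conv \<kappa> ?b)) = ?ip G (conv \<kappa> ?b)"
    using EG tb by (simp add: has_weak_curl_def L2_inner_eq)
  finally have "\<bar>?ip E (conv (partial j \<kappa>) v)\<bar> \<le> \<bar>?ip E (conv \<kappa> ?a)\<bar> + \<bar>?ip G (conv \<kappa> ?b)\<bar>"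
    by linarith
  also have "\<dots> \<le> sqrt (?ip E E) * sqrt (?ip (conv \<kappa> ?a) (conv \<kappa> ?a)) + sqrt (?ip G G) * sqrt (?ip (conv \<kappa> ?b) (conv \<kappa> ?b))"
    using na nb by (intro add_mono L2_on.Cauchy_Schwarz E G) auto
  also have "\<dots> \<le> sqrt (?ip E E) * (A * sqrt (?ip g g)) + sqrt (?ip G G) * (A * sqrt (?ip v v))"
  proof (intro add_mono mult_left_mono)
    show "sqrt (?ip (conv \<kappa> ?a) (conv \<kappa> ?a)) \<le> A * sqrt (?ip g g)" using na by (simp add: ip_g_axis)
    have "A * sqrt (?ip ?b ?b) \<le> A * sqrt (?ip v v)"
      using ip_cross_le A(2) by (intro mult_left_mono) auto
    then show "sqrt (?ip (conv \<kappa> ?b) (conv \<kappa> ?b)) \<le> A * sqrt (?ip v v)" using nb by linarith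
  qed (use L2_on.ip_nonneg[OF E] L2_on.ip_nonneg[OF G] in auto)
  finally show ?thesis by (simp add: algebra_simps)
qed

lemma conv_mollifier_diff:
  assumes "0 < d" "d \<le> e"
  shows "conv (mollifier e) v x - conv (mollifier d) v x = (\<Sum>j\<in>UNIV. conv (partial j (telescope_kernel e d j)) v x)"
proof -
  have e: "0 < e" using assms by simp
  have "(\<Sum>j\<in>UNIV. conv (partial j (telescope_kernel e d j)) v x)
      = (\<integral>z. (\<Sum>j\<in>UNIV. partial j (telescope_kernel e d j) (x - z) *\<^sub>R v z) \<partial>lebesgue)"
    unfolding conv_def
    by (rule Bochner_Integration.integral_sum[symmetric])
      (intro integrable_conv test_functions_partial telescope_kernel_test_function assms v_ext(2))
  also have "\<dots> = (\<integral>z. mollifier e (x - z) *\<^sub>R v z - mollifier d (x - z) *\<^sub>R v z \<partial>lebesgue)"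
    using sum_partial_telescope_kernel[OF assms(1) e] by (simp flip: scaleR_sum_left scaleR_diff_left)
  also have "\<dots> = conv (mollifier e) v x - conv (mollifier d) v x"
    unfolding conv_def
    by (intro Bochner_Integration.integral_diff integrable_conv mollifier_test_function e assms(1) v_ext(2))
  finally show ?thesis by simp
qed

text \<open>The bound for the difference of the scales \<open>e\<close> and \<open>d\<close> is the
  same for every \<open>d\<close>; an arbitrary \<epsilon> is then paid for replacing the
  convolution at scale \<open>d\<close> by \<open>v\<close>.\<close>

theorem mollification_error:
  fixes E G :: "real^3 \<Rightarrow> real^3"
  assumes e: "0 < e" "(\<Union>z\<in>supp \<phi>. cball z (3 * e)) \<subseteq> \<Omega>"
    and E: "E \<in> L2_on (lebesgue_on \<Omega>)" and G: "G \<in> L2_on (lebesgue_on \<Omega>)" and EG: "has_weak_curl \<Omega> E G"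
  shows "\<bar>ip_on (lebesgue_on \<Omega>) E (conv (mollifier e) v) - ip_on (lebesgue_on \<Omega>) E v\<bar> \<le>
    6 * e * (sqrt (ip_on (lebesgue_on \<Omega>) E E) * sqrt (ip_on (lebesgue_on \<Omega>) g g) +
         sqrt (ip_on (lebesgue_on \<Omega>) G G) * sqrt (ip_on (lebesgue_on \<Omega>) v v))" (is "_ \<le> 6 * e * ?K")
proof (rule field_le_epsilon)
  let ?ip = "ip_on (lebesgue_on \<Omega>)"
  fix \<epsilon> :: real assume \<epsilon>: "\<epsilon> > 0"
  \<comment> \<open>An L2 error \<open>s\<close>, paired with \<open>E\<close>, contributes at most
    \<epsilon>; the added 1 covers the case that \<open>E\<close> has norm zero.\<close>
  define s where "s = \<epsilon> / (sqrt (?ip E E) + 1)"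
  have nE: "0 \<le> sqrt (?ip E E)" using L2_on.ip_nonneg[OF E] by simp
  then have s: "s > 0" using \<epsilon> unfolding s_def by (intro divide_pos_pos add_nonneg_pos) auto
  obtain R where R: "\<And>z. z \<in> supp \<phi> \<Longrightarrow> norm z \<le> R"
    using compact_imp_bounded[OF \<phi>D(3)] by (auto simp: bounded_iff)
  have vR: "v z = 0" if "norm z > R" for z using R[of z] that v_zero[of z] by force
  obtain \<delta> where \<delta>: "\<delta> > 0" "\<And>d. 0 < d \<Longrightarrow> d < \<delta> \<Longrightarrow>
      conv (mollifier d) v \<in> L2_on lebesgue \<and> sqrt (L2_on.dsq lebesgue (conv (mollifier d) v) v) < s"
    using mollifier_L2[OF v_ext(1) vR s] by blast
  define d where "d = min e \<delta> / 2"
  have d: "0 < d" "d \<le> e" "d < \<delta>" using e \<delta>(1) by (auto simp: d_def)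
  have L: "conv (mollifier t) v \<in> L2_on (lebesgue_on \<Omega>)" if t: "0 < t" for t
  proof -
    have "(\<integral>\<^sup>+x. ennreal \<bar>mollifier t x\<bar> \<partial>lborel) \<le> ennreal 1"
      using nn_integral_mollifier[OF t] mollifier_nonneg[OF t] by simp
    from Young_L2(1)[OF mollifier_test_function[OF t] this zero_le_one v_ext(1,2)]
    show ?thesis by (rule L2_on_lebesgue_on[OF _ \<Omega>_sets])
  qed
  have sub: "(\<Union>z\<in>supp \<phi>. cball z (3 * d)) \<subseteq> \<Omega>" using e(2) d by force
  let ?\<kappa> = "telescope_kernel e d"
  note \<kappa> = telescope_kernel_test_function[OF d(1,2)] and \<kappa>0 = telescope_kernel_zero[OF d(1,2)]
  have T: "conv (partial j (?\<kappa> j)) v \<in> L2_on (lebesgue_on \<Omega>)" for j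
  proof -
    have "conv (partial j (?\<kappa> j)) v \<in> test_functions \<Omega>"
      by (rule conv_test_function[OF test_functions_partial[OF \<kappa>] partial_zero_far[OF \<kappa>0] v_ext(2) v_zero \<phi>D(3) e(2)])
    from L2_on_lebesgue_on[OF test_functions_L2_on[OF this] \<Omega>_sets] show ?thesis .
  qed
  have "?ip E (conv (mollifier e) v) - ?ip E (conv (mollifier d) v)
      = (\<integral>x. E x \<bullet> conv (mollifier e) v x - E x \<bullet> conv (mollifier d) v x \<partial>lebesgue_on \<Omega>)"
    unfolding ip_on_def
    by (intro Bochner_Integration.integral_diff[symmetric] integrable_inner_L2_on E L e(1) d(1))
  also have "\<dots> = (\<integral>x. (\<Sum>j\<in>UNIV. E x \<bullet> conv (partial j (?\<kappa> j)) v x) \<partial>lebesgue_on \<Omega>)"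
    using conv_mollifier_diff[OF d(1,2)] by (simp flip: inner_diff_right inner_sum_right)
  also have "\<dots> = (\<Sum>j\<in>UNIV. ?ip E (conv (partial j (?\<kappa> j)) v))"
    unfolding ip_on_def by (intro Bochner_Integration.integral_sum integrable_inner_L2_on E T)
  finally have "\<bar>?ip E (conv (mollifier e) v) - ?ip E (conv (mollifier d) v)\<bar> \<le> (\<Sum>j\<in>UNIV. \<bar>?ip E (conv (partial j (?\<kappa> j)) v)\<bar>)"
    by simp
  \<comment> \<open>Each of the three directions contributes the L1 bound \<open>2 * e\<close> of
    its kernel, which gives the factor \<open>6 * e\<close>.\<close>
  also have "\<dots> \<le> (\<Sum>j::3\<in>UNIV. 2 * e * ?K)"
    using e(1) by (intro sum_mono conv_derivative_bound[OF \<kappa> \<kappa>0 nn_integral_telescope_kernel[OF d(1,2)] _ e(2) E G EG]) simp_all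
  finally have 1: "\<bar>?ip E (conv (mollifier e) v) - ?ip E (conv (mollifier d) v)\<bar> \<le> 6 * e * ?K"
    by (simp add: sum_3)
  have t: "conv (mollifier d) v \<in> test_functions \<Omega>"
    by (rule conv_test_function[OF mollifier_test_function[OF d(1)] mollifier_zero[OF d(1)] v_ext(2) v_zero \<phi>D(3) sub])
  have "ip_on lebesgue a b = ?ip a b" if "a \<in> {conv (mollifier d) v, v}" for a b
    using that test_function_zero[OF t] v_zero outside by (intro ip_on_lebesgue[OF \<Omega>_sets]) auto
  then have "L2_on.dsq lebesgue (conv (mollifier d) v) v = L2_on.dsq (lebesgue_on \<Omega>) (conv (mollifier d) v) v"
    by (simp add: L2_on.dsq_def)
  then have close: "sqrt (L2_on.dsq (lebesgue_on \<Omega>) (conv (mollifier d) v) v) \<le> s"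
    using \<delta>(2)[OF d(1,3)] by simp
  have "\<bar>?ip E (conv (mollifier d) v) - ?ip E v\<bar> \<le> sqrt (L2_on.dsq (lebesgue_on \<Omega>) (conv (mollifier d) v) v) * sqrt (?ip E E)"
    using L2_on.ip_diff_le[OF L[OF d(1)] v_L2 E] L2_on.ip_sym[OF E L[OF d(1)]] L2_on.ip_sym[OF E v_L2] by simp
  also have "\<dots> \<le> s * (sqrt (?ip E E) + 1)"
    using close s nE by (intro mult_mono) auto
  also have "\<dots> = \<epsilon>" using nE by (simp add: s_def add_nonneg_eq_0_iff)
  finally show "\<bar>?ip E (conv (mollifier e) v) - ?ip E v\<bar> \<le> 6 * e * ?K + \<epsilon>" using 1 by linarith
qed

end

section \<open>Convergence of the products\<close>

lemma integral_norm_le_L2_on: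
  fixes b :: "'a::euclidean_space \<Rightarrow> 'b::euclidean_space"
  assumes b: "b \<in> L2_on lebesgue" and R: "\<And>z. norm z > R \<Longrightarrow> b z = 0"
  shows "(\<integral>z. norm (b z) \<partial>lebesgue) \<le> measure lebesgue (cball (0 :: 'a) R) + ip_on lebesgue b b"
proof -
  have ind: "integrable lebesgue (indicator (cball 0 R) :: 'a \<Rightarrow> real)"
    by (rule integrable_indicator_cball)
  have "norm (b z) \<le> indicator (cball 0 R) z + (norm (b z))\<^sup>2" for z
    by (rule norm_le_indicator_plus_square[OF R])
  then have "(\<integral>z. norm (b z) \<partial>lebesgue) \<le> (\<integral>z. indicator (cball 0 R) z + (norm (b z))\<^sup>2 \<partial>lebesgue)"
    using L2_on_lebesgue_integrable[OF b R] L2_onD(2)[OF b]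
    by (intro Bochner_Integration.integral_mono integrable_norm Bochner_Integration.integrable_add ind) auto
  also have "\<dots> = measure lebesgue (cball (0 :: 'a) R) + ip_on lebesgue b b"
    using ind L2_onD(2)[OF b] by (simp add: ip_on_def power2_norm_eq_inner)
  finally show ?thesis .
qed

text \<open>At a fixed point each component of the convolution is the inner product of
  \<open>Hn n\<close> with a fixed square integrable field, so it converges. The convolutions have a
  common bound and vanish outside a common ball, and dominated convergence upgrades this to
  L2.\<close>

lemma conv_weak_strong:
  fixes Hn :: "nat \<Rightarrow> real^3 \<Rightarrow> real^3"
  assumes \<Omega>: "open \<Omega>" and \<phi>: "\<phi> \<in> test_functions \<Omega>" and k: "k \<in> test_functions UNIV" "\<And>x. norm x > r \<Longrightarrow> k x = 0"
    and Hn: "\<And>n. Hn n \<in> L2_on (lebesgue_on \<Omega>)" "\<And>n. ip_on (lebesgue_on \<Omega>) (Hn n) (Hn n) \<le> B"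
    and H: "H \<in> L2_on (lebesgue_on \<Omega>)"
    and weak: "\<And>w. w \<in> L2_on (lebesgue_on \<Omega>) \<Longrightarrow> (\<lambda>n. ip_on (lebesgue_on \<Omega>) (Hn n) w) \<longlonglongrightarrow> ip_on (lebesgue_on \<Omega>) H w"
  shows "\<And>n. conv k (\<lambda>z. \<phi> z *\<^sub>R Hn n z) \<in> L2_on (lebesgue_on \<Omega>)"
    "conv k (\<lambda>z. \<phi> z *\<^sub>R H z) \<in> L2_on (lebesgue_on \<Omega>)"
    "(\<lambda>n. L2_on.dsq (lebesgue_on \<Omega>) (conv k (\<lambda>z. \<phi> z *\<^sub>R Hn n z)) (conv k (\<lambda>z. \<phi> z *\<^sub>R H z))) \<longlonglongrightarrow> 0"
proof -
  note \<phi>D = test_functionsD[OF \<phi>] and kD = test_functionsD[OF k(1)]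
  note \<Omega>s = open_sets_lebesgue[OF \<Omega>]
  let ?w = "\<lambda>H :: real^3 \<Rightarrow> real^3. conv k (\<lambda>z. \<phi> z *\<^sub>R H z)"
  obtain M where M: "M > 0" "\<And>x. norm (\<phi> x) \<le> M" using test_function_bounded[OF \<phi>] by blast
  obtain Mk where Mk: "Mk > 0" "\<And>x. norm (k x) \<le> Mk" using test_function_bounded[OF k(1)] by blast
  obtain R where R: "\<And>z. z \<in> supp \<phi> \<Longrightarrow> norm z \<le> R"
    using compact_imp_bounded[OF \<phi>D(3)] by (auto simp: bounded_iff)
  have \<phi>R: "\<phi> z = 0" if "norm z > R" for z using R[of z] that \<phi>D(4)[of z] by force
  define B' where "B' = max B (ip_on (lebesgue_on \<Omega>) H H)"
  have ext: "(\<lambda>z. \<phi> z *\<^sub>R F z) \<in> L2_on lebesgue" "integrable lebesgue (\<lambda>z. \<phi> z *\<^sub>R F z)"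
    "ip_on lebesgue (\<lambda>z. \<phi> z *\<^sub>R F z) (\<lambda>z. \<phi> z *\<^sub>R F z) \<le> M\<^sup>2 * B'"
    if F: "F \<in> L2_on (lebesgue_on \<Omega>)" "ip_on (lebesgue_on \<Omega>) F F \<le> B'" for F :: "real^3 \<Rightarrow> real^3"
  proof -
    have m: "\<phi> \<in> borel_measurable (lebesgue_on \<Omega>)"
      using measurable_restrict_space1[OF continuous_borel_lebesgue[OF \<phi>D(2)]] .
    have b: "\<bar>\<phi> x\<bar> \<le> M" for x using M(2)[of x] by simp
    have "(\<lambda>z. if z \<in> \<Omega> then \<phi> z *\<^sub>R F z else 0) = (\<lambda>z. \<phi> z *\<^sub>R F z)"
      using test_function_zero[OF \<phi>] by (auto simp: fun_eq_iff)
    then show L: "(\<lambda>z. \<phi> z *\<^sub>R F z) \<in> L2_on lebesgue"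
      using L2_on_zero_extension[OF L2_on_scale(1)[OF F(1) m b] \<Omega>s] by simp
    show "integrable lebesgue (\<lambda>z. \<phi> z *\<^sub>R F z)"
      by (rule L2_on_lebesgue_integrable[OF L, of R]) (simp add: \<phi>R)
    have "ip_on lebesgue (\<lambda>z. \<phi> z *\<^sub>R F z) (\<lambda>z. \<phi> z *\<^sub>R F z) = ip_on (lebesgue_on \<Omega>) (\<lambda>z. \<phi> z *\<^sub>R F z) (\<lambda>z. \<phi> z *\<^sub>R F z)"
      using test_function_zero[OF \<phi>] by (intro ip_on_lebesgue[OF \<Omega>s]) auto
    also have "\<dots> \<le> M\<^sup>2 * ip_on (lebesgue_on \<Omega>) F F" by (rule L2_on_scale(2)[OF F(1) m b])
    also have "\<dots> \<le> M\<^sup>2 * B'" by (intro mult_left_mono F) simp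
    finally show "ip_on lebesgue (\<lambda>z. \<phi> z *\<^sub>R F z) (\<lambda>z. \<phi> z *\<^sub>R F z) \<le> M\<^sup>2 * B'" .
  qed
  \<comment> \<open>Sup bound of the kernel times an L1 bound of the localized field, the latter
    from \<open>integral_norm_le_L2_on\<close>.\<close>
  define D where "D = Mk * (measure lebesgue (cball (0 :: real^3) R) + M\<^sup>2 * B')"
  have wD: "norm (?w F x) \<le> D" and wL: "?w F \<in> L2_on (lebesgue_on \<Omega>)" and w0: "norm x > R + r \<Longrightarrow> ?w F x = 0"
    if F: "F \<in> L2_on (lebesgue_on \<Omega>)" "ip_on (lebesgue_on \<Omega>) F F \<le> B'" for F x
  proof -
    note e = ext[OF F]
    have "norm (?w F x) \<le> (\<integral>z. Mk * norm (\<phi> z *\<^sub>R F z) \<partial>lebesgue)"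
      unfolding conv_def
    proof (rule Bochner_Integration.integral_norm_bound_integral)
      show "integrable lebesgue (\<lambda>z. k (x - z) *\<^sub>R (\<phi> z *\<^sub>R F z))" by (rule integrable_conv[OF k(1) e(2)])
      show "integrable lebesgue (\<lambda>z. Mk * norm (\<phi> z *\<^sub>R F z))"
        by (intro integrable_mult_right integrable_norm e(2))
      show "norm (k (x - z) *\<^sub>R (\<phi> z *\<^sub>R F z)) \<le> Mk * norm (\<phi> z *\<^sub>R F z)" for z
        unfolding norm_scaleR[of "k (x - z)"] using Mk(2)[of "x - z"] by (intro mult_right_mono) auto
    qed
    also have "\<dots> = Mk * (\<integral>z. norm (\<phi> z *\<^sub>R F z) \<partial>lebesgue)" by simp
    also have "\<dots> \<le> D"
      unfolding D_def using integral_norm_le_L2_on[OF e(1), of R] e(3) \<phi>R Mk(1) by (intro mult_left_mono) auto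
    finally show "norm (?w F x) \<le> D" .
    have kfin: "(\<integral>\<^sup>+x. ennreal \<bar>k x\<bar> \<partial>lborel) \<le> ennreal (\<integral>x. \<bar>k x\<bar> \<partial>lebesgue)"
    proof -
      have "k \<in> L2_on lebesgue" by (rule test_functions_L2_on[OF k(1)])
      from L2_on_lebesgue_integrable[OF this k(2)] have "integrable lebesgue k" .
      then have "(\<integral>\<^sup>+x. ennreal \<bar>k x\<bar> \<partial>lebesgue) = ennreal (\<integral>x. \<bar>k x\<bar> \<partial>lebesgue)"
        by (intro nn_integral_eq_integral) auto
      then show ?thesis by (simp add: nn_integral_completion)
    qed
    show "?w F \<in> L2_on (lebesgue_on \<Omega>)"
      by (rule L2_on_lebesgue_on[OF Young_L2(1)[OF k(1) kfin _ e(1,2)] \<Omega>s]) simp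
    show "?w F x = 0" if x: "norm x > R + r"
    proof (rule conv_zero_far[OF k(2), where K = "cball 0 R"])
      show "\<phi> z *\<^sub>R F z = 0" if "z \<notin> cball 0 R" for z using \<phi>R[of z] that by simp
      show "norm (x - z) > r" if "z \<in> cball 0 R" for z
        using x that norm_triangle_ineq2[of x z] by simp
    qed
  qed
  have HB: "ip_on (lebesgue_on \<Omega>) (Hn n) (Hn n) \<le> B'" "ip_on (lebesgue_on \<Omega>) H H \<le> B'" for n
    using Hn(2)[of n] by (auto simp: B'_def)
  show wn: "?w (Hn n) \<in> L2_on (lebesgue_on \<Omega>)" for n by (rule wL[OF Hn(1) HB(1)])
  show wH: "?w H \<in> L2_on (lebesgue_on \<Omega>)" by (rule wL[OF H HB(2)])
  \<comment> \<open>The kernel and the cut-off are gathered into one test field, which is what weak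
    convergence is tested with.\<close>
  have comp: "?w F x $ i = ip_on (lebesgue_on \<Omega>) F (\<lambda>z. (k (x - z) * \<phi> z) *\<^sub>R axis i 1)"
    if F: "F \<in> L2_on (lebesgue_on \<Omega>)" "ip_on (lebesgue_on \<Omega>) F F \<le> B'" for F x i
  proof -
    have "?w F x $ i = (\<integral>z. F z \<bullet> ((k (x - z) * \<phi> z) *\<^sub>R axis i 1) \<partial>lebesgue)"
      unfolding conv_component[OF ext(2)[OF F] k(1)]
      by (simp add: conv_def inner_axis mult.assoc)
    also have "\<dots> = ip_on (lebesgue_on \<Omega>) F (\<lambda>z. (k (x - z) * \<phi> z) *\<^sub>R axis i 1)"
      unfolding ip_on_def
      by (rule integral_lebesgue_on_zero_outside[OF \<Omega>s]) (simp add: test_function_zero[OF \<phi>])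
    finally show ?thesis .
  qed
  have pt: "(\<lambda>n. ?w (Hn n) x) \<longlonglongrightarrow> ?w H x" for x
  proof (rule vec_tendstoI)
    fix i
    have "(\<lambda>z. (k (x - z) * \<phi> z) *\<^sub>R (axis i 1 :: real^3)) \<in> L2_on lebesgue"
      by (rule continuous_supp_L2_on[OF _ \<phi>D(3)])
        (auto intro!: continuous_intros continuous_reflect kD(2) \<phi>D(2) simp: \<phi>D(4))
    from weak[OF L2_on_lebesgue_on[OF this \<Omega>s]]
    show "(\<lambda>n. ?w (Hn n) x $ i) \<longlonglongrightarrow> ?w H x $ i"
      by (simp only: comp[OF Hn(1) HB(1)] comp[OF H HB(2)])
  qed
  have "(\<lambda>n. \<integral>x. (norm (?w (Hn n) x - ?w H x))\<^sup>2 \<partial>lebesgue_on \<Omega>) \<longlonglongrightarrow> (\<integral>x. 0 \<partial>lebesgue_on \<Omega>)"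
  proof (rule integral_dominated_convergence)
    have "integrable (lebesgue_on UNIV) (indicator (cball 0 (R + r)) :: real^3 \<Rightarrow> real)"
      using integrable_indicator_cball by (simp add: lebesgue_on_UNIV_eq)
    from integrable_lebesgue_on_subset[OF this \<Omega>s]
    show "integrable (lebesgue_on \<Omega>) (\<lambda>x. (2 * D)\<^sup>2 * indicator (cball 0 (R + r)) x :: real)" by simp
    show "AE x in lebesgue_on \<Omega>. (\<lambda>n. (norm (?w (Hn n) x - ?w H x))\<^sup>2) \<longlonglongrightarrow> 0"
    proof (rule AE_I2)
      fix x
      have "(\<lambda>n. (norm (?w (Hn n) x - ?w H x))\<^sup>2) \<longlonglongrightarrow> (norm (?w H x - ?w H x))\<^sup>2"
        by (intro tendsto_intros pt)
      then show "(\<lambda>n. (norm (?w (Hn n) x - ?w H x))\<^sup>2) \<longlonglongrightarrow> 0" by simp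
    qed
    have "(norm (?w (Hn n) x - ?w H x))\<^sup>2 \<le> (2 * D)\<^sup>2 * indicator (cball 0 (R + r)) x" for n x
    proof (cases "norm x > R + r")
      case True
      then show ?thesis using w0[OF Hn(1) HB(1)] w0[OF H HB(2)] by simp
    next
      case False
      have "norm (?w (Hn n) x - ?w H x) \<le> 2 * D"
        using norm_triangle_ineq4[of "?w (Hn n) x" "?w H x"] wD[OF Hn(1) HB(1), of n x] wD[OF H HB(2), of x] by linarith
      then show ?thesis using False power_mono[of "norm (?w (Hn n) x - ?w H x)" "2 * D" 2] by (simp add: indicator_def)
    qed
    then show "AE x in lebesgue_on \<Omega>. norm ((norm (?w (Hn n) x - ?w H x))\<^sup>2) \<le> (2 * D)\<^sup>2 * indicator (cball 0 (R + r)) x" for n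
      by simp
  qed (use L2_onD(1)[OF wn] L2_onD(1)[OF wH] in measurable)
  then show "(\<lambda>n. L2_on.dsq (lebesgue_on \<Omega>) (?w (Hn n)) (?w H)) \<longlonglongrightarrow> 0"
    by (simp add: L2_on_dsq[OF wn wH])
qed

text \<open>The cut-off moves to the second field, because the mollification error is estimated for
  \<phi> H.\<close>

lemma L2_inner_scale: "L2_inner \<Omega> (\<lambda>x. \<phi> x *\<^sub>R E x) H = ip_on (lebesgue_on \<Omega>) E (\<lambda>x. \<phi> x *\<^sub>R H x)"
  by (simp add: L2_inner_eq ip_on_def)

text \<open>Three errors: replacing \<phi> H by its mollification for index \<open>n\<close> and for
  the limit, both at most \<open>e * C\<close> with \<open>C\<close> independent of
  \<open>n\<close>, and the convergence of the mollified products at fixed \<open>e\<close>, a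
  weakly times a strongly convergent sequence.\<close>

theorem div_curl_test_function:
  fixes En Hn :: "nat \<Rightarrow> real^3 \<Rightarrow> real^3"
  assumes \<Omega>: "open \<Omega>" and \<phi>: "\<phi> \<in> test_functions \<Omega>"
    and En: "\<And>n. En n \<in> D_curl \<Omega>" "\<And>n. D_curl_inner \<Omega> (En n) (En n) \<le> B"
    and Hn: "\<And>n. Hn n \<in> D_div \<Omega>" "\<And>n. D_div_inner \<Omega> (Hn n) (Hn n) \<le> B"
    and E: "E \<in> L2 \<Omega>" "weakly_converges (L2 \<Omega>) (L2_inner \<Omega>) En E"
    and H: "H \<in> L2 \<Omega>" "weakly_converges (L2 \<Omega>) (L2_inner \<Omega>) Hn H"
  shows "(\<lambda>n. L2_inner \<Omega> (\<lambda>x. \<phi> x *\<^sub>R En n x) (Hn n)) \<longlonglongrightarrow> L2_inner \<Omega> (\<lambda>x. \<phi> x *\<^sub>R E x) H"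
proof -
  let ?ip = "ip_on (lebesgue_on \<Omega>)"
  note Ed = D_curl_weak_limit(1)[OF \<Omega> En E] and Hd = D_div_weak_limit(1)[OF \<Omega> Hn H]
  have Bs: "\<exists>B'. (\<forall>n. D_curl_inner \<Omega> (En n) (En n) \<le> B' \<and> D_div_inner \<Omega> (Hn n) (Hn n) \<le> B') \<and>
    D_curl_inner \<Omega> E E \<le> B' \<and> D_div_inner \<Omega> H H \<le> B'"
    using En(2) Hn(2)
    by (intro exI[of _ "max B (max (D_curl_inner \<Omega> E E) (D_div_inner \<Omega> H H))"]) (auto simp: le_max_iff_disj)
  then obtain B' where B': "\<And>n. D_curl_inner \<Omega> (En n) (En n) \<le> B'" "\<And>n. D_div_inner \<Omega> (Hn n) (Hn n) \<le> B'"
    "D_curl_inner \<Omega> E E \<le> B'" "D_div_inner \<Omega> H H \<le> B'" by blast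
  obtain r where r: "r > 0" "(\<Union>z\<in>supp \<phi>. cball z r) \<subseteq> \<Omega>"
    using compact_subset_open_imp_cball_epsilon_subset[OF test_functionsD(3)[OF \<phi>] \<Omega> test_functionsD(5)[OF \<phi>]] by blast
  have "\<exists>C>0. \<forall>E H e. E \<in> D_curl \<Omega> \<longrightarrow> H \<in> D_div \<Omega> \<longrightarrow> D_curl_inner \<Omega> E E \<le> B' \<longrightarrow> D_div_inner \<Omega> H H \<le> B' \<longrightarrow>
     0 < e \<longrightarrow> 3 * e \<le> r \<longrightarrow> \<bar>?ip E (conv (mollifier e) (\<lambda>z. \<phi> z *\<^sub>R H z)) - ?ip E (\<lambda>z. \<phi> z *\<^sub>R H z)\<bar> \<le> e * C"
  proof -
    \<comment> \<open>Zero fields suffice to extract the bounds of \<phi> and its gradient, so that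
      \<open>M\<close> is fixed before \<open>H\<close> is.\<close>
    interpret \<phi>0: localized_fields \<Omega> \<phi> "\<lambda>_. 0" "\<lambda>_. 0"
      by unfold_locales (use \<Omega> \<phi> in \<open>auto simp: L2_on_def has_weak_div_def L2_inner_eq ip_on_def\<close>)
    obtain M where M: "M > 0" "\<And>z. \<bar>\<phi> z\<bar> \<le> M" "\<And>z. norm (grad \<phi> z) \<le> M" using \<phi>0.ex_bounds by blast
    \<comment> \<open>Bounds for the norms of \<open>E\<close>, \<open>g\<close>, the curl and
      \<open>v\<close>, in this order; the 4 is the factor 2 of \<open>ip_g_le\<close> times the two
      summands bounded by \<open>B'\<close>.\<close>
    define K where "K = sqrt B' * sqrt (4 * M\<^sup>2 * B') + sqrt B' * sqrt (M\<^sup>2 * B')"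
    have main: "\<bar>?ip E (conv (mollifier e) (\<lambda>z. \<phi> z *\<^sub>R H z)) - ?ip E (\<lambda>z. \<phi> z *\<^sub>R H z)\<bar> \<le> e * (6 * \<bar>K\<bar> + 1)"
      if E: "E \<in> D_curl \<Omega>" "D_curl_inner \<Omega> E E \<le> B'" and H: "H \<in> D_div \<Omega>" "D_div_inner \<Omega> H H \<le> B'"
        and e: "0 < e" "3 * e \<le> r" for E H e
    proof -
      note ED = D_curlD[OF \<Omega> E(1), unfolded L2_eq L2_inner_eq] and HD = D_divD[OF \<Omega> H(1), unfolded L2_eq L2_inner_eq]
      interpret L: localized_fields \<Omega> \<phi> H "weak_div \<Omega> H"
        by unfold_locales (use \<Omega> \<phi> HD in auto)
      have v: "L.v = (\<lambda>z. \<phi> z *\<^sub>R H z)" by (simp add: L.v_def[abs_def])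
      have sub: "(\<Union>z\<in>supp \<phi>. cball z (3 * e)) \<subseteq> \<Omega>" using r(2) e(2) by force
      have b1: "?ip E E \<le> B'" "?ip (weak_curl \<Omega> E) (weak_curl \<Omega> E) \<le> B'" using ED(4,5) E(2) by linarith+
      have b2: "?ip H H \<le> B'" "?ip (weak_div \<Omega> H) (weak_div \<Omega> H) \<le> B'" using HD(4,5) H(2) by linarith+
      have "?ip L.g L.g \<le> 2 * M\<^sup>2 * (?ip (weak_div \<Omega> H) (weak_div \<Omega> H) + ?ip H H)" by (rule L.ip_g_le[OF M(2,3)])
      also have "\<dots> \<le> 2 * M\<^sup>2 * (B' + B')" by (intro mult_left_mono add_mono b2) simp
      finally have bg: "?ip L.g L.g \<le> 4 * M\<^sup>2 * B'" by simp
      have "?ip L.v L.v \<le> M\<^sup>2 * ?ip H H" by (rule L.ip_v_le[OF M(2)])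
      also have "\<dots> \<le> M\<^sup>2 * B'" by (intro mult_left_mono b2) simp
      finally have bv: "?ip L.v L.v \<le> M\<^sup>2 * B'" .
      have B0: "0 \<le> B'" using b1(1) L2_on.ip_nonneg[OF ED(1)] by linarith
      have "sqrt (?ip E E) * sqrt (?ip L.g L.g) + sqrt (?ip (weak_curl \<Omega> E) (weak_curl \<Omega> E)) * sqrt (?ip L.v L.v) \<le> K"
        unfolding K_def using b1 bg bv L2_on.ip_nonneg[OF L.g_L2] L2_on.ip_nonneg[OF L.v_L2] B0
        by (intro add_mono mult_mono real_sqrt_le_mono) auto
      then have "6 * e * (sqrt (?ip E E) * sqrt (?ip L.g L.g) + sqrt (?ip (weak_curl \<Omega> E) (weak_curl \<Omega> E)) * sqrt (?ip L.v L.v)) \<le> 6 * e * (\<bar>K\<bar> + 1/6)"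
        using e(1) by (intro mult_left_mono) auto
      then show ?thesis
        using L.mollification_error[OF e(1) sub ED(1,2,3)] unfolding v by (simp add: algebra_simps)
    qed
    show ?thesis by (rule exI[of _ "6 * \<bar>K\<bar> + 1"]) (use main in auto)
  qed
  then obtain C where C: "C > 0"
    and est: "\<And>E H e. E \<in> D_curl \<Omega> \<Longrightarrow> H \<in> D_div \<Omega> \<Longrightarrow> D_curl_inner \<Omega> E E \<le> B' \<Longrightarrow> D_div_inner \<Omega> H H \<le> B' \<Longrightarrow>
     0 < e \<Longrightarrow> 3 * e \<le> r \<Longrightarrow> \<bar>?ip E (conv (mollifier e) (\<lambda>z. \<phi> z *\<^sub>R H z)) - ?ip E (\<lambda>z. \<phi> z *\<^sub>R H z)\<bar> \<le> e * C"
    by blast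
  note EnD = D_curlD[OF \<Omega> En(1), unfolded L2_eq L2_inner_eq] and HnD = D_divD[OF \<Omega> Hn(1), unfolded L2_eq L2_inner_eq]
  note E' = E[unfolded weakly_converges_def L2_eq L2_inner_eq, rule_format]
    and H' = H[unfolded weakly_converges_def L2_eq L2_inner_eq, rule_format]
  have Eb: "?ip (En n) (En n) \<le> B'" and Hb: "?ip (Hn n) (Hn n) \<le> B'" for n
    using EnD(4)[of n] HnD(4)[of n] B'(1,2)[of n] by linarith+
  show ?thesis
    unfolding L2_inner_scale
  proof (rule LIMSEQ_I)
    fix \<epsilon> :: real assume \<epsilon>: "\<epsilon> > 0"
    \<comment> \<open>The first entry keeps the balls of radius \<open>3 * e\<close> inside
      \<Omega>; the second gives \<open>e * C\<close> at most \<epsilon>/6, hence strictly below a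
      third.\<close>
    define e where "e = min (r / 3) (\<epsilon> / (3 * C) / 2)"
    have e: "0 < e" "3 * e \<le> r" using r(1) \<epsilon> C by (auto simp: e_def)
    have "e \<le> \<epsilon> / (3 * C) / 2" by (simp add: e_def)
    then have eC: "e * C < \<epsilon> / 3" using C \<epsilon> by (simp add: field_simps)
    let ?k = "mollifier e"
    note cw = conv_weak_strong[OF \<Omega> \<phi> mollifier_test_function[OF e(1)] mollifier_zero[OF e(1)] HnD(1) Hb H'(1,2)]
    have lim: "(\<lambda>n. ?ip (En n) (conv ?k (\<lambda>z. \<phi> z *\<^sub>R Hn n z))) \<longlonglongrightarrow> ?ip E (conv ?k (\<lambda>z. \<phi> z *\<^sub>R H z))"
      by (rule L2_on.tendsto_weak_strong[OF EnD(1) Eb E'(1) E'(2) cw])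
    have \<epsilon>3: "\<epsilon> / 3 > 0" using \<epsilon> by simp
    obtain N where N: "\<And>n. n \<ge> N \<Longrightarrow>
        norm (?ip (En n) (conv ?k (\<lambda>z. \<phi> z *\<^sub>R Hn n z)) - ?ip E (conv ?k (\<lambda>z. \<phi> z *\<^sub>R H z))) < \<epsilon> / 3"
      using LIMSEQ_D[OF lim \<epsilon>3] by blast
    have "norm (?ip (En n) (\<lambda>z. \<phi> z *\<^sub>R Hn n z) - ?ip E (\<lambda>z. \<phi> z *\<^sub>R H z)) < \<epsilon>" if "n \<ge> N" for n
      using N[OF that] est[OF En(1) Hn(1) B'(1,2) e, of n n] est[OF Ed Hd B'(3,4) e] eC
      unfolding real_norm_def by linarith
    then show "\<exists>N. \<forall>n\<ge>N. norm (?ip (En n) (\<lambda>z. \<phi> z *\<^sub>R Hn n z) - ?ip E (\<lambda>z. \<phi> z *\<^sub>R H z)) < \<epsilon>" by blast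
  qed
qed

text \<open>Changing the cut-off by at most \<eta> everywhere changes every product by at most
  \<open>\<eta> * B'\<close>, uniformly in \<open>n\<close>. A mollified \<phi> is a test function
  as close as desired, so continuity and compact support in \<Omega> are enough for all three
  classes of cut-offs.\<close>

theorem div_curl_continuous:
  fixes En Hn :: "nat \<Rightarrow> real^3 \<Rightarrow> real^3"
  assumes \<Omega>: "open \<Omega>"
    and \<phi>: "continuous_on UNIV \<phi>" "compact K" "K \<subseteq> \<Omega>" "\<And>x. x \<notin> K \<Longrightarrow> \<phi> x = 0"
    and En: "\<And>n. En n \<in> D_curl \<Omega>" "\<And>n. D_curl_inner \<Omega> (En n) (En n) \<le> B"
    and Hn: "\<And>n. Hn n \<in> D_div \<Omega>" "\<And>n. D_div_inner \<Omega> (Hn n) (Hn n) \<le> B"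
    and E: "E \<in> L2 \<Omega>" "weakly_converges (L2 \<Omega>) (L2_inner \<Omega>) En E"
    and H: "H \<in> L2 \<Omega>" "weakly_converges (L2 \<Omega>) (L2_inner \<Omega>) Hn H"
  shows "(\<lambda>n. L2_inner \<Omega> (\<lambda>x. \<phi> x *\<^sub>R En n x) (Hn n)) \<longlonglongrightarrow> L2_inner \<Omega> (\<lambda>x. \<phi> x *\<^sub>R E x) H"
proof -
  let ?ip = "ip_on (lebesgue_on \<Omega>)"
  note EnD = D_curlD[OF \<Omega> En(1), unfolded L2_eq L2_inner_eq] and HnD = D_divD[OF \<Omega> Hn(1), unfolded L2_eq L2_inner_eq]
  define B' where "B' = max B (max (?ip E E) (?ip H H))"
  have Eb: "?ip (En n) (En n) \<le> B'" and Hb: "?ip (Hn n) (Hn n) \<le> B'" for n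
    using EnD(4)[of n] HnD(4)[of n] En(2)[of n] Hn(2)[of n] by (auto simp: B'_def le_max_iff_disj)
  have EHb: "?ip E E \<le> B'" "?ip H H \<le> B'" by (auto simp: B'_def)
  have B0: "0 \<le> B'" using Eb[of 0] L2_on.ip_nonneg[OF EnD(1)[of 0]] by linarith
  obtain r where r: "r > 0" "(\<Union>z\<in>K. cball z r) \<subseteq> \<Omega>"
    using compact_subset_open_imp_cball_epsilon_subset[OF \<phi>(2) \<Omega> \<phi>(3)] by blast
  obtain R where R: "\<And>z. z \<in> K \<Longrightarrow> norm z \<le> R"
    using compact_imp_bounded[OF \<phi>(2)] by (auto simp: bounded_iff)
  have \<phi>R: "\<phi> z = 0" if "norm z > R" for z using R[of z] that \<phi>(4)[of z] by force
  have \<phi>L: "\<phi> \<in> L2_on lebesgue" by (rule continuous_supp_L2_on[OF \<phi>(1,2,4)])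
  have \<phi>i: "integrable lebesgue \<phi>" by (rule L2_on_lebesgue_integrable[OF \<phi>L \<phi>R])
  show ?thesis
  proof (rule LIMSEQ_I)
    fix \<epsilon> :: real assume \<epsilon>: "\<epsilon> > 0"
    \<comment> \<open>Makes \<open>\<eta> * B'\<close> at most \<epsilon>/4; the added 1 admits
      \<open>B' = 0\<close>.\<close>
    define \<eta> where "\<eta> = \<epsilon> / 4 / (B' + 1)"
    have \<eta>: "\<eta> > 0" using \<epsilon> B0 by (simp add: \<eta>_def)
    have "\<eta> * B' \<le> \<eta> * (B' + 1)" using \<eta> by (intro mult_left_mono) auto
    also have "\<dots> = \<epsilon> / 4"
      using B0 by (intro iffD1[OF nonzero_eq_divide_eq \<eta>_def]) simp
    finally have \<eta>B: "\<eta> * B' < \<epsilon> / 3" using \<epsilon> by linarith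
    obtain \<delta> where \<delta>: "\<delta> > 0" "\<And>e x. 0 < e \<Longrightarrow> e < \<delta> \<Longrightarrow> norm (conv (mollifier e) \<phi> x - \<phi> x) \<le> \<eta>"
      using mollifier_uniform[OF \<phi>(1) \<phi>R \<eta>] by blast
    define e where "e = min \<delta> r / 4"
    have e: "0 < e" "e < \<delta>" "3 * e \<le> r" using \<delta>(1) r(1) by (auto simp: e_def)
    define \<psi> where "\<psi> = conv (mollifier e) \<phi>"
    have sub: "(\<Union>z\<in>K. cball z (3 * e)) \<subseteq> \<Omega>" using r(2) e(3) by force
    have \<psi>: "\<psi> \<in> test_functions \<Omega>"
      unfolding \<psi>_def
      by (rule conv_test_function[where K = K and r = "3 * e"])
        (use mollifier_test_function[OF e(1)] mollifier_zero[OF e(1)] \<phi>i \<phi>(2,4) sub in auto)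
    have close: "\<bar>\<phi> x - \<psi> x\<bar> \<le> \<eta>" for x
      using \<delta>(2)[OF e(1,2), of x] by (simp add: \<psi>_def abs_minus_commute)
    have m: "\<phi> \<in> borel_measurable (lebesgue_on \<Omega>)" "\<psi> \<in> borel_measurable (lebesgue_on \<Omega>)"
      using measurable_restrict_space1[OF continuous_borel_lebesgue[OF \<phi>(1)]]
        measurable_restrict_space1[OF continuous_borel_lebesgue[OF test_functionsD(2)[OF \<psi>]]] by auto
    obtain M1 where M1: "\<And>x. \<bar>\<phi> x\<bar> \<le> M1" using bounded_compact_supp[OF \<phi>(1,2,4)] by auto
    obtain M2 where M2: "\<And>x. \<bar>\<psi> x\<bar> \<le> M2" using test_function_bounded[OF \<psi>] by auto
    have err: "\<bar>?ip F (\<lambda>x. \<phi> x *\<^sub>R G x) - ?ip F (\<lambda>x. \<psi> x *\<^sub>R G x)\<bar> \<le> \<eta> * B'"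
      if F: "F \<in> L2_on (lebesgue_on \<Omega>)" "?ip F F \<le> B'" and G: "G \<in> L2_on (lebesgue_on \<Omega>)" "?ip G G \<le> B'"
      for F G :: "real^3 \<Rightarrow> real^3"
    proof -
      have d: "(\<lambda>x. \<phi> x - \<psi> x) \<in> borel_measurable (lebesgue_on \<Omega>)" using m by measurable
      note D = L2_on_scale[OF G(1) d close]
      have "?ip F (\<lambda>x. \<phi> x *\<^sub>R G x) - ?ip F (\<lambda>x. \<psi> x *\<^sub>R G x) = ?ip F (\<lambda>x. (\<phi> x - \<psi> x) *\<^sub>R G x)"
        using integrable_inner_L2_on[OF F(1) L2_on_scale(1)[OF G(1) m(1) M1]]
          integrable_inner_L2_on[OF F(1) L2_on_scale(1)[OF G(1) m(2) M2]]
        by (simp add: ip_on_def left_diff_distrib)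
      also have "\<bar>\<dots>\<bar> \<le> sqrt (?ip F F) * sqrt (?ip (\<lambda>x. (\<phi> x - \<psi> x) *\<^sub>R G x) (\<lambda>x. (\<phi> x - \<psi> x) *\<^sub>R G x))"
        by (rule L2_on.Cauchy_Schwarz[OF F(1) D(1)])
      also have "\<dots> \<le> sqrt B' * sqrt (\<eta>\<^sup>2 * B')"
      proof (intro mult_mono real_sqrt_le_mono F)
        have "\<eta>\<^sup>2 * ?ip G G \<le> \<eta>\<^sup>2 * B'" by (intro mult_left_mono G) simp
        with D(2) show "?ip (\<lambda>x. (\<phi> x - \<psi> x) *\<^sub>R G x) (\<lambda>x. (\<phi> x - \<psi> x) *\<^sub>R G x) \<le> \<eta>\<^sup>2 * B'" by linarith
      qed (use B0 L2_on.ip_nonneg[OF D(1)] in auto)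
      also have "\<dots> = \<eta> * B'" using \<eta> B0 by (simp add: real_sqrt_mult)
      finally show ?thesis .
    qed
    have \<epsilon>3: "\<epsilon> / 3 > 0" using \<epsilon> by simp
    note lim = div_curl_test_function[OF \<Omega> \<psi> En Hn E H, unfolded L2_inner_scale]
    obtain N where N: "\<And>n. n \<ge> N \<Longrightarrow> norm (?ip (En n) (\<lambda>x. \<psi> x *\<^sub>R Hn n x) - ?ip E (\<lambda>x. \<psi> x *\<^sub>R H x)) < \<epsilon> / 3"
      using LIMSEQ_D[OF lim \<epsilon>3] by blast
    have "norm (L2_inner \<Omega> (\<lambda>x. \<phi> x *\<^sub>R En n x) (Hn n) - L2_inner \<Omega> (\<lambda>x. \<phi> x *\<^sub>R E x) H) < \<epsilon>" if "n \<ge> N" for n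
      using N[OF that] err[OF EnD(1) Eb HnD(1) Hb, of n n] err[OF E(1)[unfolded L2_eq] EHb(1) H(1)[unfolded L2_eq] EHb(2)] \<eta>B
      unfolding L2_inner_scale real_norm_def by linarith
    then show "\<exists>N. \<forall>n\<ge>N. norm (L2_inner \<Omega> (\<lambda>x. \<phi> x *\<^sub>R En n x) (Hn n) - L2_inner \<Omega> (\<lambda>x. \<phi> x *\<^sub>R E x) H) < \<epsilon>" by blast
  qed
qed

section \<open>Cut-off functions and local spaces\<close>

text \<open>The support of \<open>p\<close> avoids the boundary but may have pieces in the exterior
  of \<Omega>, so \<open>p\<close> itself need not be compactly supported in \<Omega>. Its part in
  \<Omega> equals its part in the closure, hence is compact, and setting \<open>p\<close> to zero
  outside \<Omega> creates no discontinuity.\<close>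

lemma cutoff_extension:
  fixes \<Omega> :: "(real^'n) set"
  assumes \<Omega>: "open \<Omega>" and \<phi>: "\<phi> \<in> cutoff P (frontier \<Omega>) \<Omega>" and P: "\<And>p. P p \<Longrightarrow> continuous_on UNIV p"
  obtains q K where "continuous_on UNIV q" "compact K" "K \<subseteq> \<Omega>" "\<And>x. x \<notin> K \<Longrightarrow> q x = 0" "\<And>x. x \<in> \<Omega> \<Longrightarrow> \<phi> x = q x"
proof -
  obtain p where p: "\<phi> = restrict p \<Omega>" "P p" "compact (supp p)" "pos_dist (supp p) (frontier \<Omega>)"
    using \<phi> by (auto simp: cutoff_def)
  have "supp p \<inter> frontier \<Omega> = {}"
    using p(4) unfolding pos_dist_def by (metis disjoint_iff dist_self not_le)
  then have K: "supp p \<inter> \<Omega> = supp p \<inter> closure \<Omega>"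
    using closure_subset[of \<Omega>] by (auto simp: frontier_def interior_open[OF \<Omega>])
  have cK: "compact (supp p \<inter> \<Omega>)" unfolding K by (intro compact_Int_closed p) simp
  define q where "q x = (if x \<in> \<Omega> then p x else 0)" for x
  have q0: "q x = 0" if "x \<notin> supp p \<inter> \<Omega>" for x using that by (auto simp: q_def not_in_supp)
  have "continuous_on (\<Omega> \<union> - (supp p \<inter> \<Omega>)) q"
  proof (rule continuous_on_open_Un[OF \<Omega>])
    show "open (- (supp p \<inter> \<Omega>))" using compact_imp_closed[OF cK] by (rule open_Compl)
    have "continuous_on \<Omega> p" using P[OF p(2)] continuous_on_subset by blast
    then show "continuous_on \<Omega> q" by (rule continuous_on_eq) (simp add: q_def)
    show "continuous_on (- (supp p \<inter> \<Omega>)) q"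
      by (rule continuous_on_eq[OF continuous_on_const[of _ 0]]) (use q0 in auto)
  qed
  moreover have "\<Omega> \<union> - (supp p \<inter> \<Omega>) = UNIV" by blast
  ultimately have "continuous_on UNIV q" by simp
  then show ?thesis by (rule that[OF _ cK Int_lower2 q0]) (auto simp: p(1) q_def)
qed

lemma cutoffs_extension:
  assumes "open \<Omega>" "\<phi> \<in> C_inf_cutoff (frontier \<Omega>) \<Omega> \<union> C1_cutoff (frontier \<Omega>) \<Omega> \<union> Lip_cutoff (frontier \<Omega>) \<Omega>"
  obtains q K where "continuous_on UNIV q" "compact K" "K \<subseteq> \<Omega>" "\<And>x. x \<notin> K \<Longrightarrow> q x = 0" "\<And>x. x \<in> \<Omega> \<Longrightarrow> \<phi> x = q x"
proof -
  have "\<exists>P. \<phi> \<in> cutoff P (frontier \<Omega>) \<Omega> \<and> (\<forall>p. P p \<longrightarrow> continuous_on UNIV p)"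
    using assms(2) unfolding C_inf_cutoff_def C1_cutoff_def Lip_cutoff_def
  proof (elim UnE)
    assume "\<phi> \<in> cutoff smooth (frontier \<Omega>) \<Omega>"
    then show ?thesis using smooth_continuous by blast
  next
    assume "\<phi> \<in> cutoff (Ck 1) (frontier \<Omega>) \<Omega>"
    then show ?thesis using Ck_continuous by blast
  next
    assume "\<phi> \<in> cutoff (\<lambda>\<phi>. \<exists>L. L-lipschitz_on UNIV \<phi>) (frontier \<Omega>) \<Omega>"
    then show ?thesis using lipschitz_on_continuous_on by blast
  qed
  then obtain P where P: "\<phi> \<in> cutoff P (frontier \<Omega>) \<Omega>" "\<And>p. P p \<Longrightarrow> continuous_on UNIV p" by blast
  show thesis by (rule cutoff_extension[OF assms(1) P]) (assumption, rule that)
qed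

text \<open>The integrand lives on \<open>K\<close>, so any open set between \<open>K\<close> and
  \<Omega> gives the same value; this reduces the local statement to one set \<omega>.\<close>

lemma L2_inner_cutoff:
  assumes "open \<Omega>" "open \<omega>" "K \<subseteq> \<omega>" "\<omega> \<subseteq> \<Omega>" "\<And>x. x \<notin> K \<Longrightarrow> q x = 0" "\<And>x. x \<in> \<Omega> \<Longrightarrow> \<phi> x = q x"
  shows "L2_inner \<Omega> (\<lambda>x. \<phi> x *\<^sub>R E x) H = L2_inner \<omega> (\<lambda>x. q x *\<^sub>R E x) H"
proof -
  have "L2_inner \<Omega> (\<lambda>x. \<phi> x *\<^sub>R E x) H = L2_inner \<Omega> (\<lambda>x. q x *\<^sub>R E x) H"
    unfolding L2_inner_def by (rule Bochner_Integration.integral_cong) (auto simp: assms(6) space_restrict_space)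
  also have "\<dots> = L2_inner \<omega> (\<lambda>x. q x *\<^sub>R E x) H"
    unfolding L2_inner_eq
    by (rule ip_on_superset) (use assms in \<open>auto simp: open_sets_lebesgue\<close>)
  finally show ?thesis .
qed

section \<open>Exhaustion by relatively compact sets and local sequences\<close>

text \<open>Interiors of a compact exhaustion, shifted by one: \<open>C n\<close> lies in the
  interior of \<open>C (Suc n)\<close>, so compact subsets of \<Omega> are still absorbed.\<close>

lemma compactly_inside_exhaustion:
  fixes \<Omega> :: "'a::euclidean_space set"
  assumes "open \<Omega>"
  obtains W :: "nat \<Rightarrow> 'a set" where "\<And>n. W n \<in> compactly_inside \<Omega>" "\<And>K. compact K \<Longrightarrow> K \<subseteq> \<Omega> \<Longrightarrow> \<exists>N. \<forall>n\<ge>N. K \<subseteq> W n"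
proof (rule open_Union_compact_subsets[OF assms])
  fix C :: "nat \<Rightarrow> 'a set"
  assume C: "\<And>n. compact (C n)" "\<And>n. C n \<subseteq> \<Omega>" "\<And>n. C n \<subseteq> interior (C (Suc n))"
    and K: "\<And>K. \<lbrakk>compact K; K \<subseteq> \<Omega>\<rbrakk> \<Longrightarrow> \<exists>N. \<forall>n\<ge>N. K \<subseteq> C n"
  show thesis
  proof (rule that[of "\<lambda>n. interior (C (Suc n))"])
    fix n
    have sub: "closure (interior (C (Suc n))) \<subseteq> C (Suc n)"
      using closure_minimal[OF interior_subset compact_imp_closed[OF C(1)]] .
    have "closure (interior (C (Suc n))) = closure (interior (C (Suc n))) \<inter> C (Suc n)" using sub by blast
    then have "compact (closure (interior (C (Suc n))))"
      using closed_Int_compact[OF closed_closure C(1)] by metis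
    then show "interior (C (Suc n)) \<in> compactly_inside \<Omega>"
      using sub C(2)[of "Suc n"] by (auto simp: compactly_inside_def)
  next
    fix K :: "'a set" assume "compact K" "K \<subseteq> \<Omega>"
    then obtain N where "\<forall>n\<ge>N. K \<subseteq> C n" using K by blast
    then have "\<forall>n\<ge>N. K \<subseteq> interior (C (Suc n))" using C(3) by blast
    then show "\<exists>N. \<forall>n\<ge>N. K \<subseteq> interior (C (Suc n))" by blast
  qed
qed

lemma compactly_insideD: "\<omega> \<in> compactly_inside \<Omega> \<Longrightarrow> open \<omega>" "\<omega> \<in> compactly_inside \<Omega> \<Longrightarrow> compact (closure \<omega>)"
  "\<omega> \<in> compactly_inside \<Omega> \<Longrightarrow> closure \<omega> \<subseteq> \<Omega>" "\<omega> \<in> compactly_inside \<Omega> \<Longrightarrow> \<omega> \<subseteq> \<Omega>"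
  using closure_subset[of \<omega>] by (auto simp: compactly_inside_def)

lemma norm_boundedD:
  assumes "norm_bounded ip u" "\<And>n. 0 \<le> ip (u n) (u n)"
  obtains B where "\<And>n. ip (u n) (u n) \<le> B"
proof -
  obtain C where C: "\<And>n. sqrt (ip (u n) (u n)) \<le> C" using assms(1) by (auto simp: norm_bounded_def)
  have "ip (u n) (u n) \<le> C\<^sup>2" for n
    using power_mono[OF C[of n], of 2] assms(2)[of n] by simp
  then show ?thesis using that by blast
qed

lemma D_curl_inner_nonneg: "0 \<le> D_curl_inner \<Omega> E E"
  by (simp add: D_curl_inner_def L2_inner_def)

lemma D_div_inner_nonneg: "0 \<le> D_div_inner \<Omega> H H"
  by (simp add: D_div_inner_def L2_inner_def)

text \<open>The support \<open>K\<close> of a fixed cut-off fits into one member \<omega> of the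
  exhaustion, and on \<omega> all hypotheses of \<open>div_curl_continuous\<close> hold with global
  bounds.\<close>

theorem div_curl_local:
  fixes En Hn :: "nat \<Rightarrow> real^3 \<Rightarrow> real^3"
  assumes \<Omega>: "open \<Omega>"
    and \<phi>: "\<phi> \<in> C_inf_cutoff (frontier \<Omega>) \<Omega> \<union> C1_cutoff (frontier \<Omega>) \<Omega> \<union> Lip_cutoff (frontier \<Omega>) \<Omega>"
    and En: "\<And>n. En n \<in> D_curl_loc \<Omega>" "\<And>\<omega>. \<omega> \<in> compactly_inside \<Omega> \<Longrightarrow> norm_bounded (D_curl_inner \<omega>) En"
    and Hn: "\<And>n. Hn n \<in> D_div_loc \<Omega>" "\<And>\<omega>. \<omega> \<in> compactly_inside \<Omega> \<Longrightarrow> norm_bounded (D_div_inner \<omega>) Hn"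
    and E: "E \<in> L2_loc \<Omega>" "\<And>\<omega>. \<omega> \<in> compactly_inside \<Omega> \<Longrightarrow> weakly_converges (L2 \<omega>) (L2_inner \<omega>) En E"
    and H: "H \<in> L2_loc \<Omega>" "\<And>\<omega>. \<omega> \<in> compactly_inside \<Omega> \<Longrightarrow> weakly_converges (L2 \<omega>) (L2_inner \<omega>) Hn H"
  shows "(\<lambda>n. L2_inner \<Omega> (\<lambda>x. \<phi> x *\<^sub>R En n x) (Hn n)) \<longlonglongrightarrow> L2_inner \<Omega> (\<lambda>x. \<phi> x *\<^sub>R E x) H"
proof -
  obtain q K where q: "continuous_on UNIV q" "compact K" "K \<subseteq> \<Omega>" "\<And>x. x \<notin> K \<Longrightarrow> q x = 0" "\<And>x. x \<in> \<Omega> \<Longrightarrow> \<phi> x = q x"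
    using cutoffs_extension[OF \<Omega> \<phi>] by blast
  have "\<exists>\<omega>\<in>compactly_inside \<Omega>. K \<subseteq> \<omega>"
  proof (rule compactly_inside_exhaustion[OF \<Omega>])
    fix W :: "nat \<Rightarrow> (real^3) set"
    assume W: "\<And>n. W n \<in> compactly_inside \<Omega>" and "\<And>K. compact K \<Longrightarrow> K \<subseteq> \<Omega> \<Longrightarrow> \<exists>N. \<forall>n\<ge>N. K \<subseteq> W n"
    then obtain N where "\<forall>n\<ge>N. K \<subseteq> W n" using q(2,3) by blast
    then show ?thesis using W[of N] by blast
  qed
  then obtain \<omega> where \<omega>: "\<omega> \<in> compactly_inside \<Omega>" "K \<subseteq> \<omega>" by blast
  note \<omega>D = compactly_insideD[OF \<omega>(1)]
  obtain B1 where B1: "\<And>n. D_curl_inner \<omega> (En n) (En n) \<le> B1"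
    using norm_boundedD[OF En(2)[OF \<omega>(1)] D_curl_inner_nonneg] by blast
  obtain B2 where B2: "\<And>n. D_div_inner \<omega> (Hn n) (Hn n) \<le> B2"
    using norm_boundedD[OF Hn(2)[OF \<omega>(1)] D_div_inner_nonneg] by blast
  have "(\<lambda>n. L2_inner \<omega> (\<lambda>x. q x *\<^sub>R En n x) (Hn n)) \<longlonglongrightarrow> L2_inner \<omega> (\<lambda>x. q x *\<^sub>R E x) H"
  proof (rule div_curl_continuous[OF \<omega>D(1) q(1,2) \<omega>(2) q(4)])
    show "D_curl_inner \<omega> (En n) (En n) \<le> max B1 B2" "D_div_inner \<omega> (Hn n) (Hn n) \<le> max B1 B2" for n
      using B1[of n] B2[of n] by (simp_all add: le_max_iff_disj)
  qed (use En(1) Hn(1) E H \<omega>(1) in \<open>auto simp: D_curl_loc_def D_div_loc_def L2_loc_def\<close>)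
  moreover have "L2_inner \<Omega> (\<lambda>x. \<phi> x *\<^sub>R F x) G = L2_inner \<omega> (\<lambda>x. q x *\<^sub>R F x) G" for F G :: "real^3 \<Rightarrow> real^3"
    by (rule L2_inner_cutoff[OF \<Omega> \<omega>D(1) \<omega>(2) \<omega>D(4) q(4,5)])
  ultimately show ?thesis by simp
qed

section \<open>Weak compactness in local spaces\<close>

text \<open>
  Instead of a diagonal sequence we use one weighted space on the whole of \<open>\<Omega>\<close>, with a positive weight
  that decays so fast that the local bounds turn into a global bound.
\<close>

locale weighted_exhaustion =
  fixes \<Omega> :: "'a::euclidean_space set" and W :: "nat \<Rightarrow> 'a set" and C :: "nat \<Rightarrow> real"
  assumes \<Omega>: "open \<Omega>" and W: "\<And>n. W n \<in> compactly_inside \<Omega>"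
    and exhaust: "\<And>K. compact K \<Longrightarrow> K \<subseteq> \<Omega> \<Longrightarrow> \<exists>N. \<forall>n\<ge>N. K \<subseteq> W n"
    and C: "\<And>k. C k \<ge> 0"
begin

text \<open>Both \<open>c k\<close> and \<open>c k * C k\<close> are at most \<open>2^-k\<close>:
  the first makes the weight converge, the second makes the weighted local bounds summable.\<close>

definition c :: "nat \<Rightarrow> real" where
  "c k = (1/2)^k / (1 + C k)"

definition weight :: "'a \<Rightarrow> real" where
  "weight x = (\<Sum>k. c k * indicator (W k) x)"

definition M :: "'a measure" where
  "M = density (lebesgue_on \<Omega>) (\<lambda>x. ennreal (weight x))"

lemma c_pos: "c k > 0"
  using C[of k] by (simp add: c_def add_pos_nonneg)

lemma c_le: "c k \<le> (1/2)^k"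
  using C[of k] by (simp add: c_def divide_le_eq mult_left_le add_pos_nonneg)

lemma cC_le: "c k * C k \<le> (1/2)^k"
proof -
  have "C k / (1 + C k) \<le> 1" using C[of k] by (simp add: divide_le_eq add_pos_nonneg)
  then have "(1/2)^k * (C k / (1 + C k)) \<le> (1/2)^k * 1" by (intro mult_left_mono) auto
  then show ?thesis by (simp add: c_def)
qed

lemma summable_weight: "summable (\<lambda>k. c k * indicator (W k) x)"
proof (rule summable_comparison_test'[where N = 0])
  show "summable (\<lambda>k. (1/2 :: real)^k)" by (rule summable_geometric) simp
  show "norm (c k * indicator (W k) x) \<le> (1/2)^k" for k
    using c_le[of k] c_pos[of k] by (simp add: indicator_def abs_of_pos)
qed

lemma weight_nonneg: "weight x \<ge> 0"
  unfolding weight_def using c_pos by (intro suminf_nonneg summable_weight) (simp add: less_imp_le)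

lemma weight_ge: "x \<in> W k \<Longrightarrow> c k \<le> weight x"
  using sum_le_suminf[OF summable_weight[of x], of "{k}"] c_pos
  by (simp add: weight_def less_imp_le)

lemma weight_pos: "x \<in> W k \<Longrightarrow> weight x > 0"
  using weight_ge[of x k] c_pos[of k] by linarith

lemma W_sets: "W k \<in> sets lebesgue" "W k \<in> sets (lebesgue_on \<Omega>)"
  using open_sets_lebesgue[OF compactly_insideD(1)[OF W]] open_sets_lebesgue[OF \<Omega>] compactly_insideD(4)[OF W]
  by (auto simp: sets_restrict_space_iff)

lemma weight_measurable: "weight \<in> borel_measurable (lebesgue_on \<Omega>)"
proof -
  have [measurable]: "W k \<in> sets (lebesgue_on \<Omega>)" for k by (rule W_sets)
  show ?thesis unfolding weight_def[abs_def] by measurable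
qed

lemma measurable_M: "f \<in> borel_measurable M \<longleftrightarrow> f \<in> borel_measurable (lebesgue_on \<Omega>)"
  by (simp add: M_def)

lemma ip_M: "f \<in> borel_measurable (lebesgue_on \<Omega>) \<Longrightarrow> g \<in> borel_measurable (lebesgue_on \<Omega>) \<Longrightarrow>
    ip_on M f g = (\<integral>x. weight x * (f x \<bullet> g x) \<partial>lebesgue_on \<Omega>)"
  for f g :: "'a \<Rightarrow> 'b::euclidean_space"
  unfolding ip_on_def M_def
  by (subst integral_density) (auto simp: weight_measurable weight_nonneg)

lemma L2_M: "f \<in> L2_on M \<longleftrightarrow> f \<in> borel_measurable (lebesgue_on \<Omega>) \<and> integrable (lebesgue_on \<Omega>) (\<lambda>x. weight x * (norm (f x))\<^sup>2)"
  for f :: "'a \<Rightarrow> 'b::euclidean_space"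
proof -
  have "integrable M (\<lambda>x. (norm (f x))\<^sup>2) \<longleftrightarrow> integrable (lebesgue_on \<Omega>) (\<lambda>x. weight x * (norm (f x))\<^sup>2)"
    if [measurable]: "f \<in> borel_measurable (lebesgue_on \<Omega>)"
    unfolding M_def by (subst integrable_density) (auto simp: weight_measurable weight_nonneg)
  then show ?thesis by (auto simp: L2_on_def measurable_M)
qed

text \<open>Every point of \<Omega> lies in all late \<open>W k\<close>, so the truncations to
  \<open>W k\<close> converge pointwise to \<open>f\<close> on \<Omega>.\<close>

lemma local_measurable:
  fixes f :: "'a \<Rightarrow> 'b::euclidean_space"
  assumes f: "\<And>k. f \<in> borel_measurable (lebesgue_on (W k))"
  shows "f \<in> borel_measurable (lebesgue_on \<Omega>)"
proof (rule borel_measurable_LIMSEQ_metric)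
  have "(\<lambda>x. if x \<in> W k then f x else 0) \<in> borel_measurable lebesgue" for k
    using f[of k] by (rule borel_measurable_if_I) (rule W_sets)
  then show "(\<lambda>x. if x \<in> W k then f x else 0) \<in> borel_measurable (lebesgue_on \<Omega>)" for k
    by (rule measurable_restrict_space1)
  fix x assume "x \<in> space (lebesgue_on \<Omega>)"
  then obtain N where "\<forall>n\<ge>N. {x} \<subseteq> W n" using exhaust[of "{x}"] by (auto simp: space_restrict_space)
  then have "\<forall>\<^sub>F k in sequentially. (if x \<in> W k then f x else 0) = f x"
    by (intro eventually_sequentiallyI[of N]) auto
  then show "(\<lambda>k. if x \<in> W k then f x else 0) \<longlonglongrightarrow> f x" by (rule tendsto_eventually)
qed

text \<open>The weighted integral is the sum of the integrals over \<open>W k\<close> with factors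
  \<open>c k\<close>; the bound 2 is the sum of all \<open>2^-k\<close>.\<close>

lemma local_bound:
  fixes f :: "'a \<Rightarrow> 'b::euclidean_space"
  assumes f: "\<And>k. f \<in> L2_on (lebesgue_on (W k))" "\<And>k. ip_on (lebesgue_on (W k)) f f \<le> C k"
  shows "f \<in> L2_on M" "ip_on M f f \<le> 2"
proof -
  have fm[measurable]: "f \<in> borel_measurable (lebesgue_on \<Omega>)" by (rule local_measurable[OF L2_onD(1)[OF f(1)]])
  have [measurable]: "W k \<in> sets (lebesgue_on \<Omega>)" for k by (rule W_sets)
  note weight_measurable[measurable]
  have loc: "(\<integral>\<^sup>+x. ennreal (c k * indicator (W k) x * (norm (f x))\<^sup>2) \<partial>lebesgue_on \<Omega>) \<le> ennreal ((1/2)^k)" for k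
  proof -
    have S: "W k \<inter> space lebesgue \<in> sets lebesgue" "\<Omega> \<inter> space lebesgue \<in> sets lebesgue"
      using W_sets(1)[of k] open_sets_lebesgue[OF \<Omega>] by simp_all
    have eq: "(\<lambda>x. indicator \<Omega> x *\<^sub>R (indicator (W k) x * (norm (f x))\<^sup>2)) = (\<lambda>x. indicator (W k) x *\<^sub>R (norm (f x))\<^sup>2)"
      using compactly_insideD(4)[OF W[of k]] by (auto simp: indicator_def fun_eq_iff)
    have i: "integrable (lebesgue_on \<Omega>) (\<lambda>x. indicator (W k) x * (norm (f x))\<^sup>2)"
      using L2_onD(2)[OF f(1)[of k]]
      unfolding integrable_restrict_space[OF S(1)] integrable_restrict_space[OF S(2)] eq .
    have e: "(\<integral>x. indicator (W k) x * (norm (f x))\<^sup>2 \<partial>lebesgue_on \<Omega>) = ip_on (lebesgue_on (W k)) f f"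
      unfolding ip_on_def power2_norm_eq_inner[symmetric]
        integral_restrict_space[OF S(1)] integral_restrict_space[OF S(2)] eq ..
    have "(\<integral>\<^sup>+x. ennreal (c k * indicator (W k) x * (norm (f x))\<^sup>2) \<partial>lebesgue_on \<Omega>) =
        ennreal (\<integral>x. c k * (indicator (W k) x * (norm (f x))\<^sup>2) \<partial>lebesgue_on \<Omega>)"
      unfolding mult.assoc using c_pos[of k] i by (intro nn_integral_eq_integral) auto
    also have "\<dots> = ennreal (c k * ip_on (lebesgue_on (W k)) f f)" by (simp add: e)
    also have "\<dots> \<le> ennreal ((1/2)^k)"
      using c_pos[of k] by (intro ennreal_leI order_trans[OF mult_left_mono[OF f(2)[of k]] cC_le]) simp
    finally show ?thesis .
  qed
  have "(\<integral>\<^sup>+x. ennreal (weight x * (norm (f x))\<^sup>2) \<partial>lebesgue_on \<Omega>) =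
      (\<integral>\<^sup>+x. (\<Sum>k. ennreal (c k * indicator (W k) x * (norm (f x))\<^sup>2)) \<partial>lebesgue_on \<Omega>)"
  proof (rule nn_integral_cong)
    fix x
    have "weight x * (norm (f x))\<^sup>2 = (\<Sum>k. c k * indicator (W k) x * (norm (f x))\<^sup>2)"
      unfolding weight_def by (rule suminf_mult2[OF summable_weight])
    also have "ennreal \<dots> = (\<Sum>k. ennreal (c k * indicator (W k) x * (norm (f x))\<^sup>2))"
      using c_pos by (intro suminf_ennreal2[symmetric] summable_mult2 summable_weight) (simp add: less_imp_le)
    finally show "ennreal (weight x * (norm (f x))\<^sup>2) = (\<Sum>k. ennreal (c k * indicator (W k) x * (norm (f x))\<^sup>2))" .
  qed
  also have "\<dots> = (\<Sum>k. \<integral>\<^sup>+x. ennreal (c k * indicator (W k) x * (norm (f x))\<^sup>2) \<partial>lebesgue_on \<Omega>)"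
    by (rule nn_integral_suminf) measurable
  also have "\<dots> \<le> (\<Sum>k. ennreal ((1/2)^k))"
    by (intro suminf_le loc) auto
  also have "\<dots> = ennreal (\<Sum>k. (1/2)^k)" by (intro suminf_ennreal2) auto
  also have "(\<Sum>k. (1/2 :: real)^k) = 2" using suminf_geometric[of "1/2 :: real"] by simp
  finally have le: "(\<integral>\<^sup>+x. ennreal (weight x * (norm (f x))\<^sup>2) \<partial>lebesgue_on \<Omega>) \<le> ennreal 2" .
  have fin: "(\<integral>\<^sup>+x. ennreal (norm (weight x * (norm (f x))\<^sup>2)) \<partial>lebesgue_on \<Omega>) < \<infinity>"
    using le_less_trans[OF le] weight_nonneg by simp
  have int: "integrable (lebesgue_on \<Omega>) (\<lambda>x. weight x * (norm (f x))\<^sup>2)"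
    by (rule integrableI_bounded[OF _ fin]) measurable
  then show "f \<in> L2_on M" using fm by (simp add: L2_M)
  have "ennreal (\<integral>x. weight x * (norm (f x))\<^sup>2 \<partial>lebesgue_on \<Omega>) = (\<integral>\<^sup>+x. ennreal (weight x * (norm (f x))\<^sup>2) \<partial>lebesgue_on \<Omega>)"
    using int weight_nonneg by (intro nn_integral_eq_integral[symmetric]) auto
  with le have "ennreal (\<integral>x. weight x * (norm (f x))\<^sup>2 \<partial>lebesgue_on \<Omega>) \<le> ennreal 2" by (simp only:)
  then have "(\<integral>x. weight x * (norm (f x))\<^sup>2 \<partial>lebesgue_on \<Omega>) \<le> 2"
    by (subst (asm) ennreal_le_iff) auto
  then show "ip_on M f f \<le> 2" by (simp add: ip_M[OF fm fm] power2_norm_eq_inner)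
qed

text \<open>On \<open>W k\<close> the weight is at least \<open>c k > 0\<close>, so weighted square
  integrability implies the unweighted one there.\<close>

lemma L2_M_local:
  fixes u :: "'a \<Rightarrow> 'b::euclidean_space"
  assumes u: "u \<in> L2_on M" and \<omega>: "\<omega> \<in> sets lebesgue" "\<omega> \<subseteq> W k"
  shows "u \<in> L2_on (lebesgue_on \<omega>)"
proof -
  note sub = compactly_insideD(4)[OF W[of k]]
  have um: "u \<in> borel_measurable (lebesgue_on \<Omega>)"
    and ui: "integrable (lebesgue_on \<Omega>) (\<lambda>x. weight x * (norm (u x))\<^sup>2)" using u by (auto simp: L2_M)
  have m: "u \<in> borel_measurable (lebesgue_on \<omega>)"
    by (rule measurable_restrict_mono[OF um]) (use sub \<omega> in blast)
  have "integrable (lebesgue_on \<omega>) (\<lambda>x. weight x * (norm (u x))\<^sup>2 / c k)"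
    using integrable_lebesgue_on_subset[OF ui \<omega>(1) open_sets_lebesgue[OF \<Omega>]] sub \<omega>(2) by (intro integrable_divide_zero) auto
  then have "integrable (lebesgue_on \<omega>) (\<lambda>x. (norm (u x))\<^sup>2)"
  proof (rule Bochner_Integration.integrable_bound)
    show "(\<lambda>x. (norm (u x))\<^sup>2) \<in> borel_measurable (lebesgue_on \<omega>)" using m by measurable
    show "AE x in lebesgue_on \<omega>. norm ((norm (u x))\<^sup>2) \<le> norm (weight x * (norm (u x))\<^sup>2 / c k)"
    proof (rule AE_I2)
      fix x assume "x \<in> space (lebesgue_on \<omega>)"
      then have "x \<in> W k" using \<omega>(2) by (auto simp: space_restrict_space)
      then have "c k * (norm (u x))\<^sup>2 \<le> weight x * (norm (u x))\<^sup>2" by (intro mult_right_mono weight_ge) auto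
      then show "norm ((norm (u x))\<^sup>2) \<le> norm (weight x * (norm (u x))\<^sup>2 / c k)"
        using c_pos[of k] weight_nonneg[of x] by (simp add: pos_le_divide_eq mult.commute abs_mult)
    qed
  qed
  with m show ?thesis by (simp add: L2_on_def)
qed

text \<open>Dividing \<open>F\<close> by the weight cancels the density. The quotient stays in the
  weighted space because the weight is bounded below on \<omega>, so weak convergence there is at
  least as strong as on each \<omega>.\<close>

lemma weighted_test:
  fixes F :: "'a \<Rightarrow> 'b::euclidean_space"
  assumes F: "F \<in> L2_on (lebesgue_on \<omega>)" and \<omega>: "\<omega> \<in> sets lebesgue" "\<omega> \<subseteq> W k"
  obtains G where "G \<in> L2_on M" "\<And>f. f \<in> borel_measurable (lebesgue_on \<Omega>) \<Longrightarrow> ip_on M f G = ip_on (lebesgue_on \<omega>) f F"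
proof -
  have sub: "\<omega> \<subseteq> \<Omega>" using compactly_insideD(4)[OF W[of k]] \<omega>(2) by blast
  define F0 where "F0 x = (if x \<in> \<omega> then F x else 0)" for x
  define G where "G x = (1 / weight x) *\<^sub>R F0 x" for x
  have F0: "F0 \<in> L2_on (lebesgue_on \<Omega>)"
    unfolding F0_def[abs_def]
    by (rule L2_on_lebesgue_on[OF L2_on_zero_extension[OF F \<omega>(1)] open_sets_lebesgue[OF \<Omega>]])
  note [measurable] = L2_onD(1)[OF F0] weight_measurable
  have Gm: "G \<in> borel_measurable (lebesgue_on \<Omega>)" unfolding G_def[abs_def] by measurable
  have "integrable (lebesgue_on \<Omega>) (\<lambda>x. (norm (F0 x))\<^sup>2 / c k)" using L2_onD(2)[OF F0] by simp
  then have "integrable (lebesgue_on \<Omega>) (\<lambda>x. weight x * (norm (G x))\<^sup>2)"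
  proof (rule Bochner_Integration.integrable_bound)
    show "(\<lambda>x. weight x * (norm (G x))\<^sup>2) \<in> borel_measurable (lebesgue_on \<Omega>)" using Gm by measurable
    show "AE x in lebesgue_on \<Omega>. norm (weight x * (norm (G x))\<^sup>2) \<le> norm ((norm (F0 x))\<^sup>2 / c k)"
    proof (rule AE_I2)
      fix x
      show "norm (weight x * (norm (G x))\<^sup>2) \<le> norm ((norm (F0 x))\<^sup>2 / c k)"
      proof (cases "x \<in> \<omega>")
        case True
        then have w: "weight x > 0" "c k \<le> weight x" using \<omega>(2) weight_pos weight_ge by blast+
        have "weight x * (norm (G x))\<^sup>2 = (norm (F0 x))\<^sup>2 / weight x"
          using w(1) by (simp add: G_def power_divide power2_eq_square)
        also have "\<dots> \<le> (norm (F0 x))\<^sup>2 / c k"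
          using w c_pos[of k] by (intro divide_left_mono mult_pos_pos) auto
        finally show ?thesis using c_pos[of k] weight_nonneg[of x] by (simp add: abs_mult)
      qed (simp add: G_def F0_def)
    qed
  qed
  then have GL: "G \<in> L2_on M" using Gm by (simp add: L2_M)
  have "ip_on M f G = ip_on (lebesgue_on \<omega>) f F" if f: "f \<in> borel_measurable (lebesgue_on \<Omega>)" for f
  proof -
    have "weight x * (f x \<bullet> G x) = f x \<bullet> F0 x" for x
    proof (cases "x \<in> \<omega>")
      case True
      then have "weight x > 0" using \<omega>(2) weight_pos by blast
      then show ?thesis by (simp add: G_def)
    qed (simp add: G_def F0_def)
    then have "ip_on M f G = ip_on (lebesgue_on \<Omega>) f F0" unfolding ip_M[OF f Gm] by (simp add: ip_on_def)
    also have "\<dots> = ip_on (lebesgue_on \<omega>) f F0"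
      by (rule ip_on_superset) (use \<omega> sub open_sets_lebesgue[OF \<Omega>] in \<open>auto simp: F0_def\<close>)
    also have "\<dots> = ip_on (lebesgue_on \<omega>) f F"
      unfolding ip_on_def by (rule Bochner_Integration.integral_cong) (auto simp: F0_def space_restrict_space)
    finally show ?thesis .
  qed
  with GL that show ?thesis by blast
qed

end

text \<open>One extraction in the weighted space serves every \<omega> at once, since each \<omega>
  lies in some \<open>W k\<close>; in particular the limit \<open>u\<close> does not depend on
  \<omega>.\<close>

theorem local_weak_compactness:
  fixes f :: "nat \<Rightarrow> 'a::euclidean_space \<Rightarrow> 'b::euclidean_space"
  assumes \<Omega>: "open \<Omega>" and f: "\<And>n. f n \<in> L2_loc \<Omega>"
    and bd: "\<And>\<omega>. \<omega> \<in> compactly_inside \<Omega> \<Longrightarrow> \<exists>B. \<forall>n. L2_inner \<omega> (f n) (f n) \<le> B"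
  shows "\<exists>r u. strict_mono (r :: nat \<Rightarrow> nat) \<and> u \<in> L2_loc \<Omega> \<and>
    (\<forall>\<omega>\<in>compactly_inside \<Omega>. weakly_converges (L2 \<omega>) (L2_inner \<omega>) (\<lambda>n. f (r n)) u)"
proof (rule compactly_inside_exhaustion[OF \<Omega>])
  fix W :: "nat \<Rightarrow> 'a set"
  assume W: "\<And>n. W n \<in> compactly_inside \<Omega>"
    and ex: "\<And>K. compact K \<Longrightarrow> K \<subseteq> \<Omega> \<Longrightarrow> \<exists>N. \<forall>n\<ge>N. K \<subseteq> W n"
  have fL: "f n \<in> L2_on (lebesgue_on (W k))" for n k
    using f[of n] W[of k] by (auto simp: L2_loc_def L2_eq)
  obtain C where fC: "\<And>k n. ip_on (lebesgue_on (W k)) (f n) (f n) \<le> C k"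
    using bd[OF W] unfolding L2_inner_eq by metis
  have C0: "0 \<le> C k" for k
    using fC[of k 0] L2_on.ip_nonneg[OF fL[of 0 k]] by linarith
  interpret weighted_exhaustion \<Omega> W C
    by unfold_locales (use \<Omega> W ex C0 in blast)+
  obtain r u where r: "strict_mono (r :: nat \<Rightarrow> nat)" and u: "u \<in> L2_on M"
    and lim: "\<And>w. w \<in> L2_on M \<Longrightarrow> (\<lambda>n. ip_on M (f (r n)) w) \<longlonglongrightarrow> ip_on M u w"
    using L2_on.weakly_compact[of f M 2, OF local_bound(1)[OF fL fC] local_bound(2)[OF fL fC]] by blast
  have um: "u \<in> borel_measurable (lebesgue_on \<Omega>)" using u by (simp add: L2_M)
  have fm: "f n \<in> borel_measurable (lebesgue_on \<Omega>)" for n by (rule local_measurable[OF L2_onD(1)[OF fL]])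
  have in_W: "\<exists>k. \<omega> \<subseteq> W k" if "\<omega> \<in> compactly_inside \<Omega>" for \<omega>
    using ex[OF compactly_insideD(2,3)[OF that]] closure_subset[of \<omega>] by blast
  have "u \<in> L2 \<omega>" if "\<omega> \<in> compactly_inside \<Omega>" for \<omega>
    using in_W[OF that] L2_M_local[OF u open_sets_lebesgue[OF compactly_insideD(1)[OF that]]] by (auto simp: L2_eq)
  then have "u \<in> L2_loc \<Omega>" by (simp add: L2_loc_def)
  moreover have "weakly_converges (L2 \<omega>) (L2_inner \<omega>) (\<lambda>n. f (r n)) u" if \<omega>: "\<omega> \<in> compactly_inside \<Omega>" for \<omega>
    unfolding weakly_converges_def L2_eq L2_inner_eq
  proof
    fix F :: "'a \<Rightarrow> 'b" assume F: "F \<in> L2_on (lebesgue_on \<omega>)"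
    obtain k where k: "\<omega> \<subseteq> W k" using in_W[OF \<omega>] by blast
    obtain G where G: "G \<in> L2_on M" and eq: "\<And>f. f \<in> borel_measurable (lebesgue_on \<Omega>) \<Longrightarrow> ip_on M f G = ip_on (lebesgue_on \<omega>) f F"
      using weighted_test[OF F open_sets_lebesgue[OF compactly_insideD(1)[OF \<omega>]] k] by blast
    show "(\<lambda>n. ip_on (lebesgue_on \<omega>) (f (r n)) F) \<longlonglongrightarrow> ip_on (lebesgue_on \<omega>) u F"
      using lim[OF G] by (simp add: eq[OF fm] eq[OF um])
  qed
  ultimately show ?thesis using r by blast
qed

lemma weakly_converges_subseq:
  "weakly_converges V ip u l \<Longrightarrow> strict_mono r \<Longrightarrow> weakly_converges V ip (\<lambda>n. u (r n)) l"
  unfolding weakly_converges_def using LIMSEQ_subseq_LIMSEQ[of _ _ r] by (fastforce simp: o_def)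

lemma norm_bounded_subseq: "norm_bounded ip u \<Longrightarrow> norm_bounded ip (\<lambda>n. u (r n))"
  by (auto simp: norm_bounded_def)

text \<open>Extract for \<open>En\<close>, then again for \<open>Hn\<close> along the first
  subsequence. On each \<omega> the graph bounds upgrade the weak L2 limits to limits in the graph
  spaces, and \<open>div_curl_local\<close> applies to the common subsequence.\<close>

lemma div_curl_subsequence:
  fixes En Hn :: "nat \<Rightarrow> real^3 \<Rightarrow> real^3"
  assumes \<Omega>: "open \<Omega>"
    and En: "\<And>n. En n \<in> D_curl_loc \<Omega>" "\<And>\<omega>. \<omega> \<in> compactly_inside \<Omega> \<Longrightarrow> norm_bounded (D_curl_inner \<omega>) En"
    and Hn: "\<And>n. Hn n \<in> D_div_loc \<Omega>" "\<And>\<omega>. \<omega> \<in> compactly_inside \<Omega> \<Longrightarrow> norm_bounded (D_div_inner \<omega>) Hn"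
  shows "\<exists>r E H. strict_mono (r :: nat \<Rightarrow> nat) \<and> E \<in> D_curl_loc \<Omega> \<and> H \<in> D_div_loc \<Omega> \<and>
    (\<forall>\<omega> \<in> compactly_inside \<Omega>. weakly_converges (D_curl \<omega>) (D_curl_inner \<omega>) (\<lambda>n. En (r n)) E) \<and>
    (\<forall>\<omega> \<in> compactly_inside \<Omega>. weakly_converges (D_div \<omega>) (D_div_inner \<omega>) (\<lambda>n. Hn (r n)) H) \<and>
    (\<forall>\<phi> \<in> C_inf_cutoff (frontier \<Omega>) \<Omega> \<union> C1_cutoff (frontier \<Omega>) \<Omega> \<union> Lip_cutoff (frontier \<Omega>) \<Omega>.
      (\<lambda>n. L2_inner \<Omega> (\<lambda>x. \<phi> x *\<^sub>R En (r n) x) (Hn (r n))) \<longlonglongrightarrow> L2_inner \<Omega> (\<lambda>x. \<phi> x *\<^sub>R E x) H)"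
proof -
  have Ec: "En n \<in> D_curl \<omega>" and Hc: "Hn n \<in> D_div \<omega>" if "\<omega> \<in> compactly_inside \<Omega>" for \<omega> n
    using En(1)[of n] Hn(1)[of n] that by (auto simp: D_curl_loc_def D_div_loc_def)
  have EB: "\<exists>B. \<forall>n. D_curl_inner \<omega> (En n) (En n) \<le> B" if "\<omega> \<in> compactly_inside \<Omega>" for \<omega>
    using norm_boundedD[OF En(2)[OF that] D_curl_inner_nonneg] by blast
  have HB: "\<exists>B. \<forall>n. D_div_inner \<omega> (Hn n) (Hn n) \<le> B" if "\<omega> \<in> compactly_inside \<Omega>" for \<omega>
    using norm_boundedD[OF Hn(2)[OF that] D_div_inner_nonneg] by blast
  have EL: "En n \<in> L2_loc \<Omega>" and HL: "Hn n \<in> L2_loc \<Omega>" for n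
    using D_curlD(1)[OF compactly_insideD(1) Ec] D_divD(1)[OF compactly_insideD(1) Hc] by (auto simp: L2_loc_def)
  have EB2: "\<exists>B. \<forall>n. L2_inner \<omega> (En n) (En n) \<le> B" if \<omega>: "\<omega> \<in> compactly_inside \<Omega>" for \<omega>
    using EB[OF \<omega>] D_curlD(4)[OF compactly_insideD(1)[OF \<omega>] Ec[OF \<omega>]] by (meson order_trans)
  have HB2: "\<exists>B. \<forall>n. L2_inner \<omega> (Hn n) (Hn n) \<le> B" if \<omega>: "\<omega> \<in> compactly_inside \<Omega>" for \<omega>
    using HB[OF \<omega>] D_divD(4)[OF compactly_insideD(1)[OF \<omega>] Hc[OF \<omega>]] by (meson order_trans)
  obtain r1 E where r1: "strict_mono (r1 :: nat \<Rightarrow> nat)" and E: "E \<in> L2_loc \<Omega>"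
    and Ew1: "\<And>\<omega>. \<omega> \<in> compactly_inside \<Omega> \<Longrightarrow> weakly_converges (L2 \<omega>) (L2_inner \<omega>) (\<lambda>n. En (r1 n)) E"
    using local_weak_compactness[OF \<Omega> EL EB2] by blast
  have "\<exists>B. \<forall>n. L2_inner \<omega> (Hn (r1 n)) (Hn (r1 n)) \<le> B" if "\<omega> \<in> compactly_inside \<Omega>" for \<omega>
    using HB2[OF that] by blast
  from local_weak_compactness[OF \<Omega> HL this]
  obtain r2 H where r2: "strict_mono (r2 :: nat \<Rightarrow> nat)" and H: "H \<in> L2_loc \<Omega>"
    and Hw: "\<And>\<omega>. \<omega> \<in> compactly_inside \<Omega> \<Longrightarrow> weakly_converges (L2 \<omega>) (L2_inner \<omega>) (\<lambda>n. Hn (r1 (r2 n))) H"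
    by blast
  define r where "r n = r1 (r2 n)" for n
  have r: "strict_mono r" using r1 r2 by (simp add: r_def strict_mono_def)
  have Ew: "weakly_converges (L2 \<omega>) (L2_inner \<omega>) (\<lambda>n. En (r n)) E"
    and Hw: "weakly_converges (L2 \<omega>) (L2_inner \<omega>) (\<lambda>n. Hn (r n)) H" if "\<omega> \<in> compactly_inside \<Omega>" for \<omega>
    using weakly_converges_subseq[OF Ew1[OF that] r2] Hw[OF that] by (simp_all add: r_def)
  have ED: "E \<in> D_curl \<omega> \<and> weakly_converges (D_curl \<omega>) (D_curl_inner \<omega>) (\<lambda>n. En (r n)) E"
    if \<omega>: "\<omega> \<in> compactly_inside \<Omega>" for \<omega>
  proof -
    obtain B where B: "\<And>n. D_curl_inner \<omega> (En n) (En n) \<le> B" using EB[OF \<omega>] by blast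
    have "E \<in> L2 \<omega>" using E \<omega> by (simp add: L2_loc_def)
    from D_curl_weak_limit[OF compactly_insideD(1)[OF \<omega>] Ec[OF \<omega>] B this Ew[OF \<omega>]] show ?thesis by blast
  qed
  have HD: "H \<in> D_div \<omega> \<and> weakly_converges (D_div \<omega>) (D_div_inner \<omega>) (\<lambda>n. Hn (r n)) H"
    if \<omega>: "\<omega> \<in> compactly_inside \<Omega>" for \<omega>
  proof -
    obtain B where B: "\<And>n. D_div_inner \<omega> (Hn n) (Hn n) \<le> B" using HB[OF \<omega>] by blast
    have "H \<in> L2 \<omega>" using H \<omega> by (simp add: L2_loc_def)
    from D_div_weak_limit[OF compactly_insideD(1)[OF \<omega>] Hc[OF \<omega>] B this Hw[OF \<omega>]] show ?thesis by blast
  qed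
  have "E \<in> D_curl_loc \<Omega>" "H \<in> D_div_loc \<Omega>" using ED HD by (auto simp: D_curl_loc_def D_div_loc_def)
  moreover have "(\<lambda>n. L2_inner \<Omega> (\<lambda>x. \<phi> x *\<^sub>R En (r n) x) (Hn (r n))) \<longlonglongrightarrow> L2_inner \<Omega> (\<lambda>x. \<phi> x *\<^sub>R E x) H"
    if "\<phi> \<in> C_inf_cutoff (frontier \<Omega>) \<Omega> \<union> C1_cutoff (frontier \<Omega>) \<Omega> \<union> Lip_cutoff (frontier \<Omega>) \<Omega>" for \<phi>
    by (rule div_curl_local[OF \<Omega> that En(1) norm_bounded_subseq[OF En(2)] Hn(1) norm_bounded_subseq[OF Hn(2)] E Ew H Hw])
  ultimately show ?thesis using r ED HD by blast
qed

section \<open>The globally defined case and the conclusion\<close>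

text \<open>Weak convergence in the graph spaces supplies what \<open>div_curl_continuous\<close>
  asks for: the uniform boundedness principle gives the bounds, and weak convergence in L2 comes
  from \<open>dom_weak_convergence\<close>.\<close>

theorem div_curl_global:
  fixes En Hn :: "nat \<Rightarrow> real^3 \<Rightarrow> real^3"
  assumes \<Omega>: "open \<Omega>"
    and \<phi>: "\<phi> \<in> C_inf_cutoff (frontier \<Omega>) \<Omega> \<union> C1_cutoff (frontier \<Omega>) \<Omega> \<union> Lip_cutoff (frontier \<Omega>) \<Omega>"
    and En: "\<And>n. En n \<in> D_curl \<Omega>" "E \<in> D_curl \<Omega>" "weakly_converges (D_curl \<Omega>) (D_curl_inner \<Omega>) En E"
    and Hn: "\<And>n. Hn n \<in> D_div \<Omega>" "H \<in> D_div \<Omega>" "weakly_converges (D_div \<Omega>) (D_div_inner \<Omega>) Hn H"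
  shows "(\<lambda>n. L2_inner \<Omega> (\<lambda>x. \<phi> x *\<^sub>R En n x) (Hn n)) \<longlonglongrightarrow> L2_inner \<Omega> (\<lambda>x. \<phi> x *\<^sub>R E x) H"
proof -
  obtain q K where q: "continuous_on UNIV q" "compact K" "K \<subseteq> \<Omega>" "\<And>x. x \<notin> K \<Longrightarrow> q x = 0" "\<And>x. x \<in> \<Omega> \<Longrightarrow> \<phi> x = q x"
    using cutoffs_extension[OF \<Omega> \<phi>] by blast
  note Ew = D_curl_weak_convergence[OF \<Omega> En] and Hw = D_div_weak_convergence[OF \<Omega> Hn]
  obtain B1 B2 where B: "\<And>n. D_curl_inner \<Omega> (En n) (En n) \<le> B1" "\<And>n. D_div_inner \<Omega> (Hn n) (Hn n) \<le> B2"
    using Ew(1) Hw(1) by blast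
  have "(\<lambda>n. L2_inner \<Omega> (\<lambda>x. q x *\<^sub>R En n x) (Hn n)) \<longlonglongrightarrow> L2_inner \<Omega> (\<lambda>x. q x *\<^sub>R E x) H"
  proof (rule div_curl_continuous[OF \<Omega> q(1-4) En(1) _ Hn(1) _ D_curlD(1)[OF \<Omega> En(2)] Ew(2) D_divD(1)[OF \<Omega> Hn(2)] Hw(2)])
    show "D_curl_inner \<Omega> (En n) (En n) \<le> max B1 B2" "D_div_inner \<Omega> (Hn n) (Hn n) \<le> max B1 B2" for n
      using B(1,2)[of n] by (simp_all add: le_max_iff_disj)
  qed
  moreover have "L2_inner \<Omega> (\<lambda>x. \<phi> x *\<^sub>R F x) G = L2_inner \<Omega> (\<lambda>x. q x *\<^sub>R F x) G" for F G :: "real^3 \<Rightarrow> real^3"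
    by (rule L2_inner_cutoff[OF \<Omega> \<Omega> q(3) subset_refl q(4,5)])
  ultimately show ?thesis by simp
qed

text \<open>Local bounds alone do not determine limits of the full sequences. The second part
  therefore has two forms: convergence of the full sequence when local weak L2 limits are given, and
  otherwise convergence along a subsequence whose limits are produced and lie in the local graph
  spaces.\<close>

theorem corollary1:
  fixes \<Omega> \<Gamma> :: "(real^3) set"
  assumes "open \<Omega>" and "\<Gamma> = frontier \<Omega>"
  shows
    "(\<forall>(En :: nat \<Rightarrow> real^3 \<Rightarrow> real^3) E (Hn :: nat \<Rightarrow> real^3 \<Rightarrow> real^3) H.
        (\<forall>n. En n \<in> D_curl \<Omega>) \<and> E \<in> D_curl \<Omega> \<and>
        weakly_converges (D_curl \<Omega>) (D_curl_inner \<Omega>) En E \<and>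
        (\<forall>n. Hn n \<in> D_div \<Omega>) \<and> H \<in> D_div \<Omega> \<and>
        weakly_converges (D_div \<Omega>) (D_div_inner \<Omega>) Hn H \<longrightarrow>
        (\<forall>\<phi> \<in> C_inf_cutoff \<Gamma> \<Omega> \<union> C1_cutoff \<Gamma> \<Omega> \<union> Lip_cutoff \<Gamma> \<Omega>.
           (\<lambda>n. L2_inner \<Omega> (\<lambda>x. \<phi> x *\<^sub>R En n x) (Hn n))
             \<longlonglongrightarrow> L2_inner \<Omega> (\<lambda>x. \<phi> x *\<^sub>R E x) H))
     \<and>
     (\<forall>(En :: nat \<Rightarrow> real^3 \<Rightarrow> real^3) (Hn :: nat \<Rightarrow> real^3 \<Rightarrow> real^3).
        (\<forall>n. En n \<in> D_curl_loc \<Omega>) \<and>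
        (\<forall>\<omega> \<in> compactly_inside \<Omega>. norm_bounded (D_curl_inner \<omega>) En) \<and>
        (\<forall>n. Hn n \<in> D_div_loc \<Omega>) \<and>
        (\<forall>\<omega> \<in> compactly_inside \<Omega>. norm_bounded (D_div_inner \<omega>) Hn) \<longrightarrow>
        (\<forall>E \<in> L2_loc \<Omega>. \<forall>H \<in> L2_loc \<Omega>.
           (\<forall>\<omega> \<in> compactly_inside \<Omega>. weakly_converges (L2 \<omega>) (L2_inner \<omega>) En E) \<and>
           (\<forall>\<omega> \<in> compactly_inside \<Omega>. weakly_converges (L2 \<omega>) (L2_inner \<omega>) Hn H) \<longrightarrow>
           (\<forall>\<phi> \<in> C_inf_cutoff \<Gamma> \<Omega> \<union> C1_cutoff \<Gamma> \<Omega> \<union> Lip_cutoff \<Gamma> \<Omega>.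
              (\<lambda>n. L2_inner \<Omega> (\<lambda>x. \<phi> x *\<^sub>R En n x) (Hn n))
                \<longlonglongrightarrow> L2_inner \<Omega> (\<lambda>x. \<phi> x *\<^sub>R E x) H))
        \<and>
        (\<exists>r E H. strict_mono (r :: nat \<Rightarrow> nat) \<and> E \<in> D_curl_loc \<Omega> \<and> H \<in> D_div_loc \<Omega> \<and>
           (\<forall>\<omega> \<in> compactly_inside \<Omega>.
              weakly_converges (D_curl \<omega>) (D_curl_inner \<omega>) (\<lambda>n. En (r n)) E) \<and>
           (\<forall>\<omega> \<in> compactly_inside \<Omega>.
              weakly_converges (D_div \<omega>) (D_div_inner \<omega>) (\<lambda>n. Hn (r n)) H) \<and>
           (\<forall>\<phi> \<in> C_inf_cutoff \<Gamma> \<Omega> \<union> C1_cutoff \<Gamma> \<Omega> \<union> Lip_cutoff \<Gamma> \<Omega>.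
              (\<lambda>n. L2_inner \<Omega> (\<lambda>x. \<phi> x *\<^sub>R En (r n) x) (Hn (r n)))
                \<longlonglongrightarrow> L2_inner \<Omega> (\<lambda>x. \<phi> x *\<^sub>R E x) H)))"
  unfolding assms(2)
proof (intro conjI allI impI, goal_cases)
  case (1 En E Hn H)
  then show ?case using div_curl_global[OF assms(1)] by blast
next
  case (2 En Hn)
  then show ?case using div_curl_local[OF assms(1)] by blast
next
  case (3 En Hn)
  then show ?case using div_curl_subsequence[OF assms(1)] by blast
qed

end
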